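(* Let $k$ be a field, let $q\in k$, let $\Lambda_q=k\langle x,y\rangle/(x^2,\,xy+qyx,\,y^2)$, and let $E(\Lambda_q)=\mathrm{Ext}^*_{\Lambda_q}(k,k)\cong k\langle x,y\rangle/(yx-qxy)$ be its Koszul dual. Then the graded centre of $E(\Lambda_q)$ is $$Z_{\mathrm{gr}}(E(\Lambda_q))=\begin{cases} k, & \text{if } q \text{ is not a root of unity},\\ k[x^r,y^r], & \text{if } q \text{ is a primitive } r\text{-th root of unity and either } r \text{ is even or } \mathrm{char}\,k=2,\\ k[x^{2r},x^ry^r,y^{2r}], & \text{otherwise, i.e. if } q \text{ is a primitive } r\text{-th root of unity, } r \text{ is odd and } \mathrm{char}\,k\neq 2.\end{cases}$$
   Context: $k\langle x,y\rangle$ is the free associative (non-commutative) $k$-algebra on $x,y$, and $(\dots)$ denotes the two-sided ideal generated by the listed elements. In $E(\Lambda_q)=\mathrm{Ext}^*_{\Lambda_q}(k,k)$, $k$ is the simple $\Lambda_q$-module on which $x,y$ act as zero, the multiplication is the Yoneda product, and under the identification $E(\Lambda_q)\cong k\langle x,y\rangle/(yx-qxy)$ the generators $x,y$ have cohomological degree $1$. The value $q=0$ is included in the case "$q$ is not a root of unity". For a graded ring $E$, the graded centre $Z_{\mathrm{gr}}(E)$ is the subring generated by the homogeneous elements $z\in E$ such that $z\gamma=(-1)^{\deg z\,\deg\gamma}\gamma z$ for all homogeneous $\gamma\in E$. The notation $k[\dots]$ on the right-hand side denotes the $k$-subalgebra of $k\langle x,y\rangle/(yx-qxy)$ generated by the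 listed elements. *)

theory Defs
  imports "HOL-Library.Poly_Mapping" "HOL-Library.FuncSet" "HOL-Algebra.Algebra"
    "HOL-Algebra.Algebraic_Closure_Type"
begin

section \<open>Graded algebras over a field\<close>

text \<open>A \<open>k\<close>-algebra is a (not necessarily commutative) ring with a structure map
  \<open>scalar\<close> from \<open>k\<close> to its centre; \<open>homog A n\<close> is the set of homogeneous elements of
  degree \<open>n\<close>, including zero.\<close>

record ('k, 'a) graded_algebra = "'a ring" +
  scalar :: "'k \<Rightarrow> 'a"
  homog :: "nat \<Rightarrow> 'a set"

definition subalgebra_generated :: "('k, 'a) graded_algebra \<Rightarrow> 'a set \<Rightarrow> 'a set" where
  "subalgebra_generated A S = generate_ring A (range (scalar A) \<union> S)"

definition graded_algebra_iso ::
    "('k, 'a) graded_algebra \<Rightarrow> ('k, 'b) graded_algebra \<Rightarrow> ('a \<Rightarrow> 'b) set" where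
  "graded_algebra_iso A B = {\<phi> \<in> ring_iso A B.
     (\<forall>c. \<phi> (scalar A c) = scalar B c) \<and> (\<forall>n. \<phi> ` homog A n = homog B n)}"

definition graded_centre :: "('k, 'a) graded_algebra \<Rightarrow> 'a set" where
  "graded_centre E = generate_ring E
     {z. \<exists>m. z \<in> homog E m \<and> (\<forall>n. \<forall>g \<in> homog E n.
        z \<otimes>\<^bsub>E\<^esub> g = (if even (m * n) then g \<otimes>\<^bsub>E\<^esub> z else \<ominus>\<^bsub>E\<^esub> (g \<otimes>\<^bsub>E\<^esub> z)))}"


section \<open>The free algebra on \<open>x\<close>, \<open>y\<close> and its quotients\<close>

datatype letter = LX | LY

text \<open>The free monoid on \<open>x, y\<close>, written additively so that \<^typ>\<open>'m \<Rightarrow>\<^sub>0 'k\<close> is its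
  monoid algebra.\<close>

datatype word = Word (letters: "letter list")

instantiation word :: monoid_add
begin
definition zero_word :: word where "0 = Word []"
definition plus_word :: "word \<Rightarrow> word \<Rightarrow> word" where
  "u + v = Word (letters u @ letters v)"
instance by standard (simp_all add: zero_word_def plus_word_def)
end

type_synonym 'k free_alg = "word \<Rightarrow>\<^sub>0 'k"

definition free_const :: "'k::field \<Rightarrow> 'k free_alg" where
  "free_const c = Poly_Mapping.single 0 c"

definition free_var :: "letter \<Rightarrow> 'k::field free_alg" where
  "free_var a = Poly_Mapping.single (Word [a]) 1"

text \<open>\<open>k\<langle>x,y\<rangle>/(S)\<close>, graded by word length; the set \<open>S\<close> of relations is meant to be
  homogeneous.\<close>

definition presented_algebra ::
    "'k::field free_alg set \<Rightarrow> ('k, 'k free_alg set) graded_algebra" where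
  "presented_algebra S =
    (let F = ring_of_type_algebra :: 'k free_alg ring; I = genideal F S; Q = F Quot I in
     \<lparr>carrier = carrier Q, monoid.mult = monoid.mult Q, monoid.one = monoid.one Q,
      ring.zero = ring.zero Q, ring.add = ring.add Q,
      scalar = (\<lambda>c. I +>\<^bsub>F\<^esub> free_const c),
      homog = (\<lambda>n. {I +>\<^bsub>F\<^esub> p |p. \<forall>w \<in> Poly_Mapping.keys p. length (letters w) = n})\<rparr>)"

definition Lambda_rels :: "'k::field \<Rightarrow> 'k free_alg set" where
  "Lambda_rels q = {free_var LX * free_var LX, free_var LX * free_var LY + free_const q * (free_var LY * free_var LX), free_var LY * free_var LY}"

definition Lambda :: "'k::field \<Rightarrow> ('k, 'k free_alg set) graded_algebra" where
  "Lambda q = presented_algebra (Lambda_rels q)"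

definition qplane_rels :: "'k::field \<Rightarrow> 'k free_alg set" where
  "qplane_rels q = {free_var LY * free_var LX - free_const q * (free_var LX * free_var LY)}"

definition qplane :: "'k::field \<Rightarrow> ('k, 'k free_alg set) graded_algebra" where
  "qplane q = presented_algebra (qplane_rels q)"

definition qplane_var :: "'k::field \<Rightarrow> letter \<Rightarrow> 'k free_alg set" where
  "qplane_var q a = genideal ring_of_type_algebra (qplane_rels q) +>\<^bsub>ring_of_type_algebra\<^esub> free_var a"


section \<open>Left modules and projective resolutions\<close>

text \<open>The locale \<^locale>\<open>module\<close> of the library requires a commutative ring. The fields \<open>mult\<close>
  and \<open>one\<close> of the record type of modules play no role.\<close>

locale left_module = R?: ring R + M?: abelian_group M
    for R :: "('a, 'c) ring_scheme" (structure) and M :: "('a, 'b, 'd) module_scheme" (structure) +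
  assumes smult_closed:
      "\<lbrakk>a \<in> carrier R; x \<in> carrier M\<rbrakk> \<Longrightarrow> a \<odot>\<^bsub>M\<^esub> x \<in> carrier M"
    and smult_l_distr:
      "\<lbrakk>a \<in> carrier R; b \<in> carrier R; x \<in> carrier M\<rbrakk> \<Longrightarrow>
        (a \<oplus>\<^bsub>R\<^esub> b) \<odot>\<^bsub>M\<^esub> x = a \<odot>\<^bsub>M\<^esub> x \<oplus>\<^bsub>M\<^esub> b \<odot>\<^bsub>M\<^esub> x"
    and smult_r_distr:
      "\<lbrakk>a \<in> carrier R; x \<in> carrier M; y \<in> carrier M\<rbrakk> \<Longrightarrow>
        a \<odot>\<^bsub>M\<^esub> (x \<oplus>\<^bsub>M\<^esub> y) = a \<odot>\<^bsub>M\<^esub> x \<oplus>\<^bsub>M\<^esub> a \<odot>\<^bsub>M\<^esub> y"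
    and smult_assoc1:
      "\<lbrakk>a \<in> carrier R; b \<in> carrier R; x \<in> carrier M\<rbrakk> \<Longrightarrow>
        (a \<otimes>\<^bsub>R\<^esub> b) \<odot>\<^bsub>M\<^esub> x = a \<odot>\<^bsub>M\<^esub> (b \<odot>\<^bsub>M\<^esub> x)"
    and smult_one:
      "x \<in> carrier M \<Longrightarrow> \<one>\<^bsub>R\<^esub> \<odot>\<^bsub>M\<^esub> x = x"

definition lmod_hom ::
    "('a, 'c) ring_scheme \<Rightarrow> ('a, 'b, 'd) module_scheme \<Rightarrow> ('a, 'e, 'f) module_scheme
      \<Rightarrow> ('b \<Rightarrow> 'e) set" where
  "lmod_hom R M N = {f \<in> carrier M \<rightarrow>\<^sub>E carrier N.
     (\<forall>x \<in> carrier M. \<forall>y \<in> carrier M. f (x \<oplus>\<^bsub>M\<^esub> y) = f x \<oplus>\<^bsub>N\<^esub> f y) \<and>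
     (\<forall>r \<in> carrier R. \<forall>x \<in> carrier M. f (r \<odot>\<^bsub>M\<^esub> x) = r \<odot>\<^bsub>N\<^esub> f x)}"

text \<open>The free left module with basis indexed by \<open>I\<close>.\<close>

definition free_lmod :: "('a, 'c) ring_scheme \<Rightarrow> 'i set \<Rightarrow> ('a, 'i \<Rightarrow> 'a) module" where
  "free_lmod R I =
    \<lparr>carrier = {c \<in> I \<rightarrow>\<^sub>E carrier R. finite {i \<in> I. c i \<noteq> \<zero>\<^bsub>R\<^esub>}},
     monoid.mult = undefined, monoid.one = undefined,
     ring.zero = (\<lambda>i\<in>I. \<zero>\<^bsub>R\<^esub>), ring.add = (\<lambda>c d. \<lambda>i\<in>I. c i \<oplus>\<^bsub>R\<^esub> d i),
     module.smult = (\<lambda>r c. \<lambda>i\<in>I. r \<otimes>\<^bsub>R\<^esub> c i)\<rparr>"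

text \<open>Projective means direct summand of a free module. Index sets in the type of the elements
  of \<open>M\<close> suffice, since \<open>M\<close> is a quotient of the free module on its own underlying set.\<close>

definition projective_lmod :: "('a, 'c) ring_scheme \<Rightarrow> ('a, 'b, 'd) module_scheme \<Rightarrow> bool" where
  "projective_lmod R M \<longleftrightarrow> left_module R M \<and>
     (\<exists>(I :: 'b set) s p. s \<in> lmod_hom R M (free_lmod R I) \<and> p \<in> lmod_hom R (free_lmod R I) M \<and>
        (\<forall>x \<in> carrier M. p (s x) = x))"

text \<open>\<open>d j : P j \<rightarrow> P (j - 1)\<close>, with \<open>P j = 0\<close> for \<open>j < 0\<close>, and augmentation \<open>e : P 0 \<rightarrow> N\<close>.\<close>

definition projective_resolution ::
    "('a, 'c) ring_scheme \<Rightarrow> ('a, 'n, 'f) module_scheme \<Rightarrow> (int \<Rightarrow> ('a, 'p) module)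
      \<Rightarrow> (int \<Rightarrow> 'p \<Rightarrow> 'p) \<Rightarrow> ('p \<Rightarrow> 'n) \<Rightarrow> bool" where
  "projective_resolution R N P d e \<longleftrightarrow>
     (\<forall>j. projective_lmod R (P j)) \<and>
     (\<forall>j < 0. carrier (P j) = {\<zero>\<^bsub>P j\<^esub>}) \<and>
     (\<forall>j. d j \<in> lmod_hom R (P j) (P (j - 1))) \<and>
     (\<forall>j > 0. {x \<in> carrier (P j). d j x = \<zero>\<^bsub>P (j - 1)\<^esub>} = d (j + 1) ` carrier (P (j + 1))) \<and>
     e \<in> lmod_hom R (P 0) N \<and> e ` carrier (P 0) = carrier N \<and>
     {x \<in> carrier (P 0). e x = \<zero>\<^bsub>N\<^esub>} = d 1 ` carrier (P 1)"

text \<open>The module \<open>k\<close> on which \<open>x\<close>, \<open>y\<close> act as zero: a coset acts through the constant term of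
  any representative. This is well defined over a quotient by relations without constant term,
  such as \<^term>\<open>Lambda_rels q\<close>.\<close>

definition simple_module :: "('k::field free_alg set, 'k) module" where
  "simple_module =
    \<lparr>carrier = UNIV, monoid.mult = (*), monoid.one = 1, ring.zero = 0, ring.add = (+),
     module.smult = (\<lambda>A c. Poly_Mapping.lookup (SOME p. p \<in> A) 0 * c)\<rparr>"


section \<open>The Ext algebra\<close>

text \<open>\<open>Ext\<^sup>*\<^sub>R(N,N)\<close> is the cohomology algebra of the differential graded algebra \<open>Hom\<^sub>R(P,P)\<close>,
  for a projective resolution \<open>P\<close> of \<open>N\<close>, where a map of degree \<open>n\<close> has components
  \<open>P j \<rightarrow> P (j - n)\<close> and \<open>D f = d f - (-1)\<^sup>n f d\<close>. Thus degree \<open>n\<close> cocycles modulo coboundaries are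
  chain maps from \<open>P\<close> to its \<open>n\<close>-fold shift modulo homotopy, and composition of chain maps induces
  the Yoneda product.\<close>

definition hom_deg ::
    "('a, 'c) ring_scheme \<Rightarrow> (int \<Rightarrow> ('a, 'p) module) \<Rightarrow> int \<Rightarrow> (int \<Rightarrow> 'p \<Rightarrow> 'p) set" where
  "hom_deg R P n = {f. \<forall>j. f j \<in> lmod_hom R (P j) (P (j - n))}"

definition hom_diff ::
    "(int \<Rightarrow> ('a, 'p) module) \<Rightarrow> (int \<Rightarrow> 'p \<Rightarrow> 'p) \<Rightarrow> int
      \<Rightarrow> (int \<Rightarrow> 'p \<Rightarrow> 'p) \<Rightarrow> (int \<Rightarrow> 'p \<Rightarrow> 'p)" where
  "hom_diff P d n f = (\<lambda>j. \<lambda>x \<in> carrier (P j).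
     if even n then d (j - n) (f j x) \<ominus>\<^bsub>P (j - n - 1)\<^esub> f (j - 1) (d j x)
     else d (j - n) (f j x) \<oplus>\<^bsub>P (j - n - 1)\<^esub> f (j - 1) (d j x))"

definition zero_map :: "(int \<Rightarrow> ('a, 'p) module) \<Rightarrow> int \<Rightarrow> (int \<Rightarrow> 'p \<Rightarrow> 'p)" where
  "zero_map P n = (\<lambda>j. \<lambda>x \<in> carrier (P j). \<zero>\<^bsub>P (j - n)\<^esub>)"

definition cocycles ::
    "('a, 'c) ring_scheme \<Rightarrow> (int \<Rightarrow> ('a, 'p) module) \<Rightarrow> (int \<Rightarrow> 'p \<Rightarrow> 'p) \<Rightarrow> int
      \<Rightarrow> (int \<Rightarrow> 'p \<Rightarrow> 'p) set" where
  "cocycles R P d n = {f \<in> hom_deg R P n. hom_diff P d n f = zero_map P (n + 1)}"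

definition coboundaries ::
    "('a, 'c) ring_scheme \<Rightarrow> (int \<Rightarrow> ('a, 'p) module) \<Rightarrow> (int \<Rightarrow> 'p \<Rightarrow> 'p) \<Rightarrow> int
      \<Rightarrow> (int \<Rightarrow> 'p \<Rightarrow> 'p) set" where
  "coboundaries R P d n = hom_diff P d (n - 1) ` hom_deg R P (n - 1)"

text \<open>The elements of the cocycle ring are the families \<open>F\<close> of cocycles \<open>F n\<close> of degree \<open>n\<close>,
  almost all zero, that is, the direct sum of the groups of cocycles. Negative degrees are left
  out because the cohomology vanishes there.\<close>

definition cocycle_ring ::
    "('a, 'c) ring_scheme \<Rightarrow> (int \<Rightarrow> ('a, 'p) module) \<Rightarrow> (int \<Rightarrow> 'p \<Rightarrow> 'p)
      \<Rightarrow> (nat \<Rightarrow> int \<Rightarrow> 'p \<Rightarrow> 'p) ring" where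
  "cocycle_ring R P d =
    \<lparr>carrier = {F. (\<forall>n. F n \<in> cocycles R P d (int n)) \<and> finite {n. F n \<noteq> zero_map P (int n)}},
     monoid.mult = (\<lambda>F G n j. \<lambda>x \<in> carrier (P j).
       \<Oplus>\<^bsub>P (j - int n)\<^esub>a \<in> {..n}. F a (j - int (n - a)) (G (n - a) j x)),
     monoid.one = (\<lambda>n j. \<lambda>x \<in> carrier (P j). if n = 0 then x else \<zero>\<^bsub>P (j - int n)\<^esub>),
     ring.zero = (\<lambda>n. zero_map P (int n)),
     ring.add = (\<lambda>F G n j. \<lambda>x \<in> carrier (P j). F n j x \<oplus>\<^bsub>P (j - int n)\<^esub> G n j x)\<rparr>"

definition coboundary_ideal ::
    "('a, 'c) ring_scheme \<Rightarrow> (int \<Rightarrow> ('a, 'p) module) \<Rightarrow> (int \<Rightarrow> 'p \<Rightarrow> 'p)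
      \<Rightarrow> (nat \<Rightarrow> int \<Rightarrow> 'p \<Rightarrow> 'p) set" where
  "coboundary_ideal R P d =
     {F \<in> carrier (cocycle_ring R P d). \<forall>n. F n \<in> coboundaries R P d (int n)}"

definition Ext_algebra ::
    "('k, 'a) graded_algebra \<Rightarrow> (int \<Rightarrow> ('a, 'p) module) \<Rightarrow> (int \<Rightarrow> 'p \<Rightarrow> 'p)
      \<Rightarrow> ('k, (nat \<Rightarrow> int \<Rightarrow> 'p \<Rightarrow> 'p) set) graded_algebra" where
  "Ext_algebra R P d =
    (let C = cocycle_ring R P d; B = coboundary_ideal R P d; Q = C Quot B in
     \<lparr>carrier = carrier Q, monoid.mult = monoid.mult Q, monoid.one = monoid.one Q,
      ring.zero = ring.zero Q, ring.add = ring.add Q,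
      scalar = (\<lambda>c. B +>\<^bsub>C\<^esub> (\<lambda>n j. \<lambda>x \<in> carrier (P j).
        if n = 0 then scalar R c \<odot>\<^bsub>P j\<^esub> x else \<zero>\<^bsub>P (j - int n)\<^esub>)),
      homog = (\<lambda>n. {B +>\<^bsub>C\<^esub> F |F. F \<in> carrier C \<and> (\<forall>m. m \<noteq> n \<longrightarrow> F m = zero_map P (int m))})\<rparr>)"


section \<open>Roots of unity\<close>

definition is_root_of_unity :: "'k::field \<Rightarrow> bool" where
  "is_root_of_unity q \<longleftrightarrow> (\<exists>n > 0. q ^ n = 1)"

definition is_primitive_root_of_unity :: "nat \<Rightarrow> 'k::field \<Rightarrow> bool" where
  "is_primitive_root_of_unity r q \<longleftrightarrow> r > 0 \<and> q ^ r = 1 \<and> (\<forall>n. 0 < n \<and> n < r \<longrightarrow> q ^ n \<noteq> 1)"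

end

theory Submission
  imports Defs
begin

text \<open>
  The Koszul dual of \<open>\<Lambda>\<^sub>q\<close> is computed on the Koszul resolution \<open>K\<close> of \<open>k\<close>: its \<open>n\<close>-th term has a basis
  dual to the monomials \<open>x\<^sup>i y\<^sup>j\<close> with \<open>i + j = n\<close>, and it is minimal, so a class of degree \<open>n\<close> is the same as
  its vector of values on that basis. For an arbitrary projective resolution \<open>P\<close>, comparison maps
  \<open>u : K \<rightarrow> P\<close> and \<open>v : P \<rightarrow> K\<close> make these values a complete invariant of a cocycle \<open>f\<close> on \<open>P\<close>: they are the
  augmentations of \<open>f u\<close>. If \<open>g\<close> is a cocycle and \<open>\<Xi>\<close> the explicit chain endomorphism of \<open>K\<close> with the same
  values, then \<open>g u\<close> and \<open>u \<Xi>\<close> are homotopic, hence the values of \<open>f g\<close> are read off from \<open>f u \<Xi>\<close>. The outcome is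
  the product of monomials \<open>x\<^sup>a y\<^sup>b x\<^sup>c y\<^sup>d = q\<^sup>b\<^sup>c x\<^sup>a\<^sup>+\<^sup>c y\<^sup>b\<^sup>+\<^sup>d\<close> of the quantum plane. There, commuting with \<open>x\<close> and \<open>y\<close>
  shows that the graded centre is spanned by the \<open>x\<^sup>i y\<^sup>j\<close> with \<open>q\<^sup>i = q\<^sup>j = (-1)\<^sup>i\<^sup>+\<^sup>j\<close>.
\<close>

section \<open>Linear extension\<close>

text \<open>The value q = 0 is allowed, so both algebras and the resolution have to be handled
  without dividing by q. This fixes the normal forms: yx rather than xy survives in
  \<open>Lambda q\<close>, and the monomials x^i y^j rather than y^j x^i span the quantum plane. It
  also shapes the exactness proof for the Koszul complex: constant coefficients are read off from
  the x-part of the differential, because the y-part carries weights q^i. The resolution P is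
  abstract, with elements of any type, and the isomorphism in the claim is an arbitrary one. Both
  are handled through a concrete algebra \<open>qmodel q\<close> of coefficient functions on pairs
  of exponents, with which the quantum plane and the Ext algebra are each compared. The graded
  centre is determined there once. Since any graded isomorphism carries centre to centre, a single
  isomorphism has to be constructed.\<close>

definition linext :: "('s \<Rightarrow> 'k \<Rightarrow> 'b) \<Rightarrow> ('s \<Rightarrow>\<^sub>0 'k::zero) \<Rightarrow> 'b::comm_monoid_add" where
  "linext h p = (\<Sum>s\<in>Poly_Mapping.keys p. h s (Poly_Mapping.lookup p s))"

lemma linext_superset:
  assumes "finite S" "Poly_Mapping.keys p \<subseteq> S" "\<And>s. h s 0 = 0"
  shows "linext h p = (\<Sum>s\<in>S. h s (Poly_Mapping.lookup p s))"
  unfolding linext_def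
  by (rule sum.mono_neutral_left) (use assms in \<open>auto simp: in_keys_iff\<close>)

lemma linext_zero [simp]: "linext h 0 = 0"
  by (simp add: linext_def)

lemma linext_single:
  assumes "h s 0 = 0"
  shows "linext h (Poly_Mapping.single s c) = h s c"
  using assms by (cases "c = 0") (simp_all add: linext_def)

text \<open>Only additivity of \<open>h\<close> in the coefficient is required. The scalar is
  absorbed by \<open>h\<close> itself, so the target can be any commutative monoid without a scalar
  action.\<close>

lemma linext_add:
  fixes h :: "'s \<Rightarrow> 'k::comm_monoid_add \<Rightarrow> 'b::comm_monoid_add"
  assumes "\<And>s. h s 0 = 0" "\<And>s a b. h s (a + b) = h s a + h s b"
  shows "linext h (p + q) = linext h p + linext h q"
proof -
  let ?S = "Poly_Mapping.keys p \<union> Poly_Mapping.keys q"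
  have "Poly_Mapping.keys (p + q) \<subseteq> ?S" by (rule keys_add)
  then show ?thesis
    using assms by (simp add: linext_superset[of ?S] lookup_add sum.distrib)
qed

lemma linext_single_id: "linext Poly_Mapping.single p = p"
  by (rule poly_mapping_eqI)
     (simp add: linext_def lookup_sum lookup_single when_def in_keys_iff)

text \<open>Every finitely supported function is a finite sum of monomials, so an additive statement
  reduces to monomials. Nested once per argument, this proves the bilinear and trilinear identities
  below.\<close>

lemma poly_mapping_add_induct [case_names zero single add]:
  fixes p :: "'s \<Rightarrow>\<^sub>0 'k::comm_monoid_add"
  assumes "P 0" "\<And>s c. P (Poly_Mapping.single s c)" "\<And>p q. P p \<Longrightarrow> P q \<Longrightarrow> P (p + q)"
  shows "P p"
proof -
  have "P (\<Sum>s\<in>S. Poly_Mapping.single s (Poly_Mapping.lookup p s))" if "finite S" for S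
    using that by induction (auto intro: assms)
  from this[of "Poly_Mapping.keys p"] show ?thesis
    using linext_single_id[of p] by (simp add: linext_def)
qed


section \<open>The quantum plane\<close>

type_synonym 'k bipoly = "(nat \<times> nat) \<Rightarrow>\<^sub>0 'k"

text \<open>The pair (i, j) stands for the ordered monomial x^i y^j. In a product each of the
  \<open>snd s\<close> letters y of the left factor passes each of the \<open>fst t\<close> letters
  x of the right one, and each exchange yx = q xy contributes one q.\<close>

definition qmult :: "'k::field \<Rightarrow> 'k bipoly \<Rightarrow> 'k bipoly \<Rightarrow> 'k bipoly" where
  "qmult q f g = linext (\<lambda>s a. linext (\<lambda>t b.
     Poly_Mapping.single (fst s + fst t, snd s + snd t) (q ^ (snd s * fst t) * (a * b))) g) f"

definition qmodel :: "'k::field \<Rightarrow> ('k, 'k bipoly) graded_algebra" where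
  "qmodel q = \<lparr>carrier = UNIV, monoid.mult = qmult q, monoid.one = Poly_Mapping.single (0, 0) 1,
     ring.zero = 0, ring.add = (+), scalar = Poly_Mapping.single (0, 0),
     homog = (\<lambda>n. {f. \<forall>s \<in> Poly_Mapping.keys f. fst s + snd s = n})\<rparr>"

lemma qmult_zero_right [simp]: "qmult q f 0 = 0"
  by (simp add: qmult_def linext_def)

lemma qmult_zero_left [simp]: "qmult q 0 f = 0"
  by (simp add: qmult_def)

lemma qmult_add_right: "qmult q f (g + h) = qmult q f g + qmult q f h"
proof -
  have "linext (\<lambda>t b. Poly_Mapping.single (fst s + fst t, snd s + snd t) (q ^ (snd s * fst t) * (a * b))) (g + h)
     = linext (\<lambda>t b. Poly_Mapping.single (fst s + fst t, snd s + snd t) (q ^ (snd s * fst t) * (a * b))) g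
     + linext (\<lambda>t b. Poly_Mapping.single (fst s + fst t, snd s + snd t) (q ^ (snd s * fst t) * (a * b))) h" for s a
    by (rule linext_add) (simp_all add: single_add[symmetric] algebra_simps)
  then show ?thesis
    by (simp add: qmult_def linext_def[where p = f] sum.distrib)
qed

lemma qmult_add_left: "qmult q (f + g) h = qmult q f h + qmult q g h"
  unfolding qmult_def
  by (rule linext_add)
     (simp_all add: linext_def sum.distrib[symmetric] single_add[symmetric] algebra_simps)

lemma qmult_single [simp]:
  "qmult q (Poly_Mapping.single (i, j) a) (Poly_Mapping.single (k, l) b)
    = Poly_Mapping.single (i + k, j + l) (q ^ (j * k) * (a * b))"
  by (simp add: qmult_def linext_single linext_def[where p = 0])

text \<open>For exponents (i, j), (k, l), (m, n) both bracketings collect the power q^(jk + jm +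
  lm): one factor for every y that stands in an earlier monomial than an x.\<close>

lemma qmult_assoc: "qmult q (qmult q f g) h = qmult q f (qmult q g h)"
proof (induction f rule: poly_mapping_add_induct)
  case (single s a)
  show ?case
  proof (induction g rule: poly_mapping_add_induct)
    case (single t b)
    show ?case
    proof (induction h rule: poly_mapping_add_induct)
      case (single u c)
      show ?case
        by (cases s; cases t; cases u) (simp add: algebra_simps power_add)
    qed (simp_all add: qmult_add_right)
  qed (simp_all add: qmult_add_right qmult_add_left)
qed (simp_all add: qmult_add_left)

lemma qmult_one_left: "qmult q (Poly_Mapping.single (0, 0) 1) f = f"
proof (induction f rule: poly_mapping_add_induct)
  case (single s c)
  show ?case by (cases s) simp
qed (simp_all add: qmult_add_right)

lemma qmult_one_right: "qmult q f (Poly_Mapping.single (0, 0) 1) = f"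
proof (induction f rule: poly_mapping_add_induct)
  case (single s c)
  show ?case by (cases s) simp
qed (simp_all add: qmult_add_left)

lemma ring_qmodel: "ring (qmodel q)"
proof (rule ringI)
  show "abelian_group (qmodel q)"
    by (rule abelian_groupI) (auto simp: qmodel_def add.assoc add.commute intro: exI[of _ "- _"] ab_left_minus)
  show "monoid (qmodel q)"
    by (rule monoidI) (auto simp: qmodel_def qmult_assoc qmult_one_left qmult_one_right)
qed (auto simp: qmodel_def qmult_add_left qmult_add_right)

lemma a_inv_qmodel: "\<ominus>\<^bsub>qmodel q\<^esub> f = - f"
proof -
  interpret ring "qmodel q" by (rule ring_qmodel)
  show ?thesis by (rule minus_equality) (simp_all add: qmodel_def)
qed

text \<open>The sum runs over the exponent (c, l) of the right factor, the left one being determined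
  as (i - c, j - l). The Yoneda product is later brought into exactly this shape.\<close>

lemma lookup_qmult:
  "Poly_Mapping.lookup (qmult q f g) (i, j)
    = (\<Sum>c\<le>i. \<Sum>l\<le>j. q ^ (c * (j - l)) * Poly_Mapping.lookup f (i - c, j - l) * Poly_Mapping.lookup g (c, l))"
proof (induction f rule: poly_mapping_add_induct)
  case (single s a)
  show ?case
  proof (induction g rule: poly_mapping_add_induct)
    case (single t b)
    obtain m n m' n' where [simp]: "s = (m, n)" "t = (m', n')" by (cases s, cases t)
    define A where "A = Poly_Mapping.lookup (Poly_Mapping.single s a)"
    have "(\<Sum>c\<le>i. \<Sum>l\<le>j. q ^ (c * (j - l)) * A (i - c, j - l) * Poly_Mapping.lookup (Poly_Mapping.single t b) (c, l))
      = (\<Sum>c\<le>i. \<Sum>l\<le>j. if l = n' then (if c = m' then q ^ (c * (j - l)) * A (i - c, j - l) * b else 0) else 0)"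
      by (intro sum.cong refl) (simp add: lookup_single when_def)
    also have "\<dots> = (if m' \<le> i \<and> n' \<le> j then q ^ (m' * (j - n')) * A (i - m', j - n') * b else 0)"
      by (cases "n' \<le> j") simp_all
    finally show ?case
      unfolding A_def[symmetric] by (auto simp: A_def lookup_single when_def algebra_simps)
  qed (simp_all add: qmult_add_right lookup_add algebra_simps sum.distrib)
qed (simp_all add: qmult_add_left lookup_add algebra_simps sum.distrib)

section \<open>Quotients and transport along graded isomorphisms\<close>

text \<open>A \<open>graded_algebra\<close> built on a quotient copies its operations but is a
  record of another type, so the ring axioms have to be carried over field by field.\<close>

lemma ring_cong_operations:
  assumes "ring A" "carrier B = carrier A" "monoid.mult B = monoid.mult A"
    "monoid.one B = monoid.one A" "ring.zero B = ring.zero A" "ring.add B = ring.add A"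
  shows "ring B"
proof -
  interpret ring A by fact
  note ops = assms(2-)
  show ?thesis
  proof (rule ringI)
    show "abelian_group B"
    proof (rule abelian_groupI)
      show "\<exists>y\<in>carrier B. y \<oplus>\<^bsub>B\<^esub> x = \<zero>\<^bsub>B\<^esub>" if "x \<in> carrier B" for x
        using that l_neg[of x] a_inv_closed[of x] unfolding ops by blast
    qed (simp_all add: ops a_ac)
    show "monoid B"
      by (rule monoidI) (simp_all add: ops m_assoc)
  qed (simp_all add: ops l_distr r_distr)
qed

text \<open>The first isomorphism theorem, together with the value of the isomorphism on a coset.
  That value is needed to follow scalars and homogeneous parts, which are given as cosets. It serves
  both for presented algebras and for cocycles modulo coboundaries.\<close>

lemma quotient_ring_iso:
  assumes R: "ring R" and A: "ring A" and h: "h \<in> ring_hom R A" and surj: "h ` carrier R = carrier A"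
    and I: "I = {x \<in> carrier R. h x = \<zero>\<^bsub>A\<^esub>}"
  shows "(\<lambda>K. the_elem (h ` K)) \<in> ring_iso (R Quot I) A"
    and "\<And>x. x \<in> carrier R \<Longrightarrow> the_elem (h ` (I +>\<^bsub>R\<^esub> x)) = h x"
    and "ring (R Quot I)"
proof -
  interpret H: ring_hom_ring R A h
    using R A h by (intro ring_hom_ringI2)
  have ker: "I = a_kernel R A h"
    unfolding I a_kernel_def' by (rule refl)
  show "(\<lambda>K. the_elem (h ` K)) \<in> ring_iso (R Quot I) A"
    unfolding ker by (rule H.FactRing_iso_set[OF surj])
  show "the_elem (h ` (I +>\<^bsub>R\<^esub> x)) = h x" if "x \<in> carrier R" for x
  proof -
    have "h ` (I +>\<^bsub>R\<^esub> x) = {h x}"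
    proof
      show "h ` (I +>\<^bsub>R\<^esub> x) \<subseteq> {h x}"
        using that by (auto simp: a_r_coset_def' I)
      have "x \<in> I +>\<^bsub>R\<^esub> x"
        using that by (auto simp: a_r_coset_def' I intro!: bexI[of _ "\<zero>\<^bsub>R\<^esub>"])
      then show "{h x} \<subseteq> h ` (I +>\<^bsub>R\<^esub> x)" by blast
    qed
    then show ?thesis by simp
  qed
  show "ring (R Quot I)"
    unfolding ker by (intro ideal.quotient_is_ring H.kernel_is_ideal)
qed

lemma generate_ring_image:
  assumes "ring A" "ring B" "h \<in> ring_hom A B" "S \<subseteq> carrier A"
  shows "h ` generate_ring A S = generate_ring B (h ` S)"
proof -
  interpret H: ring_hom_ring A B h
    using assms by (intro ring_hom_ringI2)
  have c: "x \<in> carrier A" if "x \<in> generate_ring A S" for x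
    using H.R.generate_ring_in_carrier[OF assms(4) that] .
  have "h x \<in> generate_ring B (h ` S)" if "x \<in> generate_ring A S" for x
    using that
  proof induction
    case one then show ?case by (simp add: generate_ring.one)
  next
    case (a_inv x)
    then show ?case using c[OF a_inv(1)] by (simp add: generate_ring.a_inv)
  next
    case (eng_add x y)
    then show ?case using c[OF eng_add(1)] c[OF eng_add(2)] by (simp add: generate_ring.eng_add)
  next
    case (eng_mult x y)
    then show ?case using c[OF eng_mult(1)] c[OF eng_mult(2)] by (simp add: generate_ring.eng_mult)
  qed (auto intro: generate_ring.incl)
  moreover have "y \<in> h ` generate_ring A S" if "y \<in> generate_ring B (h ` S)" for y
    using that
  proof induction
    case one
    show ?case by (rule image_eqI[OF _ generate_ring.one]) simp
  next
    case (a_inv y)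
    then obtain x where x: "x \<in> generate_ring A S" "y = h x" by blast
    show ?case
      by (rule image_eqI[OF _ generate_ring.a_inv[OF x(1)]]) (simp add: x c[OF x(1)])
  next
    case (eng_add y y')
    then obtain x x' where x: "x \<in> generate_ring A S" "y = h x" "x' \<in> generate_ring A S" "y' = h x'"
      by blast
    show ?case
      by (rule image_eqI[OF _ generate_ring.eng_add[OF x(1,3)]]) (simp add: x(2,4) c[OF x(1)] c[OF x(3)])
  next
    case (eng_mult y y')
    then obtain x x' where x: "x \<in> generate_ring A S" "y = h x" "x' \<in> generate_ring A S" "y' = h x'"
      by blast
    show ?case
      by (rule image_eqI[OF _ generate_ring.eng_mult[OF x(1,3)]]) (simp add: x(2,4) c[OF x(1)] c[OF x(3)])
  qed (auto intro: generate_ring.incl)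
  ultimately show ?thesis by blast
qed

lemma graded_algebra_isoD:
  assumes "\<phi> \<in> graded_algebra_iso A B"
  shows "\<phi> \<in> ring_iso A B" "\<phi> \<in> ring_hom A B" "bij_betw \<phi> (carrier A) (carrier B)"
    "\<phi> (scalar A c) = scalar B c" "\<phi> ` homog A n = homog B n"
  using assms by (auto simp: graded_algebra_iso_def ring_iso_def)

lemma subalgebra_generated_image:
  assumes "ring A" "ring B" "\<phi> \<in> graded_algebra_iso A B" "range (scalar A) \<subseteq> carrier A" "S \<subseteq> carrier A"
  shows "\<phi> ` subalgebra_generated A S = subalgebra_generated B (\<phi> ` S)"
  unfolding subalgebra_generated_def
  using assms graded_algebra_isoD(2,4)[OF assms(3)]
  by (subst generate_ring_image[of A B]) (auto simp: image_Un image_image)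

text \<open>The condition on z is tested against homogeneous elements only. An isomorphism matches
  these degree by degree, and injectivity lets the commutation rule be pulled back as well as pushed
  forward; hence already the generating sets correspond.\<close>

lemma graded_centre_image:
  assumes A: "ring A" and B: "ring B" and iso: "\<phi> \<in> graded_algebra_iso A B"
    and car: "\<And>n. homog A n \<subseteq> carrier A"
  shows "graded_centre B = \<phi> ` graded_centre A"
proof -
  interpret H: ring_hom_ring A B \<phi>
    using A B graded_algebra_isoD(2)[OF iso] by (intro ring_hom_ringI2)
  have inj: "\<phi> x = \<phi> y \<longleftrightarrow> x = y" if "x \<in> carrier A" "y \<in> carrier A" for x y
    using graded_algebra_isoD(3)[OF iso] that by (auto simp: bij_betw_def inj_on_def)
  have eq: "(\<phi> z \<otimes>\<^bsub>B\<^esub> \<phi> g = (if b then \<phi> g \<otimes>\<^bsub>B\<^esub> \<phi> z else \<ominus>\<^bsub>B\<^esub> (\<phi> g \<otimes>\<^bsub>B\<^esub> \<phi> z)))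
    \<longleftrightarrow> (z \<otimes>\<^bsub>A\<^esub> g = (if b then g \<otimes>\<^bsub>A\<^esub> z else \<ominus>\<^bsub>A\<^esub> (g \<otimes>\<^bsub>A\<^esub> z)))"
    if "z \<in> carrier A" "g \<in> carrier A" for z g b
    using that inj[of "z \<otimes>\<^bsub>A\<^esub> g" "g \<otimes>\<^bsub>A\<^esub> z"] inj[of "z \<otimes>\<^bsub>A\<^esub> g" "\<ominus>\<^bsub>A\<^esub> (g \<otimes>\<^bsub>A\<^esub> z)"] by simp
  let ?Z = "\<lambda>E. {z. \<exists>m. z \<in> homog E m \<and> (\<forall>n. \<forall>g \<in> homog E n.
        z \<otimes>\<^bsub>E\<^esub> g = (if even (m * n) then g \<otimes>\<^bsub>E\<^esub> z else \<ominus>\<^bsub>E\<^esub> (g \<otimes>\<^bsub>E\<^esub> z)))}"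
  have hom: "homog B n = \<phi> ` homog A n" for n
    using graded_algebra_isoD(5)[OF iso] by simp
  have "?Z B = \<phi> ` ?Z A"
  proof (intro subset_antisym subsetI)
    fix y assume "y \<in> ?Z B"
    then obtain m z where z: "z \<in> homog A m" "y = \<phi> z"
      and c: "\<And>n g. g \<in> homog A n \<Longrightarrow> \<phi> z \<otimes>\<^bsub>B\<^esub> \<phi> g
        = (if even (m * n) then \<phi> g \<otimes>\<^bsub>B\<^esub> \<phi> z else \<ominus>\<^bsub>B\<^esub> (\<phi> g \<otimes>\<^bsub>B\<^esub> \<phi> z))"
      by (auto simp: hom)
    have "z \<otimes>\<^bsub>A\<^esub> g = (if even (m * n) then g \<otimes>\<^bsub>A\<^esub> z else \<ominus>\<^bsub>A\<^esub> (g \<otimes>\<^bsub>A\<^esub> z))" if "g \<in> homog A n" for n g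
      using c[OF that] eq[of z g "even (m * n)"] car z that by blast
    then show "y \<in> \<phi> ` ?Z A" using z by blast
  next
    fix y assume "y \<in> \<phi> ` ?Z A"
    then obtain m z where z: "z \<in> homog A m" "y = \<phi> z"
      and c: "\<And>n g. g \<in> homog A n \<Longrightarrow> z \<otimes>\<^bsub>A\<^esub> g = (if even (m * n) then g \<otimes>\<^bsub>A\<^esub> z else \<ominus>\<^bsub>A\<^esub> (g \<otimes>\<^bsub>A\<^esub> z))"
      by blast
    have "\<phi> z \<otimes>\<^bsub>B\<^esub> \<phi> g = (if even (m * n) then \<phi> g \<otimes>\<^bsub>B\<^esub> \<phi> z else \<ominus>\<^bsub>B\<^esub> (\<phi> g \<otimes>\<^bsub>B\<^esub> \<phi> z))" if "g \<in> homog A n" for n g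
      using c[OF that] eq[of z g "even (m * n)"] car z that by blast
    then show "y \<in> ?Z B" using z(1) unfolding z(2) hom by blast
  qed
  moreover have "?Z A \<subseteq> carrier A" using car by blast
  ultimately show ?thesis
    unfolding graded_centre_def
    using generate_ring_image[OF A B graded_algebra_isoD(2)[OF iso], of "?Z A"] by simp
qed

lemma graded_algebra_iso_comp:
  assumes "\<phi> \<in> graded_algebra_iso A B" "\<psi> \<in> graded_algebra_iso B C"
  shows "\<psi> \<circ> \<phi> \<in> graded_algebra_iso A C"
proof -
  have "(\<psi> \<circ> \<phi>) ` homog A n = homog C n" for n
    using graded_algebra_isoD(5)[OF assms(1)] graded_algebra_isoD(5)[OF assms(2)]
    by (metis image_comp)
  moreover have "(\<psi> \<circ> \<phi>) (scalar A c) = scalar C c" for c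
    using graded_algebra_isoD(4)[OF assms(1)] graded_algebra_isoD(4)[OF assms(2)] by simp
  ultimately show ?thesis
    using ring_iso_set_trans[OF graded_algebra_isoD(1)[OF assms(1)] graded_algebra_isoD(1)[OF assms(2)]]
    by (simp add: graded_algebra_iso_def)
qed

text \<open>The record type does not force scalars and homogeneous parts to lie in the carrier, and
  \<open>inv_into\<close> is controlled only on the carrier; hence the two closure
  assumptions.\<close>

lemma graded_algebra_iso_inv:
  assumes "ring A" "\<phi> \<in> graded_algebra_iso A B" "\<And>c. scalar A c \<in> carrier A" "\<And>n. homog A n \<subseteq> carrier A"
  shows "inv_into (carrier A) \<phi> \<in> graded_algebra_iso B A"
proof -
  note D = graded_algebra_isoD[OF assms(2)]
  have inj: "inj_on \<phi> (carrier A)" using D(3) by (simp add: bij_betw_def)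
  have "inv_into (carrier A) \<phi> (scalar B c) = scalar A c" for c
    using inv_into_f_f[OF inj assms(3)] D(4) by metis
  moreover have "inv_into (carrier A) \<phi> ` homog B n = homog A n" for n
    using inv_into_image_cancel[OF inj assms(4)] D(5) by metis
  ultimately show ?thesis
    using ring_iso_set_sym[OF assms(1) D(1)] by (simp add: graded_algebra_iso_def)
qed


section \<open>Presented algebras\<close>

abbreviation free_ring :: "'k::field free_alg ring" where
  "free_ring \<equiv> ring_of_type_algebra"

lemma free_ring_simps [simp]:
  "carrier free_ring = UNIV" "monoid.mult free_ring = (*)" "monoid.one free_ring = 1"
  "ring.zero free_ring = 0" "ring.add free_ring = (+)"
  by (simp_all add: ring_of_type_algebra_def)

lemma ring_free_ring: "ring free_ring"
proof (rule ringI)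
  show "abelian_group free_ring"
    by (rule abelian_groupI) (auto simp: add_ac intro: exI[of _ "- _"] ab_left_minus)
  show "monoid free_ring"
    by (rule monoidI) (simp_all add: mult.assoc)
qed (simp_all add: distrib_left distrib_right)

lemma ideal_free_ringD:
  assumes "ideal I (free_ring :: 'k::field free_alg ring)"
  shows "0 \<in> I" "p \<in> I \<Longrightarrow> p' \<in> I \<Longrightarrow> p + p' \<in> I" "p \<in> I \<Longrightarrow> f * p \<in> I" "p \<in> I \<Longrightarrow> p * f \<in> I"
proof -
  interpret ideal I "free_ring :: 'k free_alg ring" by fact
  show "0 \<in> I" "p \<in> I \<Longrightarrow> p' \<in> I \<Longrightarrow> p + p' \<in> I" "p \<in> I \<Longrightarrow> f * p \<in> I" "p \<in> I \<Longrightarrow> p * f \<in> I"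
    using additive_subgroup.zero_closed[OF is_additive_subgroup]
      additive_subgroup.a_closed[OF is_additive_subgroup, of p p'] I_l_closed[of p f] I_r_closed[of p f]
    by simp_all
qed

lemma presented_algebra_iso:
  fixes A :: "('k::field, 'b) graded_algebra"
  assumes A: "ring A" and h: "h \<in> ring_hom free_ring A" and surj: "range h = carrier A"
    and ker: "genideal free_ring S = {p. h p = \<zero>\<^bsub>A\<^esub>}"
    and sc: "\<And>c. scalar A c = h (free_const c)"
    and ho: "\<And>n. homog A n = h ` {p. \<forall>w \<in> Poly_Mapping.keys p. length (letters w) = n}"
  shows "(\<lambda>K. the_elem (h ` K)) \<in> graded_algebra_iso (presented_algebra S) A"
    and "\<And>p. the_elem (h ` (genideal free_ring S +>\<^bsub>free_ring\<^esub> p)) = h p"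
    and "ring (presented_algebra S)"
proof -
  let ?I = "genideal free_ring S"
  let ?\<phi> = "\<lambda>K. the_elem (h ` K)"
  have ker': "?I = {p \<in> carrier free_ring. h p = \<zero>\<^bsub>A\<^esub>}" using ker by simp
  note Q = quotient_ring_iso[OF ring_free_ring A h _ ker']
  have surj': "h ` carrier free_ring = carrier A" using surj by simp
  show coset: "?\<phi> (?I +>\<^bsub>free_ring\<^esub> p) = h p" for p
    using Q(2)[OF surj'] by simp
  have ops: "carrier (presented_algebra S) = carrier (free_ring Quot ?I)"
    "monoid.mult (presented_algebra S) = monoid.mult (free_ring Quot ?I)"
    "monoid.one (presented_algebra S) = monoid.one (free_ring Quot ?I)"
    "ring.zero (presented_algebra S) = ring.zero (free_ring Quot ?I)"
    "ring.add (presented_algebra S) = ring.add (free_ring Quot ?I)"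
    by (simp_all add: presented_algebra_def Let_def)
  show "ring (presented_algebra S)"
    by (rule ring_cong_operations[OF Q(3)[OF surj'] ops])
  have "?\<phi> \<in> ring_iso (presented_algebra S) A"
    using Q(1)[OF surj'] by (simp add: ring_iso_def ring_hom_def ops)
  moreover have "?\<phi> (scalar (presented_algebra S) c) = scalar A c" for c
    by (simp add: presented_algebra_def Let_def coset sc)
  moreover have "?\<phi> ` homog (presented_algebra S) n = homog A n" for n
  proof -
    let ?D = "{p. \<forall>w \<in> Poly_Mapping.keys p. length (letters w) = n}"
    have "homog (presented_algebra S) n = (\<lambda>p. ?I +>\<^bsub>free_ring\<^esub> p) ` ?D"
      by (auto simp: presented_algebra_def Let_def)
    then have "?\<phi> ` homog (presented_algebra S) n = (\<lambda>p. ?\<phi> (?I +>\<^bsub>free_ring\<^esub> p)) ` ?D"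
      by (simp only: image_image)
    then show ?thesis by (simp only: coset ho)
  qed
  ultimately show "?\<phi> \<in> graded_algebra_iso (presented_algebra S) A"
    by (simp add: graded_algebra_iso_def)
qed

text \<open>A rewriting argument without confluence: \<open>N\<close> picks a normal form, and to
  reduce an arbitrary word modulo \<open>I\<close> it suffices to know how one letter acts from the
  left on a normal form. That normal forms stay independent is the business of the target of
  \<open>h\<close>.\<close>

lemma presented_algebra_normal_form:
  fixes h :: "'k::field free_alg \<Rightarrow> 'b::ab_group_add" and N :: "'b \<Rightarrow> 'k free_alg"
  assumes I: "ideal I free_ring"
    and h: "\<And>p p'. h (p + p') = h p + h p'" and N: "\<And>u v. N (u + v) = N u + N v"
    and const: "\<And>c. N (h (free_const c)) = free_const c"
    and step: "\<And>a p. free_var a * N (h p) - N (h (free_var a * p)) \<in> I"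
  shows "p - N (h p) \<in> I"
proof -
  note I' = ideal_free_ringD[OF I]
  have diff: "N (u - v) = N u - N v" for u v
    using N[of "u - v" v] by simp
  have diff': "h (p - p') = h p - h p'" for p p'
    using h[of "p - p'" p'] by simp
  show ?thesis
  proof (induction p rule: poly_mapping_add_induct)
    case zero
    show ?case using I'(1) diff'[of 0 0] diff[of 0 0] by simp
  next
    case (add p p')
    have "p + p' - N (h (p + p')) = (p - N (h p)) + (p' - N (h p'))" by (simp add: h N)
    then show ?case using I'(2)[OF add] by (simp only:)
  next
    case (single w c)
    obtain l where l: "w = Word l" by (cases w)
    have "Poly_Mapping.single (Word l) c - N (h (Poly_Mapping.single (Word l) c)) \<in> I"
    proof (induction l)
      case Nil
      then show ?case using const[of c] I'(1) by (simp add: free_const_def zero_word_def)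
    next
      case (Cons a l)
      let ?p = "Poly_Mapping.single (Word l) c"
      have eq: "Poly_Mapping.single (Word (a # l)) c = free_var a * ?p"
        by (simp add: free_var_def mult_single plus_word_def)
      \<comment> \<open>The tail is normalised, and then the letter is multiplied onto the normal
        form; the two errors lie in \<open>I\<close> by the induction hypothesis and by
        \<open>step\<close>.\<close>
      have "free_var a * ?p - N (h (free_var a * ?p))
        = free_var a * (?p - N (h ?p)) + (free_var a * N (h ?p) - N (h (free_var a * ?p)))"
        by (simp add: algebra_simps)
      then show ?case
        unfolding eq using I'(2)[OF I'(3)[OF Cons] step] by (simp only:)
    qed
    then show ?case by (simp add: l)
  qed
qed

text \<open>One inclusion is minimality of the generated ideal, as the kernel is an ideal containing
  \<open>S\<close>. For the other, \<open>h p = 0\<close> makes the normal form of p vanish, so p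
  itself is the error term in \<open>nf\<close>.\<close>

lemma genideal_eq_kernel:
  fixes h :: "'k::field free_alg \<Rightarrow> 'b::ab_group_add"
  assumes A: "ring A" "\<zero>\<^bsub>A\<^esub> = 0" and hom: "h \<in> ring_hom free_ring A" and rels: "\<And>s. s \<in> S \<Longrightarrow> h s = 0"
    and N: "N 0 = 0" and nf: "\<And>p. p - N (h p) \<in> genideal free_ring S"
  shows "genideal free_ring S = {p. h p = \<zero>\<^bsub>A\<^esub>}"
proof
  interpret H: ring_hom_ring free_ring A h
    using ring_free_ring A hom by (intro ring_hom_ringI2)
  have "genideal free_ring S \<subseteq> a_kernel free_ring A h"
    by (rule ring.genideal_minimal[OF ring_free_ring H.kernel_is_ideal])
       (unfold a_kernel_def', use rels A(2) in auto)
  then show "genideal free_ring S \<subseteq> {p. h p = \<zero>\<^bsub>A\<^esub>}"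
    unfolding a_kernel_def' by simp
  show "{p. h p = \<zero>\<^bsub>A\<^esub>} \<subseteq> genideal free_ring S"
  proof
    fix p assume "p \<in> {p. h p = \<zero>\<^bsub>A\<^esub>}"
    then have "h p = 0" using A by simp
    then show "p \<in> genideal free_ring S" using nf[of p] N by simp
  qed
qed

section \<open>The normal form of the quantum plane\<close>

text \<open>Counts the pairs of a y standing to the left of an x. This is the number of exchanges of
  yx into xy that sort the word into x^i y^j, hence the exponent of q that it acquires.\<close>

fun inversions :: "letter list \<Rightarrow> nat" where
  "inversions [] = 0"
| "inversions (LX # l) = inversions l"
| "inversions (LY # l) = inversions l + count_list l LX"

lemma inversions_append:
  "inversions (l @ l') = inversions l + inversions l' + count_list l LY * count_list l' LX"
  by (induction l rule: inversions.induct) simp_all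

lemma length_letters: "length l = count_list l LX + count_list l LY"
  by (induction l rule: inversions.induct) simp_all

lemma count_list_replicate: "count_list (replicate n a) b = (if a = b then n else 0)"
  by (induction n) auto

lemma inversions_replicate [simp]: "inversions (replicate i LX @ replicate j LY) = 0"
proof -
  have "inversions (replicate i LX) = 0" "inversions (replicate j LY) = 0"
    by (induction i) (simp_all, induction j, simp_all add: count_list_0_iff)
  then show ?thesis by (simp add: inversions_append count_list_0_iff)
qed

definition bideg :: "word \<Rightarrow> nat \<times> nat" where
  "bideg w = (count_list (letters w) LX, count_list (letters w) LY)"

definition qplane_eval :: "'k::field \<Rightarrow> 'k free_alg \<Rightarrow> 'k bipoly" where
  "qplane_eval q = linext (\<lambda>w c. Poly_Mapping.single (bideg w) (q ^ inversions (letters w) * c))"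

definition qplane_nf :: "'k::field bipoly \<Rightarrow> 'k free_alg" where
  "qplane_nf = linext (\<lambda>s. Poly_Mapping.single (Word (replicate (fst s) LX @ replicate (snd s) LY)))"

lemma qplane_eval_add: "qplane_eval q (p + p') = qplane_eval q p + qplane_eval q p'"
  unfolding qplane_eval_def by (rule linext_add) (simp_all add: single_add distrib_left)

lemma qplane_eval_zero [simp]: "qplane_eval q 0 = 0"
  by (simp add: qplane_eval_def)

lemma qplane_eval_single:
  "qplane_eval q (Poly_Mapping.single w c) = Poly_Mapping.single (bideg w) (q ^ inversions (letters w) * c)"
  unfolding qplane_eval_def by (rule linext_single) simp

lemma qplane_nf_add: "qplane_nf (f + g) = qplane_nf f + qplane_nf g"
  unfolding qplane_nf_def by (rule linext_add) (simp_all add: single_add)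

lemma qplane_nf_zero [simp]: "qplane_nf 0 = 0"
  by (simp add: qplane_nf_def)

lemma qplane_nf_single:
  "qplane_nf (Poly_Mapping.single (i, j) c) = Poly_Mapping.single (Word (replicate i LX @ replicate j LY)) c"
  unfolding qplane_nf_def by (subst linext_single) simp_all

lemma qplane_eval_nf: "qplane_eval q (qplane_nf f) = f"
proof (induction f rule: poly_mapping_add_induct)
  case (single s c)
  show ?case
    by (cases s) (simp add: qplane_nf_single qplane_eval_single bideg_def count_list_replicate)
qed (simp_all add: qplane_eval_add qplane_nf_add)

lemma qplane_eval_mult: "qplane_eval q (p * p') = qmult q (qplane_eval q p) (qplane_eval q p')"
proof (induction p rule: poly_mapping_add_induct)
  case (single w c)
  show ?case
  proof (induction p' rule: poly_mapping_add_induct)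
    case (single w' c')
    show ?case
      by (simp add: mult_single qplane_eval_single bideg_def plus_word_def inversions_append
          power_add algebra_simps)
  qed (simp_all add: qplane_eval_add distrib_left qmult_add_right)
qed (simp_all add: qplane_eval_add distrib_right qmult_add_left)

lemma qplane_eval_const: "qplane_eval q (free_const c) = Poly_Mapping.single (0, 0) c"
  by (simp add: free_const_def qplane_eval_single bideg_def zero_word_def)

lemma qplane_eval_var:
  "qplane_eval q (free_var LX) = Poly_Mapping.single (1, 0) 1"
  "qplane_eval q (free_var LY) = Poly_Mapping.single (0, 1) 1"
  by (simp_all add: free_var_def qplane_eval_single bideg_def)

lemma qplane_eval_hom: "qplane_eval q \<in> ring_hom free_ring (qmodel q)"
proof (rule ring_hom_memI)
  show "qplane_eval q \<one>\<^bsub>free_ring\<^esub> = \<one>\<^bsub>qmodel q\<^esub>"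
    using qplane_eval_const[of q 1] by (simp add: free_const_def qmodel_def)
qed (simp_all add: qplane_eval_mult qplane_eval_add qmodel_def)

lemma free_var_replicate:
  "free_var a * Poly_Mapping.single (Word l) c = Poly_Mapping.single (Word (a # l)) c"
  by (simp add: free_var_def mult_single plus_word_def)

text \<open>Modulo the relation a y moves to the right across i letters x and picks up q^i; the
  suffix \<open>l\<close> is a spectator.\<close>

lemma qplane_ideal_swap:
  fixes q c :: "'k::field"
  assumes I: "ideal I free_ring" and rel: "qplane_rels q \<subseteq> I"
  shows "free_var LY * Poly_Mapping.single (Word (replicate i LX @ l)) c
    - Poly_Mapping.single (Word (replicate i LX @ LY # l)) (q ^ i * c) \<in> I"
proof (induction i)
  case 0
  then show ?case using ideal_free_ringD(1)[OF I] by (simp add: free_var_replicate)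
next
  case (Suc i)
  let ?m = "Poly_Mapping.single (Word (replicate i LX @ l)) c"
  let ?r = "free_var LY * free_var LX - free_const q * (free_var LX * free_var LY)"
  have const: "free_const q * Poly_Mapping.single w b = Poly_Mapping.single w (q * b)" for w b
    by (simp add: free_const_def mult_single)
  \<comment> \<open>The leftmost exchange is one use of the relation, and the remaining i exchanges
    are the induction hypothesis multiplied from the left by q x.\<close>
  have "?r * ?m + free_const q * free_var LX * (free_var LY * ?m - Poly_Mapping.single (Word (replicate i LX @ LY # l)) (q ^ i * c))
    = free_var LY * (free_var LX * ?m) - free_const q * (free_var LX * Poly_Mapping.single (Word (replicate i LX @ LY # l)) (q ^ i * c))"
    by (simp add: algebra_simps)
  also have "\<dots> = free_var LY * Poly_Mapping.single (Word (replicate (Suc i) LX @ l)) c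
    - Poly_Mapping.single (Word (replicate (Suc i) LX @ LY # l)) (q ^ Suc i * c)"
    by (simp add: free_var_replicate const mult.assoc)
  finally have eq: "free_var LY * Poly_Mapping.single (Word (replicate (Suc i) LX @ l)) c
    - Poly_Mapping.single (Word (replicate (Suc i) LX @ LY # l)) (q ^ Suc i * c)
    = ?r * ?m + free_const q * free_var LX * (free_var LY * ?m - Poly_Mapping.single (Word (replicate i LX @ LY # l)) (q ^ i * c))"
    by simp
  have "?r \<in> I" using rel by (simp add: qplane_rels_def)
  then show ?case
    unfolding eq using ideal_free_ringD(2-4)[OF I] Suc by blast
qed

text \<open>A Poincare-Birkhoff-Witt statement: sorted words span the quotient by rewriting, and
  their images in the model are distinct basis monomials, so the relation has no hidden
  consequences.\<close>

lemma qplane_genideal: "genideal free_ring (qplane_rels q) = {p. qplane_eval q p = \<zero>\<^bsub>qmodel q\<^esub>}"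
proof (rule genideal_eq_kernel)
  let ?I = "genideal free_ring (qplane_rels q)"
  have I: "ideal ?I free_ring"
    by (rule ring.genideal_ideal[OF ring_free_ring]) simp
  have rel: "qplane_rels q \<subseteq> ?I"
    by (rule ring.genideal_self[OF ring_free_ring]) simp
  show "p - qplane_nf (qplane_eval q p) \<in> ?I" for p
  proof (rule presented_algebra_normal_form[OF I])
    show "qplane_nf (qplane_eval q (free_const c)) = free_const c" for c
      unfolding qplane_eval_const qplane_nf_single by (simp add: free_const_def zero_word_def)
    have step: "free_var a * qplane_nf f - qplane_nf (qmult q (qplane_eval q (free_var a)) f) \<in> ?I" for a f
    proof (induction f rule: poly_mapping_add_induct)
      case zero
      then show ?case using ideal_free_ringD(1)[OF I] by simp
    next
      case (add f g)
      have "free_var a * qplane_nf (f + g) - qplane_nf (qmult q (qplane_eval q (free_var a)) (f + g))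
        = (free_var a * qplane_nf f - qplane_nf (qmult q (qplane_eval q (free_var a)) f))
        + (free_var a * qplane_nf g - qplane_nf (qmult q (qplane_eval q (free_var a)) g))"
        by (simp add: qplane_nf_add qmult_add_right algebra_simps)
      then show ?case using ideal_free_ringD(2)[OF I add] by (simp only:)
    next
      case (single s c)
      obtain i j where s: "s = (i, j)" by (cases s)
      show ?case
      \<comment> \<open>Prepending x to x^i y^j gives a sorted word again; only y has to be
        moved.\<close>
      proof (cases a)
        case LX
        then show ?thesis using ideal_free_ringD(1)[OF I]
          by (simp add: s qplane_eval_var qplane_nf_single free_var_replicate)
      next
        case LY
        then show ?thesis using qplane_ideal_swap[OF I rel, of i "replicate j LY" c]
          by (simp add: s qplane_eval_var qplane_nf_single)
      qed
    qed
    show "free_var a * qplane_nf (qplane_eval q p) - qplane_nf (qplane_eval q (free_var a * p)) \<in> ?I" for a p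
      using step[of a "qplane_eval q p"] by (simp add: qplane_eval_mult)
  qed (simp_all add: qplane_eval_add qplane_nf_add)
  show "qplane_eval q s = 0" if "s \<in> qplane_rels q" for s
  proof -
    have "qplane_eval q (free_var LY * free_var LX) = qplane_eval q s + qplane_eval q (free_const q * (free_var LX * free_var LY))"
      using that by (simp add: qplane_rels_def qplane_eval_add[symmetric])
    then show ?thesis
      by (simp add: qplane_eval_mult qplane_eval_var qplane_eval_const)
  qed
qed (simp_all add: ring_qmodel qplane_eval_hom, simp add: qmodel_def)

lemma keys_qplane_eval:
  assumes "s \<in> Poly_Mapping.keys (qplane_eval q p)"
  shows "\<exists>w\<in>Poly_Mapping.keys p. s = bideg w"
proof (rule ccontr)
  assume "\<not> ?thesis"
  then have "Poly_Mapping.lookup (qplane_eval q p) s = 0"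
    by (auto simp: qplane_eval_def linext_def lookup_sum lookup_single when_def intro!: sum.neutral)
  then show False using assms by (simp add: in_keys_iff)
qed

lemma keys_qplane_nf:
  assumes "w \<in> Poly_Mapping.keys (qplane_nf f)"
  shows "\<exists>s\<in>Poly_Mapping.keys f. w = Word (replicate (fst s) LX @ replicate (snd s) LY)"
proof (rule ccontr)
  assume "\<not> ?thesis"
  then have "Poly_Mapping.lookup (qplane_nf f) w = 0"
    by (auto simp: qplane_nf_def linext_def lookup_sum lookup_single when_def intro!: sum.neutral)
  then show False using assms by (simp add: in_keys_iff)
qed

lemma homog_qmodel:
  "homog (qmodel q) n = qplane_eval q ` {p. \<forall>w \<in> Poly_Mapping.keys p. length (letters w) = n}"
proof (intro subset_antisym subsetI)
  fix f assume "f \<in> homog (qmodel q) n"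
  then have "qplane_nf f \<in> {p. \<forall>w \<in> Poly_Mapping.keys p. length (letters w) = n}"
    by (auto simp: qmodel_def dest!: keys_qplane_nf)
  then show "f \<in> qplane_eval q ` {p. \<forall>w \<in> Poly_Mapping.keys p. length (letters w) = n}"
    by (rule image_eqI[where f = "qplane_eval q", OF qplane_eval_nf[symmetric]])
next
  fix f assume "f \<in> qplane_eval q ` {p. \<forall>w \<in> Poly_Mapping.keys p. length (letters w) = n}"
  then obtain p where p: "f = qplane_eval q p" "\<And>w. w \<in> Poly_Mapping.keys p \<Longrightarrow> length (letters w) = n"
    by blast
  have "fst s + snd s = n" if s: "s \<in> Poly_Mapping.keys f" for s
  proof -
    obtain w where "w \<in> Poly_Mapping.keys p" "s = bideg w"
      using keys_qplane_eval s unfolding p(1) by blast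
    then show ?thesis
      using p(2)[of w] length_letters[of "letters w"] by (simp add: bideg_def)
  qed
  then show "f \<in> homog (qmodel q) n" by (simp add: qmodel_def)
qed

definition qplane_to_model :: "'k::field \<Rightarrow> 'k free_alg set \<Rightarrow> 'k bipoly" where
  "qplane_to_model q K = the_elem (qplane_eval q ` K)"

lemma qplane_to_model:
  shows qplane_to_model_iso: "qplane_to_model q \<in> graded_algebra_iso (qplane q) (qmodel q)"
    and qplane_to_model_coset: "qplane_to_model q (genideal free_ring (qplane_rels q) +>\<^bsub>free_ring\<^esub> p) = qplane_eval q p"
    and ring_qplane: "ring (qplane q)"
proof -
  have surj: "range (qplane_eval q) = carrier (qmodel q)"
    using surjI[of "qplane_eval q" qplane_nf, OF qplane_eval_nf] by (simp add: qmodel_def)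
  have sc: "scalar (qmodel q) c = qplane_eval q (free_const c)" for c
    by (simp add: qplane_eval_const qmodel_def)
  note P = presented_algebra_iso[OF ring_qmodel qplane_eval_hom surj qplane_genideal sc homog_qmodel]
  show "qplane_to_model q \<in> graded_algebra_iso (qplane q) (qmodel q)"
    using P(1) by (simp add: qplane_to_model_def[abs_def] qplane_def)
  show "qplane_to_model q (genideal free_ring (qplane_rels q) +>\<^bsub>free_ring\<^esub> p) = qplane_eval q p"
    using P(2) by (simp add: qplane_to_model_def)
  show "ring (qplane q)"
    using P(3) by (simp add: qplane_def)
qed

lemma qplane_to_model_var:
  "qplane_to_model q (qplane_var q LX) = Poly_Mapping.single (1, 0) 1"
  "qplane_to_model q (qplane_var q LY) = Poly_Mapping.single (0, 1) 1"
  unfolding qplane_var_def qplane_to_model_coset by (simp_all add: qplane_eval_var)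

lemma qplane_closed:
  "scalar (qplane q) c \<in> carrier (qplane q)" "homog (qplane q) n \<subseteq> carrier (qplane q)"
  "qplane_var q a \<in> carrier (qplane q)"
  by (auto simp: qplane_def presented_algebra_def Let_def qplane_var_def FactRing_def A_RCOSETS_def'
      ring.defs)

section \<open>The graded centre of the quantum plane\<close>

text \<open>The exponents of the graded-central monomials, read off from commuting with \<open>x\<close> and \<open>y\<close>.\<close>

definition central_exponents :: "'k::field \<Rightarrow> (nat \<times> nat) set" where
  "central_exponents q = {(i, j). q ^ i = (- 1) ^ (i + j) \<and> q ^ j = (- 1) ^ (i + j)}"

lemma central_exponents_add:
  assumes "s \<in> central_exponents q" "t \<in> central_exponents q"
  shows "(fst s + fst t, snd s + snd t) \<in> central_exponents q"
  using assms by (auto simp: central_exponents_def power_add)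

lemma qmodel_simps:
  "carrier (qmodel q) = UNIV" "f \<otimes>\<^bsub>qmodel q\<^esub> g = qmult q f g" "f \<oplus>\<^bsub>qmodel q\<^esub> g = f + g"
  "\<zero>\<^bsub>qmodel q\<^esub> = 0" "\<one>\<^bsub>qmodel q\<^esub> = Poly_Mapping.single (0, 0) 1"
  "scalar (qmodel q) c = Poly_Mapping.single (0, 0) c"
  "f \<in> homog (qmodel q) n \<longleftrightarrow> (\<forall>s\<in>Poly_Mapping.keys f. fst s + snd s = n)"
  by (simp_all add: qmodel_def)

lemma keys_qmult:
  assumes "s \<in> Poly_Mapping.keys (qmult q f g)"
  shows "\<exists>a\<in>Poly_Mapping.keys f. \<exists>b\<in>Poly_Mapping.keys g. s = (fst a + fst b, snd a + snd b)"
proof (rule ccontr)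
  assume "\<not> ?thesis"
  then have "(fst a + fst b, snd a + snd b) \<noteq> s"
    if "a \<in> Poly_Mapping.keys f" "b \<in> Poly_Mapping.keys g" for a b
    using that by metis
  then have "Poly_Mapping.lookup (qmult q f g) s = 0"
    unfolding qmult_def linext_def lookup_sum
    by (intro sum.neutral ballI) (simp add: lookup_single)
  then show False using assms by (simp add: in_keys_iff)
qed

text \<open>Multiplying by x costs q^j only on the right, multiplying by y costs q^i only on the
  left. Reading the product at the shifted exponent isolates a single coefficient of z.\<close>

lemma lookup_qmult_var:
  "Poly_Mapping.lookup (qmult q z (Poly_Mapping.single (Suc 0, 0) 1)) (Suc i, j) = q ^ j * Poly_Mapping.lookup z (i, j)"
  "Poly_Mapping.lookup (qmult q (Poly_Mapping.single (Suc 0, 0) 1) z) (Suc i, j) = Poly_Mapping.lookup z (i, j)"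
  "Poly_Mapping.lookup (qmult q z (Poly_Mapping.single (0, Suc 0) 1)) (i, Suc j) = Poly_Mapping.lookup z (i, j)"
  "Poly_Mapping.lookup (qmult q (Poly_Mapping.single (0, Suc 0) 1) z) (i, Suc j) = q ^ i * Poly_Mapping.lookup z (i, j)"
proof (induction z rule: poly_mapping_add_induct)
  case (single s c)
  obtain a b where s: "s = (a, b)" by (cases s)
  {
    case 1 then show ?case by (simp add: s lookup_single when_def)
  next
    case 2 then show ?case by (simp add: s lookup_single when_def)
  next
    case 3 then show ?case by (simp add: s lookup_single when_def)
  next
    case 4 then show ?case by (simp add: s lookup_single when_def)
  }
qed (simp_all add: qmult_add_left qmult_add_right lookup_add algebra_simps)

lemma qmult_sum_left: "qmult q (\<Sum>s\<in>S. f s) g = (\<Sum>s\<in>S. qmult q (f s) g)"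
  by (induction S rule: infinite_finite_induct) (simp_all add: qmult_add_left)

lemma qmult_sum_right: "qmult q g (\<Sum>s\<in>S. f s) = (\<Sum>s\<in>S. qmult q g (f s))"
  by (induction S rule: infinite_finite_induct) (simp_all add: qmult_add_right)

lemma graded_commute_central_monomial:
  assumes ij: "(i, j) \<in> central_exponents q" and g: "\<And>s. s \<in> Poly_Mapping.keys g \<Longrightarrow> fst s + snd s = n"
  shows "qmult q (Poly_Mapping.single (i, j) c) g
    = (if even ((i + j) * n) then qmult q g (Poly_Mapping.single (i, j) c) else - qmult q g (Poly_Mapping.single (i, j) c))"
proof -
  let ?z = "Poly_Mapping.single (i, j) c"
  let ?m = "\<lambda>s. Poly_Mapping.single s (Poly_Mapping.lookup g s)"
  have step: "qmult q ?z (?m s) = (if even ((i + j) * n) then qmult q (?m s) ?z else - qmult q (?m s) ?z)"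
    if s: "s \<in> Poly_Mapping.keys g" for s
  proof -
    obtain k l where kl: "s = (k, l)" by (cases s)
    then have n: "n = k + l" using g[OF s] by simp
    \<comment> \<open>The products of x^i y^j and x^k y^l in the two orders give the same monomial,
      with weights q^(jk) and q^(li). Both weights are signs by centrality, namely (-1)^((i+j)k) and
      (-1)^((i+j)l), and they differ by (-1)^((i+j)n) as n = k + l.\<close>
    have "q ^ (j * k) = (- 1) ^ ((i + j) * n) * q ^ (l * i)"
    proof -
      have "q ^ (j * k) = (- 1) ^ ((i + j) * k)" "q ^ (i * l) = (- 1) ^ ((i + j) * l)"
        using ij by (simp_all add: central_exponents_def power_mult)
      then show ?thesis
        unfolding n distrib_left power_add mult.commute[of l i]
        by (simp add: mult.assoc)
    qed
    then show ?thesis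
      by (auto simp: kl add.commute mult.commute single_uminus[symmetric])
  qed
  have g_sum: "g = (\<Sum>s\<in>Poly_Mapping.keys g. ?m s)"
    using linext_single_id[of g] by (simp add: linext_def)
  have "qmult q ?z g = (\<Sum>s\<in>Poly_Mapping.keys g. qmult q ?z (?m s))"
    by (subst g_sum) (rule qmult_sum_right)
  also have "\<dots> = (if even ((i + j) * n) then (\<Sum>s\<in>Poly_Mapping.keys g. qmult q (?m s) ?z)
      else - (\<Sum>s\<in>Poly_Mapping.keys g. qmult q (?m s) ?z))"
    using step by (simp add: sum_negf[symmetric])
  also have "(\<Sum>s\<in>Poly_Mapping.keys g. qmult q (?m s) ?z) = qmult q g ?z"
    by (subst (3) g_sum) (rule qmult_sum_left[symmetric])
  finally show ?thesis .
qed

lemma qmodel_sum_in_generate_ring: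
  assumes "\<And>s. s \<in> Poly_Mapping.keys f \<Longrightarrow> Poly_Mapping.single s (Poly_Mapping.lookup f s) \<in> generate_ring (qmodel q) H"
  shows "f \<in> generate_ring (qmodel q) H"
proof -
  have "(\<Sum>s\<in>S. Poly_Mapping.single s (Poly_Mapping.lookup f s)) \<in> generate_ring (qmodel q) H"
    if "finite S" "S \<subseteq> Poly_Mapping.keys f" for S
    using that
  proof induction
    case empty
    then show ?case using ring.zero_in_generate[OF ring_qmodel, of q H] by (simp add: qmodel_simps)
  next
    case (insert s S)
    then show ?case
      using generate_ring.eng_add[OF assms[of s] insert.IH] by (simp add: qmodel_simps)
  qed
  from this[of "Poly_Mapping.keys f"] show ?thesis
    using linext_single_id[of f] by (simp add: linext_def)
qed

text \<open>Elements supported in a fixed submonoid \<open>T\<close> of exponents form a subring,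
  because a product is supported on sums of exponents.\<close>

lemma generate_ring_qmodel_keys:
  assumes "f \<in> generate_ring (qmodel q) H" and H: "\<And>h. h \<in> H \<Longrightarrow> Poly_Mapping.keys h \<subseteq> T"
    and T: "(0, 0) \<in> T" "\<And>s t. s \<in> T \<Longrightarrow> t \<in> T \<Longrightarrow> (fst s + fst t, snd s + snd t) \<in> T"
  shows "Poly_Mapping.keys f \<subseteq> T"
  using assms(1)
proof induction
  case (a_inv h)
  then show ?case by (auto simp: a_inv_qmodel in_keys_iff)
next
  case (eng_add f g)
  then show ?case using keys_add[of f g] by (auto simp: qmodel_simps)
next
  case (eng_mult f g)
  show ?case
  proof
    fix s assume "s \<in> Poly_Mapping.keys (f \<otimes>\<^bsub>qmodel q\<^esub> g)"
    then obtain a b where "a \<in> Poly_Mapping.keys f" "b \<in> Poly_Mapping.keys g"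
      "s = (fst a + fst b, snd a + snd b)"
      using keys_qmult[of s q f g] by (auto simp: qmodel_simps)
    then show "s \<in> T" using T(2)[of a b] eng_mult.IH by blast
  qed
qed (use H T in \<open>auto simp: qmodel_simps\<close>)

lemma graded_centre_qmodel:
  "graded_centre (qmodel q) = {f. Poly_Mapping.keys f \<subseteq> central_exponents q}"
proof -
  let ?Z = "{z. \<exists>m. z \<in> homog (qmodel q) m \<and> (\<forall>n. \<forall>g \<in> homog (qmodel q) n.
     z \<otimes>\<^bsub>qmodel q\<^esub> g = (if even (m * n) then g \<otimes>\<^bsub>qmodel q\<^esub> z else \<ominus>\<^bsub>qmodel q\<^esub> (g \<otimes>\<^bsub>qmodel q\<^esub> z)))}"
  have Z: "Poly_Mapping.keys z \<subseteq> central_exponents q" if "z \<in> ?Z" for z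
  proof
    fix s assume s: "s \<in> Poly_Mapping.keys z"
    obtain i j where ij: "s = (i, j)" by (cases s)
    obtain m where z: "z \<in> homog (qmodel q) m" "\<forall>n. \<forall>g \<in> homog (qmodel q) n.
       z \<otimes>\<^bsub>qmodel q\<^esub> g = (if even (m * n) then g \<otimes>\<^bsub>qmodel q\<^esub> z else \<ominus>\<^bsub>qmodel q\<^esub> (g \<otimes>\<^bsub>qmodel q\<^esub> z))"
      using \<open>z \<in> ?Z\<close> by blast
    have comm: "qmult q z g = (if even (m * n) then qmult q g z else - qmult q g z)"
      if "\<forall>s\<in>Poly_Mapping.keys g. fst s + snd s = n" for n g
      using z(2)[rule_format, of g n] that unfolding a_inv_qmodel qmodel_simps by blast
    have nz: "Poly_Mapping.lookup z (i, j) \<noteq> 0" using s by (simp add: ij in_keys_iff)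
    have m: "m = i + j" using z(1) s by (auto simp: qmodel_simps ij)
    let ?x = "Poly_Mapping.single (Suc 0, 0) 1" and ?y = "Poly_Mapping.single (0, Suc 0) 1"
    \<comment> \<open>Commuting with x is compared at x^(i+1) y^j, where only the coefficient of z
      at (i, j) enters. So each monomial of z is tested separately and turns out to be
      graded-central on its own.\<close>
    have "Poly_Mapping.lookup (qmult q z ?x) (Suc i, j) = (- 1) ^ m * Poly_Mapping.lookup (qmult q ?x z) (Suc i, j)"
      by (subst comm[of _ 1]) (simp_all add: minus_one_power_iff)
    then have "q ^ j = (- 1) ^ m"
      unfolding lookup_qmult_var using nz by simp
    moreover have "Poly_Mapping.lookup (qmult q z ?y) (i, Suc j) = (- 1) ^ m * Poly_Mapping.lookup (qmult q ?y z) (i, Suc j)"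
      by (subst comm[of _ 1]) (simp_all add: minus_one_power_iff)
    then have "1 * Poly_Mapping.lookup z (i, j) = ((- 1) ^ m * q ^ i) * Poly_Mapping.lookup z (i, j)"
      unfolding lookup_qmult_var by (simp only: mult_1 mult.assoc)
    then have "1 = (- 1) ^ m * q ^ i"
      using nz mult_right_cancel by blast
    \<comment> \<open>For y the weight q^i stands on the same side as the sign, so the sign is moved
      across by multiplying with it once more.\<close>
    then have "(- 1) ^ m * 1 = (- 1) ^ m * ((- 1) ^ m * q ^ i)" by (rule arg_cong)
    then have "q ^ i = (- 1) ^ m" by (simp add: mult.assoc[symmetric])
    ultimately have "q ^ j = (- 1) ^ m" "q ^ i = (- 1) ^ m" by simp_all
    then show "s \<in> central_exponents q" by (simp add: central_exponents_def ij m)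
  qed
  have "Poly_Mapping.keys f \<subseteq> central_exponents q" if "f \<in> generate_ring (qmodel q) ?Z" for f
    using that Z by (rule generate_ring_qmodel_keys) (auto simp: central_exponents_def power_add)
  moreover have "f \<in> generate_ring (qmodel q) ?Z" if f: "Poly_Mapping.keys f \<subseteq> central_exponents q" for f
  proof (rule qmodel_sum_in_generate_ring)
    fix s assume "s \<in> Poly_Mapping.keys f"
    then have s: "s \<in> central_exponents q" using f by auto
    obtain i j where ij: "s = (i, j)" by (cases s)
    have "Poly_Mapping.single s (Poly_Mapping.lookup f s) \<in> ?Z"
    proof (intro CollectI exI[of _ "i + j"] conjI allI ballI)
      show "Poly_Mapping.single s (Poly_Mapping.lookup f s) \<in> homog (qmodel q) (i + j)"
        by (simp add: qmodel_simps ij)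
      fix n g assume "g \<in> homog (qmodel q) n"
      then show "Poly_Mapping.single s (Poly_Mapping.lookup f s) \<otimes>\<^bsub>qmodel q\<^esub> g =
        (if even ((i + j) * n) then g \<otimes>\<^bsub>qmodel q\<^esub> Poly_Mapping.single s (Poly_Mapping.lookup f s)
         else \<ominus>\<^bsub>qmodel q\<^esub> (g \<otimes>\<^bsub>qmodel q\<^esub> Poly_Mapping.single s (Poly_Mapping.lookup f s)))"
        unfolding a_inv_qmodel qmodel_simps ij
        by (intro graded_commute_central_monomial) (use s ij in auto)
    qed
    then show "Poly_Mapping.single s (Poly_Mapping.lookup f s) \<in> generate_ring (qmodel q) ?Z"
      by (rule generate_ring.incl)
  qed
  ultimately show ?thesis
    unfolding graded_centre_def by blast
qed

text \<open>A subalgebra spanned by monomials is recognised by its monoid of exponents. Coefficient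
  1 suffices in \<open>gen\<close>, because the scalars lie in the subalgebra.\<close>

lemma subalgebra_generated_qmodel:
  fixes q :: "'k::field" and T :: "(nat \<times> nat) set"
  assumes S: "\<And>h. h \<in> S \<Longrightarrow> Poly_Mapping.keys h \<subseteq> T"
    and T: "(0, 0) \<in> T" "\<And>s t. s \<in> T \<Longrightarrow> t \<in> T \<Longrightarrow> (fst s + fst t, snd s + snd t) \<in> T"
    and gen: "\<And>s. s \<in> T \<Longrightarrow> Poly_Mapping.single s 1 \<in> subalgebra_generated (qmodel q) S"
  shows "subalgebra_generated (qmodel q) S = {f. Poly_Mapping.keys f \<subseteq> T}"
proof (intro subset_antisym subsetI)
  fix f assume "f \<in> subalgebra_generated (qmodel q) S"
  then have "f \<in> generate_ring (qmodel q) (range (scalar (qmodel q)) \<union> S)"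
    by (simp add: subalgebra_generated_def)
  then have "Poly_Mapping.keys f \<subseteq> T"
    by (rule generate_ring_qmodel_keys) (use S T in \<open>auto simp: qmodel_simps split: if_splits\<close>)
  then show "f \<in> {f. Poly_Mapping.keys f \<subseteq> T}" by simp
next
  fix f :: "'k bipoly" assume f: "f \<in> {f. Poly_Mapping.keys f \<subseteq> T}"
  let ?H = "range (scalar (qmodel q)) \<union> S"
  have "f \<in> generate_ring (qmodel q) ?H"
  proof (rule qmodel_sum_in_generate_ring)
    fix s assume "s \<in> Poly_Mapping.keys f"
    then have "Poly_Mapping.single s 1 \<in> generate_ring (qmodel q) ?H"
      using f gen[of s] unfolding subalgebra_generated_def by blast
    moreover have "Poly_Mapping.single (0, 0) (Poly_Mapping.lookup f s) \<in> generate_ring (qmodel q) ?H"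
      by (rule generate_ring.incl, rule UnI1, rule range_eqI[of _ _ "Poly_Mapping.lookup f s"])
         (simp add: qmodel_simps)
    moreover have "Poly_Mapping.single s (Poly_Mapping.lookup f s)
      = Poly_Mapping.single (0, 0) (Poly_Mapping.lookup f s) \<otimes>\<^bsub>qmodel q\<^esub> Poly_Mapping.single s 1"
      by (cases s) (simp add: qmodel_simps)
    ultimately show "Poly_Mapping.single s (Poly_Mapping.lookup f s) \<in> generate_ring (qmodel q) ?H"
      using generate_ring.eng_mult by metis
  qed
  then show "f \<in> subalgebra_generated (qmodel q) S" by (simp add: subalgebra_generated_def)
qed

lemma qmodel_pow:
  "(Poly_Mapping.single (i, 0) 1 :: 'k::field bipoly) [^]\<^bsub>qmodel q\<^esub> (n::nat) = Poly_Mapping.single (n * i, 0) 1"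
  "(Poly_Mapping.single (0, j) 1 :: 'k::field bipoly) [^]\<^bsub>qmodel q\<^esub> (n::nat) = Poly_Mapping.single (0, n * j) 1"
  by (induction n) (simp_all add: qmodel_simps nat_pow_def add.commute)

lemma qmodel_mult_single:
  "Poly_Mapping.single (i, j) a \<otimes>\<^bsub>qmodel q\<^esub> Poly_Mapping.single (k, l) b
    = Poly_Mapping.single (i + k, j + l) (q ^ (j * k) * (a * b))"
  by (simp add: qmodel_simps)

lemma generate_ring_nat_pow:
  assumes "ring R" "x \<in> generate_ring R H"
  shows "x [^]\<^bsub>R\<^esub> (n::nat) \<in> generate_ring R H"
proof -
  interpret ring R by fact
  show ?thesis
    by (induction n) (auto intro: generate_ring.one generate_ring.eng_mult assms(2))
qed

section \<open>Central exponents according to the order of q\<close>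

lemma primitive_root_power_eq_1_iff:
  assumes "is_primitive_root_of_unity r q"
  shows "q ^ n = 1 \<longleftrightarrow> r dvd n"
proof -
  have r: "r > 0" "q ^ r = 1" "\<And>n. 0 < n \<Longrightarrow> n < r \<Longrightarrow> q ^ n \<noteq> 1"
    using assms by (auto simp: is_primitive_root_of_unity_def)
  have "q ^ n = q ^ (n mod r + r * (n div r))" by simp
  also have "\<dots> = q ^ (n mod r)" unfolding power_add power_mult r(2) by simp
  finally have "q ^ n = q ^ (n mod r)" .
  then show ?thesis
    using r(1) r(3)[of "n mod r"] by (auto simp: dvd_eq_mod_eq_0)
qed

lemma char_eq_2_iff: "CHAR('k::field) = 2 \<longleftrightarrow> (- 1 :: 'k) = 1"
proof -
  have "(- 1 :: 'k) = 1 \<longleftrightarrow> of_nat 2 = (0 :: 'k)"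
    by (simp add: eq_neg_iff_add_eq_0 minus_equation_iff eq_commute[of "- 1 :: 'k"])
  also have "\<dots> \<longleftrightarrow> CHAR('k) dvd 2" by (rule of_nat_eq_0_iff_char_dvd)
  also have "\<dots> \<longleftrightarrow> CHAR('k) = 2"
    using CHAR_not_1[where ?'a = 'k] by (auto simp: dvd_def) (metis nat_mult_1 numeral_2_eq_2 One_nat_def dvdI prime_nat_iff two_is_prime_nat CHAR_not_1)
  finally show ?thesis by simp
qed

text \<open>If r is even, q^i = q^j forces i and j to agree modulo r and hence modulo 2, so the
  common sign (-1)^(i+j) is 1 and both exponents are multiples of r. In characteristic 2 there are
  no signs to begin with.\<close>

lemma central_exponents_even:
  assumes r: "is_primitive_root_of_unity r (q :: 'k::field)" and e: "even r \<or> CHAR('k) = 2"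
  shows "central_exponents q = {(r * a, r * b) |a b. True}"
proof -
  note iff = primitive_root_power_eq_1_iff[OF r]
  have q0: "q \<noteq> 0"
    using r by (auto simp: is_primitive_root_of_unity_def zero_power)
  have "r dvd i \<and> r dvd j" if "q ^ i = (- 1) ^ (i + j)" "q ^ j = (- 1) ^ (i + j)" for i j
  proof (cases "CHAR('k) = 2")
    case True
    then have neg: "(- 1 :: 'k) = 1" by (simp add: char_eq_2_iff)
    show ?thesis using that iff unfolding neg power_one by blast
  next
    case False
    then have "even r" using e by simp
    have "even (i + j)"
    proof -
      \<comment> \<open>Stated for an ordered pair, so that q^m can be cancelled from q^n = q^m
        q^(n-m); this uses that a root of unity is nonzero.\<close>
      have *: "even (m + n)" if "q ^ m = q ^ n" "m \<le> n" for m n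
      proof -
        have "q ^ n = q ^ (m + (n - m))" using that(2) by simp
        then have "q ^ n = q ^ m * q ^ (n - m)" by (simp only: power_add)
        then have "q ^ (n - m) = 1" using that q0 by simp
        then have "even (n - m)" using iff \<open>even r\<close> by (meson dvd_trans)
        then show ?thesis using that(2) by presburger
      qed
      show ?thesis using *[of i j] *[of j i] that by (metis add.commute nle_le)
    qed
    then show ?thesis using that iff by simp
  qed
  moreover have "q ^ (r * a) = (- 1) ^ (r * a + r * b) \<and> q ^ (r * b) = (- 1) ^ (r * a + r * b)" for a b
  proof (cases "CHAR('k) = 2")
    case True
    then have neg: "(- 1 :: 'k) = 1" by (simp add: char_eq_2_iff)
    show ?thesis unfolding neg power_one using iff by simp
  next
    case False
    then have "even r" using e by simp
    then have "even (r * a + r * b)" by simp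
    then show ?thesis using iff by (simp only: power_minus_even) simp
  qed
  ultimately show ?thesis
    by (auto simp: central_exponents_def dvd_def)
qed

text \<open>Squaring q^n = (-1)^m removes the sign and shows that r divides 2n, hence n, as r is
  odd. On multiples of r the powers of q are 1, so the sign must be 1 too; for odd r and -1 distinct
  from 1 this says that a + b is even.\<close>

lemma central_exponents_odd:
  assumes r: "is_primitive_root_of_unity r (q :: 'k::field)" and o: "odd r" "CHAR('k) \<noteq> 2"
  shows "central_exponents q = {(r * a, r * b) |a b. even (a + b)}"
proof -
  note iff = primitive_root_power_eq_1_iff[OF r]
  have neg: "(- 1 :: 'k) \<noteq> 1" using o(2) by (simp add: char_eq_2_iff)
  have dvd: "r dvd n" if "q ^ n = (- 1) ^ m" for n m
  proof -
    have "q ^ (2 * n) = (q ^ n) ^ 2" by (simp add: power_mult[symmetric] mult.commute)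
    also have "\<dots> = 1" unfolding that by (simp add: power_mult[symmetric])
    finally have "r dvd 2 * n" using iff by simp
    then show ?thesis using o(1) by (simp add: coprime_dvd_mult_right_iff)
  qed
  have "even (a + b)" if "q ^ (r * a) = (- 1) ^ (r * a + r * b)" for a b
  proof -
    have "q ^ (r * a) = 1" using iff by simp
    then have "(- 1 :: 'k) ^ (r * a + r * b) = 1" using that by simp
    then have "even (r * a + r * b)" using neg by (auto simp: minus_one_power_iff split: if_splits)
    then show ?thesis using o(1) by (auto simp: distrib_left[symmetric])
  qed
  note ev = this
  have conv: "q ^ (r * a) = (- 1) ^ (r * a + r * b) \<and> q ^ (r * b) = (- 1) ^ (r * a + r * b)"
    if "even (a + b)" for a b
  proof -
    have "even (r * a + r * b)" using that by (simp add: distrib_left[symmetric])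
    then show ?thesis using iff by (simp only: power_minus_even) simp
  qed
  show ?thesis
  proof (intro subset_antisym subsetI)
    fix s assume "s \<in> central_exponents q"
    then obtain i j where s: "s = (i, j)" "q ^ i = (- 1) ^ (i + j)" "q ^ j = (- 1) ^ (i + j)"
      by (auto simp: central_exponents_def)
    obtain a b where "i = r * a" "j = r * b"
      using dvd[OF s(2)] dvd[OF s(3)] by (auto elim!: dvdE)
    then show "s \<in> {(r * a, r * b) |a b. even (a + b)}"
      using ev[of a b] s by blast
  next
    fix s assume "s \<in> {(r * a, r * b) |a b. even (a + b)}"
    then obtain a b where "s = (r * a, r * b)" "even (a + b)" by blast
    then show "s \<in> central_exponents q"
      using conv[of a b] unfolding central_exponents_def by blast
  qed
qed

text \<open>Squaring q^n = (-1)^m would exhibit q as a root of unity unless n = 0. The case q = 0 is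
  included.\<close>

lemma central_exponents_non_root:
  assumes "\<not> is_root_of_unity q"
  shows "central_exponents q = {(0, 0)}"
proof -
  have "n = 0" if "q ^ n = (- 1) ^ m" for n m
  proof (rule ccontr)
    assume "n \<noteq> 0"
    then have "2 * n > 0" by simp
    moreover have "q ^ (2 * n) = (q ^ n) ^ 2" by (simp add: power_mult[symmetric] mult.commute)
    then have "q ^ (2 * n) = 1" unfolding that by (simp add: power_mult[symmetric])
    ultimately show False using assms unfolding is_root_of_unity_def by blast
  qed
  then show ?thesis by (auto simp: central_exponents_def)
qed

section \<open>The graded centre of the model in the three cases\<close>

lemma graded_centre_qmodel_non_root:
  assumes "\<not> is_root_of_unity q"
  shows "graded_centre (qmodel q) = range (scalar (qmodel q))"
proof -
  have "f = Poly_Mapping.single (0, 0) (Poly_Mapping.lookup f (0, 0))"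
    if "Poly_Mapping.keys f \<subseteq> {(0, 0)}" for f :: "'a bipoly"
    by (rule poly_mapping_eqI) (use that in \<open>auto simp: lookup_single when_def in_keys_iff\<close>)
  then show ?thesis
    unfolding graded_centre_qmodel central_exponents_non_root[OF assms]
    by (auto simp: qmodel_def split: if_splits)
qed

lemma graded_centre_qmodel_even:
  assumes "is_primitive_root_of_unity r (q :: 'k::field)" "even r \<or> CHAR('k) = 2"
  shows "graded_centre (qmodel q) = subalgebra_generated (qmodel q)
    {Poly_Mapping.single (1, 0) 1 [^]\<^bsub>qmodel q\<^esub> r, Poly_Mapping.single (0, 1) 1 [^]\<^bsub>qmodel q\<^esub> r}"
    (is "_ = subalgebra_generated _ ?S")
proof -
  have "subalgebra_generated (qmodel q) ?S = {f. Poly_Mapping.keys f \<subseteq> central_exponents q}"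
  proof (rule subalgebra_generated_qmodel)
    show "(0, 0) \<in> central_exponents q" by (simp add: central_exponents_def)
    have c: "(r, 0) \<in> central_exponents q" "(0, r) \<in> central_exponents q"
      unfolding central_exponents_even[OF assms] by (auto intro: exI[of _ 0] exI[of _ 1])
    show "Poly_Mapping.keys h \<subseteq> central_exponents q" if "h \<in> ?S" for h
      using that c by (auto simp: qmodel_pow split: if_splits)
    fix s assume "s \<in> central_exponents q"
    then obtain a b where s: "s = (r * a, r * b)"
      unfolding central_exponents_even[OF assms] by blast
    let ?H = "range (scalar (qmodel q)) \<union> ?S"
    have "(Poly_Mapping.single (1, 0) 1 [^]\<^bsub>qmodel q\<^esub> r) [^]\<^bsub>qmodel q\<^esub> a
       \<otimes>\<^bsub>qmodel q\<^esub> (Poly_Mapping.single (0, 1) 1 [^]\<^bsub>qmodel q\<^esub> r) [^]\<^bsub>qmodel q\<^esub> b \<in> generate_ring (qmodel q) ?H"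
      by (intro generate_ring.eng_mult generate_ring_nat_pow[OF ring_qmodel] generate_ring.incl) simp_all
    then show "Poly_Mapping.single s 1 \<in> subalgebra_generated (qmodel q) ?S"
      by (simp add: subalgebra_generated_def s qmodel_pow qmodel_mult_single mult.commute)
  qed (rule central_exponents_add)
  then show ?thesis by (simp only: graded_centre_qmodel)
qed

lemma graded_centre_qmodel_odd:
  assumes "is_primitive_root_of_unity r (q :: 'k::field)" "odd r" "CHAR('k) \<noteq> 2"
  shows "graded_centre (qmodel q) = subalgebra_generated (qmodel q)
    {Poly_Mapping.single (1, 0) 1 [^]\<^bsub>qmodel q\<^esub> (2 * r),
     Poly_Mapping.single (1, 0) 1 [^]\<^bsub>qmodel q\<^esub> r \<otimes>\<^bsub>qmodel q\<^esub> Poly_Mapping.single (0, 1) 1 [^]\<^bsub>qmodel q\<^esub> r,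
     Poly_Mapping.single (0, 1) 1 [^]\<^bsub>qmodel q\<^esub> (2 * r)}"
    (is "_ = subalgebra_generated _ {?x, ?xy, ?y}")
proof -
  let ?S = "{?x, ?xy, ?y}"
  have "subalgebra_generated (qmodel q) ?S = {f. Poly_Mapping.keys f \<subseteq> central_exponents q}"
  proof (rule subalgebra_generated_qmodel)
    show "(0, 0) \<in> central_exponents q" by (simp add: central_exponents_def)
    have c: "(r * a, r * b) \<in> central_exponents q" if "even (a + b)" for a b
      unfolding central_exponents_odd[OF assms] using that by blast
    have "(2 * r, 0) \<in> central_exponents q" "(r, r) \<in> central_exponents q" "(0, 2 * r) \<in> central_exponents q"
      using c[of 2 0] c[of 1 1] c[of 0 2] by (simp_all add: mult.commute)
    then show "Poly_Mapping.keys h \<subseteq> central_exponents q" if "h \<in> ?S" for h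
      using that by (auto simp: qmodel_pow qmodel_mult_single split: if_splits)
    fix s assume "s \<in> central_exponents q"
    then obtain a b where s: "s = (r * a, r * b)" and ab: "even (a + b)"
      unfolding central_exponents_odd[OF assms] by blast
    let ?H = "range (scalar (qmodel q)) \<union> ?S"
    have pow: "g [^]\<^bsub>qmodel q\<^esub> (n::nat) \<in> generate_ring (qmodel q) ?H" if "g \<in> ?S" for g n
      by (rule generate_ring_nat_pow[OF ring_qmodel], rule generate_ring.incl, rule UnI2, rule that)
    \<comment> \<open>As a and b have the same parity, (ra, rb) splits into multiples of (2r, 0) and
      (0, 2r) and at most one (r, r). In this order no y precedes an x, so no power of q
      appears.\<close>
    have "?x [^]\<^bsub>qmodel q\<^esub> (a div 2) \<otimes>\<^bsub>qmodel q\<^esub> ?xy [^]\<^bsub>qmodel q\<^esub> (a mod 2) \<otimes>\<^bsub>qmodel q\<^esub> ?y [^]\<^bsub>qmodel q\<^esub> (b div 2)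
      \<in> generate_ring (qmodel q) ?H"
      by (intro generate_ring.eng_mult pow) simp_all
    moreover have "?x [^]\<^bsub>qmodel q\<^esub> (a div 2) \<otimes>\<^bsub>qmodel q\<^esub> ?xy [^]\<^bsub>qmodel q\<^esub> (a mod 2) \<otimes>\<^bsub>qmodel q\<^esub> ?y [^]\<^bsub>qmodel q\<^esub> (b div 2)
      = Poly_Mapping.single (a div 2 * (2 * r) + a mod 2 * r, a mod 2 * r + b div 2 * (2 * r)) 1"
    proof -
      have xy: "?xy = Poly_Mapping.single (r, r) 1" by (simp add: qmodel_pow qmodel_mult_single)
      have xyp: "?xy [^]\<^bsub>qmodel q\<^esub> (a mod 2) = Poly_Mapping.single (a mod 2 * r, a mod 2 * r) 1"
        unfolding xy by (cases "even a") (simp_all add: nat_pow_def qmodel_simps odd_iff_mod_2_eq_one)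
      show ?thesis unfolding xyp by (simp add: qmodel_pow qmodel_mult_single)
    qed
    moreover have "a div 2 * (2 * r) + a mod 2 * r = r * a"
    proof -
      have "a div 2 * (2 * r) + a mod 2 * r = (a div 2 * 2 + a mod 2) * r" by (simp only: distrib_right mult.assoc)
      then show ?thesis by (simp add: mult.commute)
    qed
    moreover have "a mod 2 * r + b div 2 * (2 * r) = r * b"
    proof -
      have "a mod 2 = b mod 2" using ab by presburger
      then have "a mod 2 * r + b div 2 * (2 * r) = (b mod 2 + b div 2 * 2) * r" by (simp only: distrib_right mult.assoc)
      then show ?thesis by (simp add: mult.commute)
    qed
    ultimately show "Poly_Mapping.single s 1 \<in> subalgebra_generated (qmodel q) ?S"
      by (simp only: subalgebra_generated_def s)
  qed (rule central_exponents_add)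
  then show ?thesis by (simp only: graded_centre_qmodel)
qed

section \<open>Transport to the presented quantum plane\<close>

lemma inj_image_eqD: "inj_on f C \<Longrightarrow> A \<subseteq> C \<Longrightarrow> B \<subseteq> C \<Longrightarrow> f ` A = f ` B \<Longrightarrow> A = B"
  by (simp add: inj_on_image_eq_iff)

text \<open>Both sides of each equation lie in the carrier, where the isomorphism to the model is
  injective. So it suffices to compare images, and x and y go to the monomials with exponents (1, 0)
  and (0, 1).\<close>

lemma graded_centre_qplane:
  fixes q :: "'k::field"
  shows "\<not> is_root_of_unity q \<Longrightarrow> graded_centre (qplane q) = range (scalar (qplane q))"
    and "\<And>r. is_primitive_root_of_unity r q \<and> (even r \<or> CHAR('k) = 2) \<Longrightarrow>
      graded_centre (qplane q) = subalgebra_generated (qplane q)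
        {qplane_var q LX [^]\<^bsub>qplane q\<^esub> r, qplane_var q LY [^]\<^bsub>qplane q\<^esub> r}"
    and "\<And>r. is_primitive_root_of_unity r q \<and> odd r \<and> CHAR('k) \<noteq> 2 \<Longrightarrow>
      graded_centre (qplane q) = subalgebra_generated (qplane q)
        {qplane_var q LX [^]\<^bsub>qplane q\<^esub> (2 * r),
         qplane_var q LX [^]\<^bsub>qplane q\<^esub> r \<otimes>\<^bsub>qplane q\<^esub> qplane_var q LY [^]\<^bsub>qplane q\<^esub> r,
         qplane_var q LY [^]\<^bsub>qplane q\<^esub> (2 * r)}"
proof -
  let ?\<phi> = "qplane_to_model q"
  note iso = qplane_to_model_iso[of q]
  interpret H: ring_hom_ring "qplane q" "qmodel q" ?\<phi>
    using ring_qplane ring_qmodel graded_algebra_isoD(2)[OF iso] by (intro ring_hom_ringI2)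
  have inj: "inj_on ?\<phi> (carrier (qplane q))"
    using graded_algebra_isoD(3)[OF iso] by (simp add: bij_betw_def)
  have centre: "?\<phi> ` graded_centre (qplane q) = graded_centre (qmodel q)"
    using graded_centre_image[OF ring_qplane ring_qmodel iso] qplane_closed(2) by blast
  have centre_car: "graded_centre (qplane q) \<subseteq> carrier (qplane q)"
    unfolding graded_centre_def by (rule H.R.generate_ring_incl) (use qplane_closed(2) in blast)
  have sc: "?\<phi> (scalar (qplane q) c) = scalar (qmodel q) c" for c
    by (rule graded_algebra_isoD(4)[OF iso])
  have range: "range (scalar (qplane q)) \<subseteq> carrier (qplane q)"
    using qplane_closed(1) by blast
  have gen_car: "subalgebra_generated (qplane q) S \<subseteq> carrier (qplane q)" if "S \<subseteq> carrier (qplane q)" for S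
    unfolding subalgebra_generated_def by (rule H.R.generate_ring_incl) (use that range in blast)
  note gen = subalgebra_generated_image[OF ring_qplane ring_qmodel iso range]
  have pow: "?\<phi> (x [^]\<^bsub>qplane q\<^esub> n) = ?\<phi> x [^]\<^bsub>qmodel q\<^esub> n" if "x \<in> carrier (qplane q)" for x and n :: nat
    using that by (induction n) simp_all
  show "graded_centre (qplane q) = range (scalar (qplane q))" if "\<not> is_root_of_unity q"
  proof (rule inj_image_eqD[OF inj centre_car])
    show "?\<phi> ` graded_centre (qplane q) = ?\<phi> ` range (scalar (qplane q))"
      unfolding centre graded_centre_qmodel_non_root[OF that] by (auto simp: sc image_iff)
  qed (use qplane_closed(1) in auto)
  note var = qplane_closed(3)[of q LX] qplane_closed(3)[of q LY]
  show "graded_centre (qplane q) = subalgebra_generated (qplane q)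
        {qplane_var q LX [^]\<^bsub>qplane q\<^esub> r, qplane_var q LY [^]\<^bsub>qplane q\<^esub> r}" (is "_ = subalgebra_generated _ ?S")
    if "is_primitive_root_of_unity r q \<and> (even r \<or> CHAR('k) = 2)" for r
  proof (rule inj_image_eqD[OF inj centre_car])
    have S: "?S \<subseteq> carrier (qplane q)" using var by auto
    then show "subalgebra_generated (qplane q) ?S \<subseteq> carrier (qplane q)" by (rule gen_car)
    show "?\<phi> ` graded_centre (qplane q) = ?\<phi> ` subalgebra_generated (qplane q) ?S"
      unfolding centre gen[OF S] graded_centre_qmodel_even[OF conjunct1[OF that] conjunct2[OF that]]
      using var by (simp add: pow qplane_to_model_var)
  qed
  show "graded_centre (qplane q) = subalgebra_generated (qplane q)
        {qplane_var q LX [^]\<^bsub>qplane q\<^esub> (2 * r),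
         qplane_var q LX [^]\<^bsub>qplane q\<^esub> r \<otimes>\<^bsub>qplane q\<^esub> qplane_var q LY [^]\<^bsub>qplane q\<^esub> r,
         qplane_var q LY [^]\<^bsub>qplane q\<^esub> (2 * r)}" (is "_ = subalgebra_generated _ ?S")
    if r: "is_primitive_root_of_unity r q \<and> odd r \<and> CHAR('k) \<noteq> 2" for r
  proof (rule inj_image_eqD[OF inj centre_car])
    have S: "?S \<subseteq> carrier (qplane q)" using var by auto
    then show "subalgebra_generated (qplane q) ?S \<subseteq> carrier (qplane q)" by (rule gen_car)
    have odd: "graded_centre (qmodel q) = subalgebra_generated (qmodel q) (?\<phi> ` ?S)"
      using graded_centre_qmodel_odd[of r q] r var by (simp add: pow qplane_to_model_var)
    show "?\<phi> ` graded_centre (qplane q) = ?\<phi> ` subalgebra_generated (qplane q) ?S"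
      unfolding centre gen[OF S] by (rule odd)
  qed
qed

section \<open>Homological algebra over an arbitrary ring\<close>

section \<open>Homomorphisms of left modules\<close>

lemma lmod_homD:
  assumes "f \<in> lmod_hom R M N"
  shows "x \<in> carrier M \<Longrightarrow> f x \<in> carrier N"
    and "x \<in> carrier M \<Longrightarrow> y \<in> carrier M \<Longrightarrow> f (x \<oplus>\<^bsub>M\<^esub> y) = f x \<oplus>\<^bsub>N\<^esub> f y"
    and "r \<in> carrier R \<Longrightarrow> x \<in> carrier M \<Longrightarrow> f (r \<odot>\<^bsub>M\<^esub> x) = r \<odot>\<^bsub>N\<^esub> f x"
    and "x \<notin> carrier M \<Longrightarrow> f x = undefined"
  using assms by (auto simp: lmod_hom_def PiE_def extensional_def)

lemma lmod_homI:
  assumes "left_module R M"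
    and "\<And>x. x \<in> carrier M \<Longrightarrow> f x \<in> carrier N"
    and "\<And>x y. x \<in> carrier M \<Longrightarrow> y \<in> carrier M \<Longrightarrow> f (x \<oplus>\<^bsub>M\<^esub> y) = f x \<oplus>\<^bsub>N\<^esub> f y"
    and "\<And>r x. r \<in> carrier R \<Longrightarrow> x \<in> carrier M \<Longrightarrow> f (r \<odot>\<^bsub>M\<^esub> x) = r \<odot>\<^bsub>N\<^esub> f x"
  shows "(\<lambda>x\<in>carrier M. f x) \<in> lmod_hom R M N"
proof -
  interpret left_module R M by fact
  show ?thesis using assms(2-4) by (auto simp: lmod_hom_def smult_closed)
qed

text \<open>Homomorphisms are \<open>undefined\<close> outside the carrier by definition, so
  agreement on the carrier is equality of functions.\<close>

lemma lmod_hom_eqI: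
  assumes "f \<in> lmod_hom R M N" "g \<in> lmod_hom R M N" "\<And>x. x \<in> carrier M \<Longrightarrow> f x = g x"
  shows "f = g"
  using assms lmod_homD(4)[OF assms(1)] lmod_homD(4)[OF assms(2)] by (metis ext)

lemma left_module_abelian_group: "left_module R M \<Longrightarrow> abelian_group M"
  by (simp add: left_module_def)

lemma lmod_hom_group_hom:
  assumes "left_module R M" "left_module R N" "f \<in> lmod_hom R M N"
  shows "abelian_group_hom M N f"
  using assms lmod_homD[OF assms(3)]
  by (intro abelian_group_homI group_hom.intro group_hom_axioms.intro homI)
     (auto simp: left_module_abelian_group abelian_group.a_group)

lemma lmod_hom_zero:
  assumes "left_module R M" "left_module R N" "f \<in> lmod_hom R M N"
  shows "f \<zero>\<^bsub>M\<^esub> = \<zero>\<^bsub>N\<^esub>"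
  using abelian_group_hom.hom_zero[OF lmod_hom_group_hom[OF assms]] .

lemma lmod_hom_a_inv:
  assumes "left_module R M" "left_module R N" "f \<in> lmod_hom R M N" "x \<in> carrier M"
  shows "f (\<ominus>\<^bsub>M\<^esub> x) = \<ominus>\<^bsub>N\<^esub> f x"
  using abelian_group_hom.hom_a_inv[OF lmod_hom_group_hom[OF assms(1-3)] assms(4)] .

lemma lmod_hom_compose:
  assumes "left_module R M" "g \<in> lmod_hom R M N" "f \<in> lmod_hom R N L"
  shows "(\<lambda>x\<in>carrier M. f (g x)) \<in> lmod_hom R M L"
  using lmod_homD[OF assms(2)] lmod_homD[OF assms(3)] by (intro lmod_homI[OF assms(1)]) auto

lemma left_module_smult_zero:
  assumes "left_module R M" "r \<in> carrier R"
  shows "r \<odot>\<^bsub>M\<^esub> \<zero>\<^bsub>M\<^esub> = \<zero>\<^bsub>M\<^esub>"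
proof -
  interpret left_module R M by fact
  have "r \<odot>\<^bsub>M\<^esub> \<zero>\<^bsub>M\<^esub> \<oplus>\<^bsub>M\<^esub> r \<odot>\<^bsub>M\<^esub> \<zero>\<^bsub>M\<^esub> = r \<odot>\<^bsub>M\<^esub> \<zero>\<^bsub>M\<^esub> \<oplus>\<^bsub>M\<^esub> \<zero>\<^bsub>M\<^esub>"
    using assms(2) smult_r_distr[of r "\<zero>\<^bsub>M\<^esub>" "\<zero>\<^bsub>M\<^esub>"] smult_closed by simp
  then show ?thesis using assms(2) smult_closed M.add.l_cancel by simp
qed

lemma left_module_zero_smult:
  assumes "left_module R M" "x \<in> carrier M"
  shows "\<zero>\<^bsub>R\<^esub> \<odot>\<^bsub>M\<^esub> x = \<zero>\<^bsub>M\<^esub>"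
proof -
  interpret left_module R M by fact
  have "\<zero>\<^bsub>R\<^esub> \<odot>\<^bsub>M\<^esub> x \<oplus>\<^bsub>M\<^esub> \<zero>\<^bsub>R\<^esub> \<odot>\<^bsub>M\<^esub> x = \<zero>\<^bsub>R\<^esub> \<odot>\<^bsub>M\<^esub> x \<oplus>\<^bsub>M\<^esub> \<zero>\<^bsub>M\<^esub>"
    using assms(2) smult_l_distr[of "\<zero>\<^bsub>R\<^esub>" "\<zero>\<^bsub>R\<^esub>" x] smult_closed by simp
  then show ?thesis using assms(2) smult_closed M.add.l_cancel by simp
qed

lemma left_module_smult_a_inv:
  assumes "left_module R M" "r \<in> carrier R" "x \<in> carrier M"
  shows "r \<odot>\<^bsub>M\<^esub> (\<ominus>\<^bsub>M\<^esub> x) = \<ominus>\<^bsub>M\<^esub> (r \<odot>\<^bsub>M\<^esub> x)"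
proof -
  interpret left_module R M by fact
  have "r \<odot>\<^bsub>M\<^esub> (\<ominus>\<^bsub>M\<^esub> x) \<oplus>\<^bsub>M\<^esub> r \<odot>\<^bsub>M\<^esub> x = \<zero>\<^bsub>M\<^esub>"
    using assms smult_r_distr[of r "\<ominus>\<^bsub>M\<^esub> x" x] left_module_smult_zero[OF assms(1,2)]
    by (simp add: M.l_neg)
  then show ?thesis using assms smult_closed M.minus_equality by simp
qed

lemma lmod_hom_finsum:
  assumes "left_module R M" "left_module R N" "f \<in> lmod_hom R M N" "a \<in> A \<rightarrow> carrier M" "finite A"
  shows "f (\<Oplus>\<^bsub>M\<^esub>i\<in>A. a i) = (\<Oplus>\<^bsub>N\<^esub>i\<in>A. f (a i))"
proof -
  interpret M: abelian_group M using assms(1) by (rule left_module_abelian_group)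
  interpret N: abelian_group N using assms(2) by (rule left_module_abelian_group)
  show ?thesis
    using assms(5,4)
  proof (induction A)
    case empty
    then show ?case using lmod_hom_zero[OF assms(1-3)] by simp
  next
    case (insert i A)
    then have "a \<in> A \<rightarrow> carrier M" "a i \<in> carrier M" by auto
    then show ?case
      using insert lmod_homD(1,2)[OF assms(3)] by (simp add: Pi_iff)
  qed
qed

lemma left_module_smult_finsum:
  assumes "left_module R M" "r \<in> carrier R" "a \<in> A \<rightarrow> carrier M" "finite A"
  shows "r \<odot>\<^bsub>M\<^esub> (\<Oplus>\<^bsub>M\<^esub>i\<in>A. a i) = (\<Oplus>\<^bsub>M\<^esub>i\<in>A. r \<odot>\<^bsub>M\<^esub> a i)"
proof -
  interpret left_module R M by fact
  show ?thesis
    using assms(4,3)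
  proof (induction A)
    case empty
    then show ?case using left_module_smult_zero[OF assms(1,2)] by simp
  next
    case (insert i A)
    then have "a \<in> A \<rightarrow> carrier M" "a i \<in> carrier M" by auto
    then show ?case
      using insert assms(2) smult_r_distr smult_closed by (simp add: Pi_iff)
  qed
qed


section \<open>Free and projective modules\<close>

lemma free_lmod_simps [simp]:
  "carrier (free_lmod R I) = {c \<in> I \<rightarrow>\<^sub>E carrier R. finite {i \<in> I. c i \<noteq> \<zero>\<^bsub>R\<^esub>}}"
  "\<zero>\<^bsub>free_lmod R I\<^esub> = (\<lambda>i\<in>I. \<zero>\<^bsub>R\<^esub>)"
  "c \<oplus>\<^bsub>free_lmod R I\<^esub> c' = (\<lambda>i\<in>I. c i \<oplus>\<^bsub>R\<^esub> c' i)"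
  "r \<odot>\<^bsub>free_lmod R I\<^esub> c = (\<lambda>i\<in>I. r \<otimes>\<^bsub>R\<^esub> c i)"
  by (simp_all add: free_lmod_def)

lemma left_module_free_lmod:
  assumes "ring R"
  shows "left_module R (free_lmod R I)"
proof -
  interpret ring R by fact
  have support: "finite {i \<in> I. (\<lambda>i\<in>I. c i) i \<noteq> \<zero>\<^bsub>R\<^esub>}"
    if "finite {i \<in> I. a i \<noteq> \<zero>\<^bsub>R\<^esub>}" "finite {i \<in> I. b i \<noteq> \<zero>\<^bsub>R\<^esub>}"
      "\<And>i. i \<in> I \<Longrightarrow> a i = \<zero>\<^bsub>R\<^esub> \<Longrightarrow> b i = \<zero>\<^bsub>R\<^esub> \<Longrightarrow> c i = \<zero>\<^bsub>R\<^esub>" for a b c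
    by (rule finite_subset[OF _ finite_UnI[OF that(1,2)]]) (use that(3) in auto)
  show ?thesis
  proof (rule left_module.intro)
    show "abelian_group (free_lmod R I)"
    proof (rule abelian_groupI)
      fix x y assume "x \<in> carrier (free_lmod R I)" "y \<in> carrier (free_lmod R I)"
      then show "x \<oplus>\<^bsub>free_lmod R I\<^esub> y \<in> carrier (free_lmod R I)"
        using support[of x y "\<lambda>i. x i \<oplus>\<^bsub>R\<^esub> y i"] by (auto simp: PiE_iff)
    next
      fix x assume x: "x \<in> carrier (free_lmod R I)"
      show "\<exists>y\<in>carrier (free_lmod R I). y \<oplus>\<^bsub>free_lmod R I\<^esub> x = \<zero>\<^bsub>free_lmod R I\<^esub>"
      proof
        show "(\<lambda>i\<in>I. \<ominus>\<^bsub>R\<^esub> x i) \<in> carrier (free_lmod R I)"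
          using x support[of x x "\<lambda>i. \<ominus>\<^bsub>R\<^esub> x i"] by (auto simp: PiE_iff)
        show "(\<lambda>i\<in>I. \<ominus>\<^bsub>R\<^esub> x i) \<oplus>\<^bsub>free_lmod R I\<^esub> x = \<zero>\<^bsub>free_lmod R I\<^esub>"
          using x by (auto simp: PiE_iff l_neg intro!: restrict_ext)
      qed
      show "\<zero>\<^bsub>free_lmod R I\<^esub> \<oplus>\<^bsub>free_lmod R I\<^esub> x = x"
        using x by (auto simp: PiE_iff extensional_def restrict_def fun_eq_iff)
    next
      show "\<zero>\<^bsub>free_lmod R I\<^esub> \<in> carrier (free_lmod R I)"
        using support[of "\<lambda>i. \<zero>\<^bsub>R\<^esub>" "\<lambda>i. \<zero>\<^bsub>R\<^esub>" "\<lambda>i. \<zero>\<^bsub>R\<^esub>"] by auto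
    qed (auto simp: PiE_iff a_ac intro!: restrict_ext)
    show "left_module_axioms R (free_lmod R I)"
    proof
      fix a x assume "a \<in> carrier R" "x \<in> carrier (free_lmod R I)"
      then show "a \<odot>\<^bsub>free_lmod R I\<^esub> x \<in> carrier (free_lmod R I)"
        using support[of x x "\<lambda>i. a \<otimes>\<^bsub>R\<^esub> x i"] by (auto simp: PiE_iff)
    next
      fix x assume "x \<in> carrier (free_lmod R I)"
      then show "\<one>\<^bsub>R\<^esub> \<odot>\<^bsub>free_lmod R I\<^esub> x = x"
        by (auto simp: PiE_iff extensional_def restrict_def fun_eq_iff)
    qed (auto simp: PiE_iff l_distr r_distr m_assoc intro!: restrict_ext)
  qed (rule assms)
qed

definition unit_vector :: "('a, 'c) ring_scheme \<Rightarrow> 'i set \<Rightarrow> 'i \<Rightarrow> 'i \<Rightarrow> 'a" where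
  "unit_vector R I i = (\<lambda>j\<in>I. if j = i then \<one>\<^bsub>R\<^esub> else \<zero>\<^bsub>R\<^esub>)"

lemma unit_vector_closed:
  assumes "ring R" "i \<in> I"
  shows "unit_vector R I i \<in> carrier (free_lmod R I)"
proof -
  interpret ring R by fact
  have "finite {j \<in> I. unit_vector R I i j \<noteq> \<zero>\<^bsub>R\<^esub>}"
    by (rule finite_subset[of _ "{i}"]) (auto simp: unit_vector_def)
  then show ?thesis by (auto simp: unit_vector_def)
qed

lemma free_lmod_hom_expansion:
  assumes R: "ring R" and N: "left_module R N" and f: "f \<in> lmod_hom R (free_lmod R I) N"
    and "finite T" "T \<subseteq> I" "c \<in> carrier (free_lmod R I)" "\<And>i. i \<in> I \<Longrightarrow> i \<notin> T \<Longrightarrow> c i = \<zero>\<^bsub>R\<^esub>"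
  shows "f c = (\<Oplus>\<^bsub>N\<^esub>i\<in>T. c i \<odot>\<^bsub>N\<^esub> f (unit_vector R I i))"
  using assms(4-7)
proof (induction T arbitrary: c)
  case empty
  interpret abelian_group N using N by (rule left_module_abelian_group)
  have c: "c = \<zero>\<^bsub>free_lmod R I\<^esub>"
    using empty by (auto simp: PiE_iff extensional_def restrict_def fun_eq_iff)
  show ?case
    unfolding c lmod_hom_zero[OF left_module_free_lmod[OF R] N f] by simp
next
  case (insert t T)
  interpret N: left_module R N by (rule N)
  note F = left_module_free_lmod[OF R, of I]
  let ?c = "\<lambda>i\<in>I. if i = t then \<zero>\<^bsub>R\<^esub> else c i"
  have t: "t \<in> I" "c t \<in> carrier R" using insert.prems by (auto simp: PiE_iff)
  have c': "?c \<in> carrier (free_lmod R I)"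
  proof -
    have "finite {i \<in> I. ?c i \<noteq> \<zero>\<^bsub>R\<^esub>}"
      by (rule finite_subset[of _ "{i \<in> I. c i \<noteq> \<zero>\<^bsub>R\<^esub>}"]) (use insert.prems in auto)
    then show ?thesis using insert.prems by (auto simp: PiE_iff)
  qed
  have u: "unit_vector R I i \<in> carrier (free_lmod R I)" if "i \<in> I" for i
    using unit_vector_closed[OF R that] .
  have eq: "c = ?c \<oplus>\<^bsub>free_lmod R I\<^esub> (c t \<odot>\<^bsub>free_lmod R I\<^esub> unit_vector R I t)"
    using insert.prems t by (auto simp: PiE_iff extensional_def unit_vector_def fun_eq_iff)
  have smult: "c t \<odot>\<^bsub>free_lmod R I\<^esub> unit_vector R I t \<in> carrier (free_lmod R I)"
    using left_module.smult_closed[OF F t(2) u[OF t(1)]] .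
  have summand: "c i \<odot>\<^bsub>N\<^esub> f (unit_vector R I i) \<in> carrier N" if "i \<in> I" for i
    using that lmod_homD(1)[OF f u[OF that]] insert.prems(2) by (auto simp: PiE_iff intro!: N.smult_closed)
  have "f c = f ?c \<oplus>\<^bsub>N\<^esub> c t \<odot>\<^bsub>N\<^esub> f (unit_vector R I t)"
    using lmod_homD(2)[OF f c' smult] lmod_homD(3)[OF f t(2) u[OF t(1)]] eq by metis
  also have "f ?c = (\<Oplus>\<^bsub>N\<^esub>i\<in>T. ?c i \<odot>\<^bsub>N\<^esub> f (unit_vector R I i))"
    using insert by (intro insert.IH c') auto
  also have "\<dots> = (\<Oplus>\<^bsub>N\<^esub>i\<in>T. c i \<odot>\<^bsub>N\<^esub> f (unit_vector R I i))"
    by (rule N.M.finsum_cong') (use insert summand in auto)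
  finally have expand: "f c = (\<Oplus>\<^bsub>N\<^esub>i\<in>T. c i \<odot>\<^bsub>N\<^esub> f (unit_vector R I i)) \<oplus>\<^bsub>N\<^esub> c t \<odot>\<^bsub>N\<^esub> f (unit_vector R I t)" .
  have closed: "(\<lambda>i. c i \<odot>\<^bsub>N\<^esub> f (unit_vector R I i)) \<in> T \<rightarrow> carrier N"
    using insert.prems(1) summand by auto
  show ?case
    unfolding expand N.M.finsum_insert[OF insert.hyps closed summand[OF t(1)]]
    by (rule N.M.a_comm[OF N.M.finsum_closed[OF closed] summand[OF t(1)]])
qed

lemma free_lmod_lift:
  assumes R: "ring R" and A: "left_module R A" and a: "\<And>i. i \<in> I \<Longrightarrow> a i \<in> carrier A"
  obtains g where "g \<in> lmod_hom R (free_lmod R I) A" "\<And>i. i \<in> I \<Longrightarrow> g (unit_vector R I i) = a i"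
proof -
  interpret A: left_module R A by (rule A)
  let ?S = "\<lambda>c. {i \<in> I. c i \<noteq> \<zero>\<^bsub>R\<^esub>}"
  let ?g = "\<lambda>c. \<Oplus>\<^bsub>A\<^esub>i\<in>?S c. c i \<odot>\<^bsub>A\<^esub> a i"
  \<comment> \<open>The defining sum runs over the support of c, which changes with c. Any larger
    finite index set gives the same value, so additivity can be checked over the union of two
    supports, and compatibility with scalars over the support before scaling.\<close>
  have sup: "?g c = (\<Oplus>\<^bsub>A\<^esub>i\<in>T. c i \<odot>\<^bsub>A\<^esub> a i)"
    if "c \<in> carrier (free_lmod R I)" "finite T" "?S c \<subseteq> T" "T \<subseteq> I" for c T
    by (rule A.M.add.finprod_mono_neutral_cong_left)
       (use that a left_module_zero_smult[OF A] in \<open>auto simp: PiE_iff subset_iff intro!: A.smult_closed\<close>)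
  have closed: "c i \<odot>\<^bsub>A\<^esub> a i \<in> carrier A" if "c \<in> carrier (free_lmod R I)" "i \<in> I" for c i
    using that a by (auto simp: PiE_iff intro!: A.smult_closed)
  have "(\<lambda>c\<in>carrier (free_lmod R I). ?g c) \<in> lmod_hom R (free_lmod R I) A"
  proof (rule lmod_homI[OF left_module_free_lmod[OF R]])
    fix c assume c: "c \<in> carrier (free_lmod R I)"
    then show "?g c \<in> carrier A" using closed[OF c] by (intro A.M.finsum_closed) auto
    fix r assume r: "r \<in> carrier R"
    have rc: "r \<odot>\<^bsub>free_lmod R I\<^esub> c \<in> carrier (free_lmod R I)"
      using left_module.smult_closed[OF left_module_free_lmod[OF R] r c] .
    have "?g (r \<odot>\<^bsub>free_lmod R I\<^esub> c) = (\<Oplus>\<^bsub>A\<^esub>i\<in>?S c. (r \<odot>\<^bsub>free_lmod R I\<^esub> c) i \<odot>\<^bsub>A\<^esub> a i)"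
      by (rule sup[OF rc]) (use c r in auto)
    also have "\<dots> = (\<Oplus>\<^bsub>A\<^esub>i\<in>?S c. r \<odot>\<^bsub>A\<^esub> (c i \<odot>\<^bsub>A\<^esub> a i))"
    proof (rule A.M.finsum_cong')
      fix i assume i: "i \<in> ?S c"
      then have "c i \<in> carrier R" using c by (auto simp: PiE_iff)
      then show "(r \<odot>\<^bsub>free_lmod R I\<^esub> c) i \<odot>\<^bsub>A\<^esub> a i = r \<odot>\<^bsub>A\<^esub> (c i \<odot>\<^bsub>A\<^esub> a i)"
        using i r a by (simp add: A.smult_assoc1)
    qed (auto intro!: A.smult_closed[OF r] closed[OF c])
    also have "\<dots> = r \<odot>\<^bsub>A\<^esub> ?g c"
      by (rule left_module_smult_finsum[OF A r, symmetric]) (use c closed[OF c] in auto)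
    finally show "?g (r \<odot>\<^bsub>free_lmod R I\<^esub> c) = r \<odot>\<^bsub>A\<^esub> ?g c" .
  next
    fix c c' assume c: "c \<in> carrier (free_lmod R I)" and c': "c' \<in> carrier (free_lmod R I)"
    have cc: "c \<oplus>\<^bsub>free_lmod R I\<^esub> c' \<in> carrier (free_lmod R I)"
      using abelian_monoid.a_closed[OF abelian_group.axioms(1)[OF left_module_abelian_group[OF left_module_free_lmod[OF R]]] c c'] .
    let ?T = "?S c \<union> ?S c'"
    have fin: "finite ?T" "?T \<subseteq> I" using c c' by auto
    have "?g (c \<oplus>\<^bsub>free_lmod R I\<^esub> c') = (\<Oplus>\<^bsub>A\<^esub>i\<in>?T. (c \<oplus>\<^bsub>free_lmod R I\<^esub> c') i \<odot>\<^bsub>A\<^esub> a i)"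
      by (rule sup[OF cc fin(1) _ fin(2)]) auto
    also have "\<dots> = (\<Oplus>\<^bsub>A\<^esub>i\<in>?T. c i \<odot>\<^bsub>A\<^esub> a i \<oplus>\<^bsub>A\<^esub> c' i \<odot>\<^bsub>A\<^esub> a i)"
    proof (rule A.M.finsum_cong')
      fix i assume i: "i \<in> ?T"
      then have "c i \<in> carrier R" "c' i \<in> carrier R" "i \<in> I" using c c' by (auto simp: PiE_iff)
      then show "(c \<oplus>\<^bsub>free_lmod R I\<^esub> c') i \<odot>\<^bsub>A\<^esub> a i = c i \<odot>\<^bsub>A\<^esub> a i \<oplus>\<^bsub>A\<^esub> c' i \<odot>\<^bsub>A\<^esub> a i"
        using a by (simp add: A.smult_l_distr)
    qed (use closed[OF c] closed[OF c'] in auto)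
    also have "\<dots> = (\<Oplus>\<^bsub>A\<^esub>i\<in>?T. c i \<odot>\<^bsub>A\<^esub> a i) \<oplus>\<^bsub>A\<^esub> (\<Oplus>\<^bsub>A\<^esub>i\<in>?T. c' i \<odot>\<^bsub>A\<^esub> a i)"
      by (rule A.M.finsum_addf) (use closed[OF c] closed[OF c'] in auto)
    also have "(\<Oplus>\<^bsub>A\<^esub>i\<in>?T. c i \<odot>\<^bsub>A\<^esub> a i) = ?g c"
      by (rule sup[OF c fin(1) _ fin(2), symmetric]) auto
    also have "(\<Oplus>\<^bsub>A\<^esub>i\<in>?T. c' i \<odot>\<^bsub>A\<^esub> a i) = ?g c'"
      by (rule sup[OF c' fin(1) _ fin(2), symmetric]) auto
    finally show "?g (c \<oplus>\<^bsub>free_lmod R I\<^esub> c') = ?g c \<oplus>\<^bsub>A\<^esub> ?g c'" .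
  qed
  moreover have "(\<lambda>c\<in>carrier (free_lmod R I). ?g c) (unit_vector R I i) = a i" if i: "i \<in> I" for i
  proof -
    have u: "unit_vector R I i \<in> carrier (free_lmod R I)" using unit_vector_closed[OF R i] .
    have "?g (unit_vector R I i) = (\<Oplus>\<^bsub>A\<^esub>j\<in>{i}. unit_vector R I i j \<odot>\<^bsub>A\<^esub> a j)"
      by (rule sup[OF u]) (use i in \<open>auto simp: unit_vector_def\<close>)
    also have "\<dots> = a i"
      using i a A.smult_one by (simp add: unit_vector_def Pi_iff)
    finally show ?thesis using u by (simp only: restrict_apply' if_True)
  qed
  ultimately show thesis using that by blast
qed

text \<open>Lift f composed with the projection of the free module, basis vector by basis vector,
  and restrict along the section. Preimages under p are asked for only on the image of f, which is
  the form that exactness of a resolution delivers.\<close>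

lemma projective_lmod_lift:
  fixes M :: "('a, 'b, 'd) module_scheme"
  assumes M: "projective_lmod R M" and A: "left_module R A" and B: "left_module R B"
    and p: "p \<in> lmod_hom R A B" and f: "f \<in> lmod_hom R M B"
    and onto: "\<And>x. x \<in> carrier M \<Longrightarrow> \<exists>a\<in>carrier A. p a = f x"
  shows "\<exists>g\<in>lmod_hom R M A. \<forall>x\<in>carrier M. p (g x) = f x"
proof -
  obtain I :: "'b set" and s \<pi> where LM: "left_module R M" and s: "s \<in> lmod_hom R M (free_lmod R I)"
    and \<pi>: "\<pi> \<in> lmod_hom R (free_lmod R I) M" and retract: "\<And>x. x \<in> carrier M \<Longrightarrow> \<pi> (s x) = x"
    using M unfolding projective_lmod_def by auto
  have R: "ring R" using LM by (simp add: left_module_def)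
  note F = left_module_free_lmod[OF R]
  have "\<forall>i\<in>I. \<exists>a\<in>carrier A. p a = f (\<pi> (unit_vector R I i))"
    by (intro ballI onto lmod_homD(1)[OF \<pi>] unit_vector_closed[OF R])
  from bchoice[OF this[unfolded Bex_def]] obtain a where "\<forall>i\<in>I. a i \<in> carrier A \<and> p (a i) = f (\<pi> (unit_vector R I i))"
    by blast
  then have a: "\<And>i. i \<in> I \<Longrightarrow> a i \<in> carrier A" "\<And>i. i \<in> I \<Longrightarrow> p (a i) = f (\<pi> (unit_vector R I i))"
    by simp_all
  obtain g where g: "g \<in> lmod_hom R (free_lmod R I) A" "\<And>i. i \<in> I \<Longrightarrow> g (unit_vector R I i) = a i"
    using free_lmod_lift[where I = I and a = a, OF R A a(1)] by blast
  have eq: "p (g c) = f (\<pi> c)" if c: "c \<in> carrier (free_lmod R I)" for c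
  proof -
    let ?T = "{i \<in> I. c i \<noteq> \<zero>\<^bsub>R\<^esub>}"
    have T: "finite ?T" "?T \<subseteq> I" "\<And>i. i \<in> I \<Longrightarrow> i \<notin> ?T \<Longrightarrow> c i = \<zero>\<^bsub>R\<^esub>" using c by auto
    let ?pg = "\<lambda>c\<in>carrier (free_lmod R I). p (g c)" and ?fp = "\<lambda>c\<in>carrier (free_lmod R I). f (\<pi> c)"
    have "?pg c = (\<Oplus>\<^bsub>B\<^esub>i\<in>?T. c i \<odot>\<^bsub>B\<^esub> ?pg (unit_vector R I i))"
      by (rule free_lmod_hom_expansion[OF R B lmod_hom_compose[OF F g(1) p] T(1,2) c T(3)])
    also have "\<dots> = (\<Oplus>\<^bsub>B\<^esub>i\<in>?T. c i \<odot>\<^bsub>B\<^esub> ?fp (unit_vector R I i))"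
    proof -
      have "?pg (unit_vector R I i) = ?fp (unit_vector R I i)" if "i \<in> I" for i
        using that unit_vector_closed[OF R that] g(2) a(2) by (simp only: restrict_apply' if_True)
      moreover have "c i \<odot>\<^bsub>B\<^esub> ?fp (unit_vector R I i) \<in> carrier B" if "i \<in> I" for i
        using that c lmod_homD(1)[OF lmod_hom_compose[OF F \<pi> f] unit_vector_closed[OF R that]]
        by (intro left_module.smult_closed[OF B]) (auto simp: PiE_iff)
      ultimately show ?thesis
        by (intro abelian_monoid.finsum_cong' abelian_group.axioms(1)[OF left_module_abelian_group[OF B]])
           (auto simp del: free_lmod_simps(1) restrict_apply)
    qed
    also have "\<dots> = ?fp c"
      by (rule free_lmod_hom_expansion[OF R B lmod_hom_compose[OF F \<pi> f] T(1,2) c T(3), symmetric])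
    finally show ?thesis using c by (simp only: restrict_apply' if_True)
  qed
  have "(\<lambda>x\<in>carrier M. g (s x)) \<in> lmod_hom R M A"
    by (rule lmod_hom_compose[OF LM s g(1)])
  moreover have "p (g (s x)) = f x" if "x \<in> carrier M" for x
    using eq[OF lmod_homD(1)[OF s that]] retract[OF that] by simp
  ultimately show ?thesis
    by (intro bexI[of _ "\<lambda>x\<in>carrier M. g (s x)"]) auto
qed

section \<open>Signs\<close>

text \<open>The factor (-1)^n. The degree is an integer, so that the degree n - 1 of a homotopy is
  always covered, and the module is an argument because each component of a complex has its own
  negation.\<close>

definition signed :: "('b, 'm) ring_scheme \<Rightarrow> int \<Rightarrow> 'b \<Rightarrow> 'b" where
  "signed M n x = (if even n then x else \<ominus>\<^bsub>M\<^esub> x)"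

context abelian_group
begin

lemma signed_closed: "x \<in> carrier G \<Longrightarrow> signed G n x \<in> carrier G"
  by (simp add: signed_def)

lemma signed_zero [simp]: "signed G n \<zero> = \<zero>"
  by (simp add: signed_def)

lemma signed_add:
  "x \<in> carrier G \<Longrightarrow> y \<in> carrier G \<Longrightarrow> signed G n (x \<oplus> y) = signed G n x \<oplus> signed G n y"
  by (simp add: signed_def minus_add)

lemma signed_signed: "x \<in> carrier G \<Longrightarrow> signed G m (signed G n x) = signed G (m + n) x"
  by (auto simp: signed_def)

lemma signed_cancel: "x \<in> carrier G \<Longrightarrow> signed G n (signed G n x) = x"
  by (simp add: signed_def)

end

lemma lmod_hom_signed:
  assumes "left_module R M" "left_module R N" "f \<in> lmod_hom R M N" "x \<in> carrier M"
  shows "f (signed M n x) = signed N n (f x)"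
  using lmod_hom_a_inv[OF assms] by (simp add: signed_def)

lemma smult_signed:
  assumes "left_module R M" "r \<in> carrier R" "x \<in> carrier M"
  shows "r \<odot>\<^bsub>M\<^esub> signed M n x = signed M n (r \<odot>\<^bsub>M\<^esub> x)"
  using left_module_smult_a_inv[OF assms] by (simp add: signed_def)


section \<open>Complexes of left modules\<close>

definition lcomplex :: "('a, 'c) ring_scheme \<Rightarrow> (int \<Rightarrow> ('a, 'p) module) \<Rightarrow> (int \<Rightarrow> 'p \<Rightarrow> 'p) \<Rightarrow> bool" where
  "lcomplex R P d \<longleftrightarrow> (\<forall>j. left_module R (P j)) \<and> (\<forall>j. d j \<in> lmod_hom R (P j) (P (j - 1))) \<and>
     (\<forall>j. \<forall>x\<in>carrier (P j). d (j - 1) (d j x) = \<zero>\<^bsub>P (j - 1 - 1)\<^esub>)"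

lemma lcomplexD:
  assumes "lcomplex R P d"
  shows "left_module R (P j)" "abelian_group (P j)" "d j \<in> lmod_hom R (P j) (P (j - 1))"
    and "x \<in> carrier (P j) \<Longrightarrow> d j x \<in> carrier (P (j - 1))"
    and "x \<in> carrier (P j) \<Longrightarrow> d (j - 1) (d j x) = \<zero>\<^bsub>P (j - 1 - 1)\<^esub>"
  using assms lmod_homD(1)[of "d j" R "P j" "P (j - 1)" x]
  by (auto simp: lcomplex_def intro: left_module_abelian_group)

text \<open>\<open>hom_deg\<close> has only maps of a complex to itself, while the comparison maps
  run between two complexes with elements of different types.\<close>

definition hom_family :: "('a, 'c) ring_scheme \<Rightarrow> (int \<Rightarrow> ('a, 'p) module) \<Rightarrow> (int \<Rightarrow> ('a, 's) module)
    \<Rightarrow> int \<Rightarrow> (int \<Rightarrow> 'p \<Rightarrow> 's) set" where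
  "hom_family R P Q n = {f. \<forall>j. f j \<in> lmod_hom R (P j) (Q (j - n))}"

lemma hom_familyD:
  assumes "f \<in> hom_family R P Q n"
  shows "f j \<in> lmod_hom R (P j) (Q (j - n))"
    and "x \<in> carrier (P j) \<Longrightarrow> f j x \<in> carrier (Q (j - n))"
  using assms lmod_homD(1)[of "f j" R "P j" "Q (j - n)" x] by (auto simp: hom_family_def)

definition chain_maps :: "('a, 'c) ring_scheme \<Rightarrow> (int \<Rightarrow> ('a, 'p) module) \<Rightarrow> (int \<Rightarrow> 'p \<Rightarrow> 'p) \<Rightarrow>
    (int \<Rightarrow> ('a, 's) module) \<Rightarrow> (int \<Rightarrow> 's \<Rightarrow> 's) \<Rightarrow> int \<Rightarrow> (int \<Rightarrow> 'p \<Rightarrow> 's) set" where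
  "chain_maps R P d Q d' n = {f \<in> hom_family R P Q n.
     \<forall>j. \<forall>x\<in>carrier (P j). d' (j - n) (f j x) = signed (Q (j - 1 - n)) n (f (j - 1) (d j x))}"

text \<open>These are the boundaries D h = d h - (-1)^(n-1) h d of families h of degree n - 1, which
  explains the sign (-1)^n in front of h d.\<close>

definition null_homotopic :: "('a, 'c) ring_scheme \<Rightarrow> (int \<Rightarrow> ('a, 'p) module) \<Rightarrow> (int \<Rightarrow> 'p \<Rightarrow> 'p) \<Rightarrow>
    (int \<Rightarrow> ('a, 's) module) \<Rightarrow> (int \<Rightarrow> 's \<Rightarrow> 's) \<Rightarrow> int \<Rightarrow> (int \<Rightarrow> 'p \<Rightarrow> 's) \<Rightarrow> bool" where
  "null_homotopic R P d Q d' n f \<longleftrightarrow> (\<exists>h\<in>hom_family R P Q (n - 1). \<forall>j. \<forall>x\<in>carrier (P j).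
     f j x = d' (j - (n - 1)) (h j x) \<oplus>\<^bsub>Q (j - n)\<^esub> signed (Q (j - n)) n (h (j - 1) (d j x)))"

text \<open>The integer j - n selects a module of the family, so facts about one component match
  only after its index has been brought to a common form.\<close>

lemma int_shift: "(j::int) - n - 1 = j - 1 - n" "(j::int) - (n - 1) - 1 = j - n" "(j::int) - 1 - (n - 1) = j - n"
  by simp_all

lemma chain_mapsD:
  assumes "f \<in> chain_maps R P d Q d' n"
  shows "f \<in> hom_family R P Q n" "f j \<in> lmod_hom R (P j) (Q (j - n))"
    and "x \<in> carrier (P j) \<Longrightarrow> f j x \<in> carrier (Q (j - n))"
    and "x \<in> carrier (P j) \<Longrightarrow> d' (j - n) (f j x) = signed (Q (j - 1 - n)) n (f (j - 1) (d j x))"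
  using assms hom_familyD[of f R P Q n] by (auto simp: chain_maps_def)

lemma homotopyD:
  assumes "h \<in> hom_family R P Q (n - 1)" "lcomplex R P d" "lcomplex R Q d'" "x \<in> carrier (P j)"
  shows "h j x \<in> carrier (Q (j - (n - 1)))" "d' (j - (n - 1)) (h j x) \<in> carrier (Q (j - n))"
    "h (j - 1) (d j x) \<in> carrier (Q (j - n))"
    "signed (Q (j - n)) n (h (j - 1) (d j x)) \<in> carrier (Q (j - n))"
proof -
  show a: "h j x \<in> carrier (Q (j - (n - 1)))"
    using hom_familyD(2)[OF assms(1,4)] .
  show "d' (j - (n - 1)) (h j x) \<in> carrier (Q (j - n))"
    using lcomplexD(4)[OF assms(3) a] by (simp only: int_shift)
  show b: "h (j - 1) (d j x) \<in> carrier (Q (j - n))"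
    using hom_familyD(2)[OF assms(1) lcomplexD(4)[OF assms(2,4)]] by (simp only: int_shift)
  show "signed (Q (j - n)) n (h (j - 1) (d j x)) \<in> carrier (Q (j - n))"
    using abelian_group.signed_closed[OF lcomplexD(2)[OF assms(3)] b] .
qed

definition comp_maps :: "(int \<Rightarrow> ('a, 'p) module) \<Rightarrow> int \<Rightarrow> (int \<Rightarrow> 's \<Rightarrow> 't) \<Rightarrow> (int \<Rightarrow> 'p \<Rightarrow> 's) \<Rightarrow> int \<Rightarrow> 'p \<Rightarrow> 't" where
  "comp_maps P n f g = (\<lambda>j. \<lambda>x\<in>carrier (P j). f (j - n) (g j x))"

definition add_maps :: "(int \<Rightarrow> ('a, 'p) module) \<Rightarrow> (int \<Rightarrow> ('a, 's) module) \<Rightarrow> int \<Rightarrow>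
    (int \<Rightarrow> 'p \<Rightarrow> 's) \<Rightarrow> (int \<Rightarrow> 'p \<Rightarrow> 's) \<Rightarrow> int \<Rightarrow> 'p \<Rightarrow> 's" where
  "add_maps P Q n f g = (\<lambda>j. \<lambda>x\<in>carrier (P j). f j x \<oplus>\<^bsub>Q (j - n)\<^esub> g j x)"

definition signed_maps :: "(int \<Rightarrow> ('a, 'p) module) \<Rightarrow> (int \<Rightarrow> ('a, 's) module) \<Rightarrow> int \<Rightarrow> int \<Rightarrow>
    (int \<Rightarrow> 'p \<Rightarrow> 's) \<Rightarrow> int \<Rightarrow> 'p \<Rightarrow> 's" where
  "signed_maps P Q n m f = (\<lambda>j. \<lambda>x\<in>carrier (P j). signed (Q (j - n)) m (f j x))"

lemma hom_family_comp:
  assumes "lcomplex R P d" "f \<in> hom_family R Q S m" "g \<in> hom_family R P Q n"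
  shows "comp_maps P n f g \<in> hom_family R P S (m + n)"
proof -
  have "(\<lambda>x\<in>carrier (P j). f (j - n) (g j x)) \<in> lmod_hom R (P j) (S (j - n - m))" for j
    by (rule lmod_hom_compose[OF lcomplexD(1)[OF assms(1)] hom_familyD(1)[OF assms(3)] hom_familyD(1)[OF assms(2)]])
  moreover have "j - n - m = j - (m + n)" for j by simp
  ultimately show ?thesis by (simp add: hom_family_def comp_maps_def)
qed

lemma lmod_hom_add:
  assumes M: "left_module R M" and N: "left_module R N" and f: "f \<in> lmod_hom R M N" and g: "g \<in> lmod_hom R M N"
  shows "(\<lambda>x\<in>carrier M. f x \<oplus>\<^bsub>N\<^esub> g x) \<in> lmod_hom R M N"
proof -
  interpret N: left_module R N by fact
  note F = lmod_homD[OF f] and G = lmod_homD[OF g]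
  show ?thesis
    by (rule lmod_homI[OF M]) (simp_all add: F(1-3) G(1-3) N.smult_r_distr N.M.a_ac)
qed

lemma lmod_hom_signed_map:
  assumes M: "left_module R M" and N: "left_module R N" and f: "f \<in> lmod_hom R M N"
  shows "(\<lambda>x\<in>carrier M. signed N m (f x)) \<in> lmod_hom R M N"
proof -
  interpret N: left_module R N by fact
  note F = lmod_homD[OF f]
  show ?thesis
    by (rule lmod_homI[OF M]) (simp_all add: F(1-3) N.M.signed_closed N.M.signed_add smult_signed[OF N])
qed

lemma hom_family_add:
  assumes "lcomplex R P d" "lcomplex R Q d'" "f \<in> hom_family R P Q n" "g \<in> hom_family R P Q n"
  shows "add_maps P Q n f g \<in> hom_family R P Q n"
  using lmod_hom_add[OF lcomplexD(1)[OF assms(1)] lcomplexD(1)[OF assms(2)] hom_familyD(1)[OF assms(3)] hom_familyD(1)[OF assms(4)]]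
  by (simp add: hom_family_def add_maps_def)

lemma hom_family_signed:
  assumes "lcomplex R P d" "lcomplex R Q d'" "f \<in> hom_family R P Q n"
  shows "signed_maps P Q n m f \<in> hom_family R P Q n"
  using lmod_hom_signed_map[OF lcomplexD(1)[OF assms(1)] lcomplexD(1)[OF assms(2)] hom_familyD(1)[OF assms(3)]]
  by (simp add: hom_family_def signed_maps_def)

lemma chain_maps_comp:
  assumes P: "lcomplex R P d" and Q: "lcomplex R Q dQ" and S: "lcomplex R S dS"
    and f: "f \<in> chain_maps R Q dQ S dS m" and g: "g \<in> chain_maps R P d Q dQ n"
  shows "comp_maps P n f g \<in> chain_maps R P d S dS (m + n)"
proof -
  have "dS (j - (m + n)) (f (j - n) (g j x)) = signed (S (j - 1 - (m + n))) (m + n) (f (j - 1 - n) (g (j - 1) (d j x)))"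
    if x: "x \<in> carrier (P j)" for j x
  proof -
    have eq: "j - (m + n) = j - n - m" "j - 1 - (m + n) = j - 1 - n - m" "j - n - 1 = j - 1 - n" by simp_all
    have dx: "d j x \<in> carrier (P (j - 1))" using lcomplexD(4)[OF P x] .
    have gx: "g (j - 1) (d j x) \<in> carrier (Q (j - 1 - n))" using chain_mapsD(3)[OF g dx] .
    have fgx: "f (j - 1 - n) (g (j - 1) (d j x)) \<in> carrier (S (j - 1 - n - m))"
      using chain_mapsD(3)[OF f gx] .
    have "dS (j - n - m) (f (j - n) (g j x)) = signed (S (j - n - 1 - m)) m (f (j - n - 1) (dQ (j - n) (g j x)))"
      using chain_mapsD(4)[OF f chain_mapsD(3)[OF g x]] .
    also have "\<dots> = signed (S (j - 1 - n - m)) m (f (j - 1 - n) (signed (Q (j - 1 - n)) n (g (j - 1) (d j x))))"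
      unfolding chain_mapsD(4)[OF g x] eq(3) ..
    also have "\<dots> = signed (S (j - 1 - n - m)) m (signed (S (j - 1 - n - m)) n (f (j - 1 - n) (g (j - 1) (d j x))))"
      using lmod_hom_signed[OF lcomplexD(1)[OF Q] lcomplexD(1)[OF S] chain_mapsD(2)[OF f] gx] by simp
    finally show ?thesis
      unfolding eq(1,2) abelian_group.signed_signed[OF lcomplexD(2)[OF S] fgx] .
  qed
  then show ?thesis
    using hom_family_comp[OF P chain_mapsD(1)[OF f] chain_mapsD(1)[OF g]] lcomplexD(4)[OF P]
    by (simp add: chain_maps_def comp_maps_def)
qed

lemma chain_maps_add:
  assumes P: "lcomplex R P d" and Q: "lcomplex R Q d'"
    and f: "f \<in> chain_maps R P d Q d' n" and g: "g \<in> chain_maps R P d Q d' n"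
  shows "add_maps P Q n f g \<in> chain_maps R P d Q d' n"
proof -
  have "d' (j - n) (f j x \<oplus>\<^bsub>Q (j - n)\<^esub> g j x) = signed (Q (j - 1 - n)) n (f (j - 1) (d j x) \<oplus>\<^bsub>Q (j - 1 - n)\<^esub> g (j - 1) (d j x))"
    if x: "x \<in> carrier (P j)" for j x
  proof -
    have dx: "d j x \<in> carrier (P (j - 1))" using lcomplexD(4)[OF P x] .
    show ?thesis
      using lmod_homD(2)[OF lcomplexD(3)[OF Q] chain_mapsD(3)[OF f x] chain_mapsD(3)[OF g x]]
        abelian_group.signed_add[OF lcomplexD(2)[OF Q] chain_mapsD(3)[OF f dx] chain_mapsD(3)[OF g dx]]
      unfolding chain_mapsD(4)[OF f x] chain_mapsD(4)[OF g x] int_shift(1) by simp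
  qed
  then show ?thesis
    using hom_family_add[OF P Q chain_mapsD(1)[OF f] chain_mapsD(1)[OF g]] lcomplexD(4)[OF P]
    by (simp add: chain_maps_def add_maps_def)
qed

lemma chain_maps_signed:
  assumes P: "lcomplex R P d" and Q: "lcomplex R Q d'" and f: "f \<in> chain_maps R P d Q d' n"
  shows "signed_maps P Q n m f \<in> chain_maps R P d Q d' n"
proof -
  have "d' (j - n) (signed (Q (j - n)) m (f j x)) = signed (Q (j - 1 - n)) n (signed (Q (j - 1 - n)) m (f (j - 1) (d j x)))"
    if x: "x \<in> carrier (P j)" for j x
  proof -
    have fdx: "f (j - 1) (d j x) \<in> carrier (Q (j - 1 - n))"
      using chain_mapsD(3)[OF f lcomplexD(4)[OF P x]] .
    show ?thesis
      using lmod_hom_signed[OF lcomplexD(1)[OF Q] lcomplexD(1)[OF Q] lcomplexD(3)[OF Q] chain_mapsD(3)[OF f x], of m]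
      unfolding chain_mapsD(4)[OF f x] int_shift(1)
      by (simp add: abelian_group.signed_signed[OF lcomplexD(2)[OF Q] fdx] add.commute)
  qed
  then show ?thesis
    using hom_family_signed[OF P Q chain_mapsD(1)[OF f]] lcomplexD(4)[OF P]
    by (simp add: chain_maps_def signed_maps_def)
qed

section \<open>Null-homotopies under sums, signs and composition\<close>

lemma null_homotopic_add:
  assumes P: "lcomplex R P d" and Q: "lcomplex R Q d'"
    and f: "null_homotopic R P d Q d' n f" and g: "null_homotopic R P d Q d' n g"
  shows "null_homotopic R P d Q d' n (add_maps P Q n f g)"
proof -
  obtain h where h: "h \<in> hom_family R P Q (n - 1)" and fh: "\<And>j x. x \<in> carrier (P j) \<Longrightarrow>
      f j x = d' (j - (n - 1)) (h j x) \<oplus>\<^bsub>Q (j - n)\<^esub> signed (Q (j - n)) n (h (j - 1) (d j x))"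
    using f unfolding null_homotopic_def by blast
  obtain k where k: "k \<in> hom_family R P Q (n - 1)" and gk: "\<And>j x. x \<in> carrier (P j) \<Longrightarrow>
      g j x = d' (j - (n - 1)) (k j x) \<oplus>\<^bsub>Q (j - n)\<^esub> signed (Q (j - n)) n (k (j - 1) (d j x))"
    using g unfolding null_homotopic_def by blast
  have "f j x \<oplus>\<^bsub>Q (j - n)\<^esub> g j x = d' (j - (n - 1)) (h j x \<oplus>\<^bsub>Q (j - (n - 1))\<^esub> k j x)
      \<oplus>\<^bsub>Q (j - n)\<^esub> signed (Q (j - n)) n (h (j - 1) (d j x) \<oplus>\<^bsub>Q (j - n)\<^esub> k (j - 1) (d j x))"
    if x: "x \<in> carrier (P j)" for j x
  proof -
    interpret Qj: abelian_group "Q (j - n)" by (rule lcomplexD(2)[OF Q])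
    note H = homotopyD[OF h P Q x] and K = homotopyD[OF k P Q x]
    have "d' (j - (n - 1)) (h j x \<oplus>\<^bsub>Q (j - (n - 1))\<^esub> k j x) = d' (j - (n - 1)) (h j x) \<oplus>\<^bsub>Q (j - n)\<^esub> d' (j - (n - 1)) (k j x)"
      using lmod_homD(2)[OF lcomplexD(3)[OF Q] H(1) K(1)] by (simp only: int_shift)
    then show ?thesis
      by (simp add: fh[OF x] gk[OF x] Qj.signed_add H(2-4) K(2-4) Qj.a_ac)
  qed
  then show ?thesis
    unfolding null_homotopic_def
    by (intro bexI[OF _ hom_family_add[OF P Q h k]]) (simp add: add_maps_def lcomplexD(4)[OF P] int_shift(3))
qed

lemma null_homotopic_signed:
  assumes P: "lcomplex R P d" and Q: "lcomplex R Q d'" and f: "null_homotopic R P d Q d' n f"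
  shows "null_homotopic R P d Q d' n (signed_maps P Q n m f)"
proof -
  obtain h where h: "h \<in> hom_family R P Q (n - 1)" and fh: "\<And>j x. x \<in> carrier (P j) \<Longrightarrow>
      f j x = d' (j - (n - 1)) (h j x) \<oplus>\<^bsub>Q (j - n)\<^esub> signed (Q (j - n)) n (h (j - 1) (d j x))"
    using f unfolding null_homotopic_def by blast
  have "signed (Q (j - n)) m (f j x) = d' (j - (n - 1)) (signed (Q (j - (n - 1))) m (h j x))
      \<oplus>\<^bsub>Q (j - n)\<^esub> signed (Q (j - n)) n (signed (Q (j - n)) m (h (j - 1) (d j x)))"
    if x: "x \<in> carrier (P j)" for j x
  proof -
    interpret Qj: abelian_group "Q (j - n)" by (rule lcomplexD(2)[OF Q])
    note H = homotopyD[OF h P Q x]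
    have "d' (j - (n - 1)) (signed (Q (j - (n - 1))) m (h j x)) = signed (Q (j - n)) m (d' (j - (n - 1)) (h j x))"
      using lmod_hom_signed[OF lcomplexD(1)[OF Q] lcomplexD(1)[OF Q] lcomplexD(3)[OF Q] H(1)] by (simp only: int_shift)
    then show ?thesis
      by (simp add: fh[OF x] Qj.signed_add H(2-4) Qj.signed_signed add.commute)
  qed
  then show ?thesis
    unfolding null_homotopic_def
    by (intro bexI[OF _ hom_family_signed[OF P Q h, of m]]) (simp add: signed_maps_def lcomplexD(4)[OF P] int_shift(3))
qed

text \<open>If g = d h + (-1)^n h d, the homotopy for f g is (-1)^m f h: the sign compensates d f =
  (-1)^m f d, and in the second term it turns (-1)^(m+n) back into (-1)^n.\<close>

lemma null_homotopic_comp_left: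
  assumes P: "lcomplex R P d" and Q: "lcomplex R Q dQ" and S: "lcomplex R S dS"
    and f: "f \<in> chain_maps R Q dQ S dS m" and g: "null_homotopic R P d Q dQ n g"
  shows "null_homotopic R P d S dS (m + n) (comp_maps P n f g)"
proof -
  obtain h where h: "h \<in> hom_family R P Q (n - 1)" and gh: "\<And>j x. x \<in> carrier (P j) \<Longrightarrow>
      g j x = dQ (j - (n - 1)) (h j x) \<oplus>\<^bsub>Q (j - n)\<^esub> signed (Q (j - n)) n (h (j - 1) (d j x))"
    using g unfolding null_homotopic_def by blast
  let ?k = "signed_maps P S (m + (n - 1)) m (comp_maps P (n - 1) f h)"
  have k: "?k \<in> hom_family R P S (m + n - 1)"
    using hom_family_signed[OF P S hom_family_comp[OF P chain_mapsD(1)[OF f] h]] by (simp only: add_diff_eq)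
  have "f (j - n) (g j x) = dS (j - (m + n - 1)) (?k j x) \<oplus>\<^bsub>S (j - (m + n))\<^esub> signed (S (j - (m + n))) (m + n) (?k (j - 1) (d j x))"
    if x: "x \<in> carrier (P j)" for j x
  proof -
    have eq: "j - (m + n) = j - n - m" "j - (m + n - 1) = j - (n - 1) - m" "j - (m + (n - 1)) = j - (n - 1) - m"
      "j - 1 - (m + (n - 1)) = j - n - m" "j - (n - 1) - m - 1 = j - n - m" "j - (n - 1) - 1 - m = j - n - m" by simp_all
    interpret Sj: abelian_group "S (j - n - m)" by (rule lcomplexD(2)[OF S])
    note H = homotopyD[OF h P Q x]
    note f1 = lmod_homD[OF chain_mapsD(2)[OF f]]
    have c1: "f (j - n) (dQ (j - (n - 1)) (h j x)) \<in> carrier (S (j - n - m))"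
      and c2: "f (j - n) (h (j - 1) (d j x)) \<in> carrier (S (j - n - m))"
      and c3: "f (j - (n - 1)) (h j x) \<in> carrier (S (j - (n - 1) - m))"
      using f1(1)[OF H(2)] f1(1)[OF H(3)] f1(1)[OF H(1)] by simp_all
    have kx: "?k j x = signed (S (j - (n - 1) - m)) m (f (j - (n - 1)) (h j x))"
      using x by (simp add: signed_maps_def comp_maps_def eq(3))
    have kdx: "?k (j - 1) (d j x) = signed (S (j - n - m)) m (f (j - n) (h (j - 1) (d j x)))"
      using lcomplexD(4)[OF P x] by (simp add: signed_maps_def comp_maps_def eq(4))
    have "dS (j - (n - 1) - m) (?k j x) = signed (S (j - n - m)) m (dS (j - (n - 1) - m) (f (j - (n - 1)) (h j x)))"
      using lmod_hom_signed[OF lcomplexD(1)[OF S] lcomplexD(1)[OF S] lcomplexD(3)[OF S] c3] by (simp only: kx eq(5))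
    also have "dS (j - (n - 1) - m) (f (j - (n - 1)) (h j x)) = signed (S (j - n - m)) m (f (j - n) (dQ (j - (n - 1)) (h j x)))"
      using chain_mapsD(4)[OF f H(1)] by (simp only: eq(6) int_shift(2))
    finally have dk: "dS (j - (n - 1) - m) (?k j x) = f (j - n) (dQ (j - (n - 1)) (h j x))"
      by (simp only: Sj.signed_cancel[OF c1])
    have "f (j - n) (g j x) = f (j - n) (dQ (j - (n - 1)) (h j x)) \<oplus>\<^bsub>S (j - n - m)\<^esub> signed (S (j - n - m)) n (f (j - n) (h (j - 1) (d j x)))"
      using f1(2)[OF H(2) H(4)] lmod_hom_signed[OF lcomplexD(1)[OF Q] lcomplexD(1)[OF S] chain_mapsD(2)[OF f] H(3)]
      by (simp only: gh[OF x])
    moreover have "signed (S (j - n - m)) (m + n) (?k (j - 1) (d j x)) = signed (S (j - n - m)) n (f (j - n) (h (j - 1) (d j x)))"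
      unfolding kdx Sj.signed_signed[OF c2] by (simp add: signed_def)
    ultimately show ?thesis by (simp only: eq(1,2) dk)
  qed
  then show ?thesis
    unfolding null_homotopic_def by (intro bexI[OF _ k]) (simp add: comp_maps_def)
qed

text \<open>Here h g itself is the homotopy: the sign (-1)^n from d g = (-1)^n g d combines with
  (-1)^m to the required (-1)^(m+n).\<close>

lemma null_homotopic_comp_right:
  assumes P: "lcomplex R P d" and Q: "lcomplex R Q dQ" and S: "lcomplex R S dS"
    and f: "null_homotopic R Q dQ S dS m f" and g: "g \<in> chain_maps R P d Q dQ n"
  shows "null_homotopic R P d S dS (m + n) (comp_maps P n f g)"
proof -
  obtain h where h: "h \<in> hom_family R Q S (m - 1)" and fh: "\<And>j x. x \<in> carrier (Q j) \<Longrightarrow>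
      f j x = dS (j - (m - 1)) (h j x) \<oplus>\<^bsub>S (j - m)\<^esub> signed (S (j - m)) m (h (j - 1) (dQ j x))"
    using f unfolding null_homotopic_def by blast
  let ?k = "comp_maps P n h g"
  have k: "?k \<in> hom_family R P S (m + n - 1)"
    using hom_family_comp[OF P h chain_mapsD(1)[OF g]] by (simp add: algebra_simps)
  have "f (j - n) (g j x) = dS (j - (m + n - 1)) (?k j x) \<oplus>\<^bsub>S (j - (m + n))\<^esub> signed (S (j - (m + n))) (m + n) (?k (j - 1) (d j x))"
    if x: "x \<in> carrier (P j)" for j x
  proof -
    have eq: "j - (m + n) = j - n - m" "j - (m + n - 1) = j - n - (m - 1)" "j - n - 1 = j - 1 - n"
      "j - 1 - n - (m - 1) = j - n - m" by simp_all
    interpret Sj: abelian_group "S (j - n - m)" by (rule lcomplexD(2)[OF S])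
    have gx: "g j x \<in> carrier (Q (j - n))" and gdx: "g (j - 1) (d j x) \<in> carrier (Q (j - 1 - n))"
      using chain_mapsD(3)[OF g x] chain_mapsD(3)[OF g lcomplexD(4)[OF P x]] .
    have hom: "h (j - 1 - n) \<in> lmod_hom R (Q (j - 1 - n)) (S (j - n - m))"
      using hom_familyD(1)[OF h, of "j - 1 - n"] by (simp only: eq(4))
    have "h (j - n - 1) (dQ (j - n) (g j x)) = signed (S (j - n - m)) n (h (j - 1 - n) (g (j - 1) (d j x)))"
      unfolding chain_mapsD(4)[OF g x] eq(3)
      by (rule lmod_hom_signed[OF lcomplexD(1)[OF Q] lcomplexD(1)[OF S] hom gdx])
    then show ?thesis
      using x lcomplexD(4)[OF P x] lmod_homD(1)[OF hom gdx]
      by (simp only: fh[OF gx] comp_maps_def restrict_apply' eq(1,2) Sj.signed_signed)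
  qed
  then show ?thesis
    unfolding null_homotopic_def by (intro bexI[OF _ k]) (simp add: comp_maps_def)
qed

lemma null_homotopic_cong:
  assumes "null_homotopic R P d Q d' n f" "\<And>j x. x \<in> carrier (P j) \<Longrightarrow> g j x = f j x"
  shows "null_homotopic R P d Q d' n g"
  using assms by (simp add: null_homotopic_def)

definition sub_maps :: "(int \<Rightarrow> ('a, 'p) module) \<Rightarrow> (int \<Rightarrow> ('a, 's) module) \<Rightarrow> int \<Rightarrow>
    (int \<Rightarrow> 'p \<Rightarrow> 's) \<Rightarrow> (int \<Rightarrow> 'p \<Rightarrow> 's) \<Rightarrow> int \<Rightarrow> 'p \<Rightarrow> 's" where
  "sub_maps P Q n f g = add_maps P Q n f (signed_maps P Q n 1 g)"

lemma sub_maps_apply: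
  "x \<in> carrier (P j) \<Longrightarrow> sub_maps P Q n f g j x = f j x \<ominus>\<^bsub>Q (j - n)\<^esub> g j x"
  by (simp add: sub_maps_def add_maps_def signed_maps_def signed_def a_minus_def)

lemma chain_maps_sub:
  assumes P: "lcomplex R P d" and Q: "lcomplex R Q d'"
    and f: "f \<in> chain_maps R P d Q d' n" and g: "g \<in> chain_maps R P d Q d' n"
  shows "sub_maps P Q n f g \<in> chain_maps R P d Q d' n"
  unfolding sub_maps_def by (intro chain_maps_add[OF P Q f] chain_maps_signed[OF P Q g])

lemma lmod_hom_minus:
  assumes M: "left_module R M" and N: "left_module R N" and f: "f \<in> lmod_hom R M N"
    and "x \<in> carrier M" "y \<in> carrier M"
  shows "f (x \<ominus>\<^bsub>M\<^esub> y) = f x \<ominus>\<^bsub>N\<^esub> f y"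
proof -
  interpret M: abelian_group M by (rule left_module_abelian_group[OF M])
  show ?thesis
    using assms(4,5) by (simp add: a_minus_def lmod_homD(2)[OF f] lmod_hom_a_inv[OF M N f])
qed

lemma identity_chain_map:
  assumes P: "lcomplex R P d"
  shows "(\<lambda>j. \<lambda>x\<in>carrier (P j). x) \<in> chain_maps R P d P d 0"
proof -
  have "(\<lambda>x\<in>carrier (P j). x) \<in> lmod_hom R (P j) (P j)" for j
    by (rule lmod_homI[OF lcomplexD(1)[OF P]]) simp_all
  then show ?thesis
    using lcomplexD(4)[OF P] by (simp add: chain_maps_def hom_family_def signed_def)
qed

section \<open>Comparison of projective resolutions\<close>

lemma lcomplex_Suc:
  assumes "lcomplex R P d"
  shows "d (j + 1) \<in> lmod_hom R (P (j + 1)) (P j)"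
    and "x \<in> carrier (P (j + 1)) \<Longrightarrow> d (j + 1) x \<in> carrier (P j)"
    and "x \<in> carrier (P (j + 1)) \<Longrightarrow> d j (d (j + 1) x) = \<zero>\<^bsub>P (j - 1)\<^esub>"
  using lcomplexD(3)[OF assms, of "j + 1"] lcomplexD(4)[OF assms, of x "j + 1"] lcomplexD(5)[OF assms, of x "j + 1"]
  by simp_all

lemma projective_resolutionD:
  assumes "projective_resolution R N P d e"
  shows "lcomplex R P d" and "projective_lmod R (P j)" and "j < 0 \<Longrightarrow> carrier (P j) = {\<zero>\<^bsub>P j\<^esub>}"
    and "e \<in> lmod_hom R (P 0) N"
    and "j > 0 \<Longrightarrow> x \<in> carrier (P j) \<Longrightarrow> d j x = \<zero>\<^bsub>P (j - 1)\<^esub> \<Longrightarrow> \<exists>y\<in>carrier (P (j + 1)). d (j + 1) y = x"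
    and "x \<in> carrier (P 0) \<Longrightarrow> e x = \<zero>\<^bsub>N\<^esub> \<Longrightarrow> \<exists>y\<in>carrier (P 1). d 1 y = x"
    and "z \<in> carrier N \<Longrightarrow> \<exists>y\<in>carrier (P 0). e y = z"
    and "x \<in> carrier (P 1) \<Longrightarrow> e (d 1 x) = \<zero>\<^bsub>N\<^esub>"
proof -
  note D = assms[unfolded projective_resolution_def]
  have proj: "projective_lmod R (P j)" for j
    using D[THEN conjunct1] by simp
  have neg: "carrier (P j) = {\<zero>\<^bsub>P j\<^esub>}" if "j < 0" for j
    using D[THEN conjunct2, THEN conjunct1] that by blast
  have d: "d j \<in> lmod_hom R (P j) (P (j - 1))" for j
    using D[THEN conjunct2, THEN conjunct2, THEN conjunct1] by simp
  have exact: "{x \<in> carrier (P j). d j x = \<zero>\<^bsub>P (j - 1)\<^esub>} = d (j + 1) ` carrier (P (j + 1))" if "j > 0" for j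
    using D[THEN conjunct2, THEN conjunct2, THEN conjunct2, THEN conjunct1] that by blast
  have e: "e \<in> lmod_hom R (P 0) N" "e ` carrier (P 0) = carrier N" "{x \<in> carrier (P 0). e x = \<zero>\<^bsub>N\<^esub>} = d 1 ` carrier (P 1)"
    using D[THEN conjunct2, THEN conjunct2, THEN conjunct2, THEN conjunct2] by simp_all
  \<comment> \<open>For j > 1 this is half of the exactness condition; for smaller j the composite
    ends in a module of negative index, which is zero.\<close>
  have "d (j - 1) (d j x) = \<zero>\<^bsub>P (j - 1 - 1)\<^esub>" if x: "x \<in> carrier (P j)" for j x
  proof (cases "j - 1 > 0")
    case True
    have "d (j - 1 + 1) x \<in> d (j - 1 + 1) ` carrier (P (j - 1 + 1))" using x by simp
    then have "d (j - 1 + 1) x \<in> {x \<in> carrier (P (j - 1)). d (j - 1) x = \<zero>\<^bsub>P (j - 1 - 1)\<^esub>}"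
      by (simp only: exact[OF True])
    then show ?thesis by simp
  next
    case False
    then have "carrier (P (j - 1 - 1)) = {\<zero>\<^bsub>P (j - 1 - 1)\<^esub>}" by (intro neg) simp
    then show ?thesis using lmod_homD(1)[OF d[of "j - 1"] lmod_homD(1)[OF d[of j] x]] by blast
  qed
  then show "lcomplex R P d"
    using proj[unfolded projective_lmod_def, THEN conjunct1] d by (simp add: lcomplex_def)
  show "projective_lmod R (P j)" "e \<in> lmod_hom R (P 0) N" by (fact proj e)+
  show "carrier (P j) = {\<zero>\<^bsub>P j\<^esub>}" if "j < 0" using neg[OF that] .
  show "\<exists>y\<in>carrier (P (j + 1)). d (j + 1) y = x" if "j > 0" "x \<in> carrier (P j)" "d j x = \<zero>\<^bsub>P (j - 1)\<^esub>"
  proof -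
    have "x \<in> d (j + 1) ` carrier (P (j + 1))"
      unfolding exact[OF that(1), symmetric] using that(2,3) by simp
    then show ?thesis by auto
  qed
  show "\<exists>y\<in>carrier (P 1). d 1 y = x" if "x \<in> carrier (P 0)" "e x = \<zero>\<^bsub>N\<^esub>"
  proof -
    have "x \<in> d 1 ` carrier (P 1)" unfolding e(3)[symmetric] using that by simp
    then show ?thesis by auto
  qed
  show "\<exists>y\<in>carrier (P 0). e y = z" if "z \<in> carrier N"
    using that unfolding e(2)[symmetric] by auto
  show "e (d 1 x) = \<zero>\<^bsub>N\<^esub>" if "x \<in> carrier (P 1)"
  proof -
    have "d 1 x \<in> d 1 ` carrier (P 1)" using that by simp
    then show ?thesis unfolding e(3)[symmetric] by simp
  qed
qed

lemma lmod_hom_zero_map: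
  assumes "left_module R M" "left_module R N"
  shows "(\<lambda>x\<in>carrier M. \<zero>\<^bsub>N\<^esub>) \<in> lmod_hom R M N"
proof -
  interpret N: left_module R N by fact
  show ?thesis
    by (rule lmod_homI[OF assms(1)]) (simp_all add: left_module_smult_zero[OF assms(2)])
qed

text \<open>One step of the comparison theorem. The invariant \<open>im\<close> says that g d takes
  values in boundaries of Q. It provides the next component, and it holds again one degree higher
  because d d = 0 and Q is exact in positive degrees.\<close>

lemma chain_map_lift_step:
  fixes n k :: int
  assumes P: "lcomplex R P d" and proj: "\<And>j. projective_lmod R (P j)"
    and Q: "projective_resolution R N Q d' e" and k: "k \<ge> 0"
    and g: "g \<in> lmod_hom R (P (n + k)) (Q k)"
    and im: "\<And>y. y \<in> carrier (P (n + k + 1)) \<Longrightarrow> \<exists>z\<in>carrier (Q (k + 1)). d' (k + 1) z = g (d (n + k + 1) y)"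
  shows "\<exists>g'\<in>lmod_hom R (P (n + k + 1)) (Q (k + 1)).
    (\<forall>y\<in>carrier (P (n + k + 1)). d' (k + 1) (g' y) = signed (Q k) n (g (d (n + k + 1) y))) \<and>
    (\<forall>y\<in>carrier (P (n + k + 1 + 1)). \<exists>z\<in>carrier (Q (k + 1 + 1)). d' (k + 1 + 1) z = g' (d (n + k + 1 + 1) y))"
proof -
  note Q' = projective_resolutionD(1)[OF Q]
  interpret Qk: left_module R "Q k" by (rule lcomplexD(1)[OF Q'])
  let ?f = "\<lambda>y\<in>carrier (P (n + k + 1)). signed (Q k) n ((\<lambda>y\<in>carrier (P (n + k + 1)). g (d (n + k + 1) y)) y)"
  have f: "?f \<in> lmod_hom R (P (n + k + 1)) (Q k)"
    by (rule lmod_hom_signed_map[OF lcomplexD(1)[OF P] lcomplexD(1)[OF Q'] lmod_hom_compose[OF lcomplexD(1)[OF P] lcomplex_Suc(1)[OF P] g]])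
  have "\<exists>z\<in>carrier (Q (k + 1)). d' (k + 1) z = ?f y" if y: "y \<in> carrier (P (n + k + 1))" for y
  proof -
    obtain z where z: "z \<in> carrier (Q (k + 1))" "d' (k + 1) z = g (d (n + k + 1) y)"
      using im[OF y] by blast
    have "d' (k + 1) (signed (Q (k + 1)) n z) = ?f y"
      using y z lmod_hom_signed[OF lcomplexD(1)[OF Q'] lcomplexD(1)[OF Q'] lcomplex_Suc(1)[OF Q'] z(1)] by simp
    then show ?thesis
      using abelian_group.signed_closed[OF lcomplexD(2)[OF Q'] z(1)] by blast
  qed
  then obtain g' where g': "g' \<in> lmod_hom R (P (n + k + 1)) (Q (k + 1))"
    "\<And>y. y \<in> carrier (P (n + k + 1)) \<Longrightarrow> d' (k + 1) (g' y) = ?f y"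
    using projective_lmod_lift[OF proj lcomplexD(1)[OF Q'] lcomplexD(1)[OF Q'] lcomplex_Suc(1)[OF Q'] f] by blast
  have "\<exists>z\<in>carrier (Q (k + 1 + 1)). d' (k + 1 + 1) z = g' (d (n + k + 1 + 1) y)"
    if y: "y \<in> carrier (P (n + k + 1 + 1))" for y
  proof (rule projective_resolutionD(5)[OF Q])
    have dy: "d (n + k + 1 + 1) y \<in> carrier (P (n + k + 1))" using lcomplex_Suc(2)[OF P y] .
    then show "g' (d (n + k + 1 + 1) y) \<in> carrier (Q (k + 1))" using lmod_homD(1)[OF g'(1)] by blast
    have "d (n + k + 1) (d (n + k + 1 + 1) y) = \<zero>\<^bsub>P (n + k)\<^esub>"
      using lcomplex_Suc(3)[OF P y] by simp
    then have "g (d (n + k + 1) (d (n + k + 1 + 1) y)) = \<zero>\<^bsub>Q k\<^esub>"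
      using lmod_hom_zero[OF lcomplexD(1)[OF P] lcomplexD(1)[OF Q'] g] by simp
    then show "d' (k + 1) (g' (d (n + k + 1 + 1) y)) = \<zero>\<^bsub>Q (k + 1 - 1)\<^esub>"
      using g'(2)[OF dy] dy by simp
  qed (use k in simp)
  then show ?thesis using g' by (intro bexI[OF _ g'(1)]) auto
qed

text \<open>The existence half of the comparison theorem, in degree n. P enters as a complex of
  projectives, and exactness is used in Q.\<close>

lemma chain_map_lift:
  fixes n :: int
  assumes P: "lcomplex R P d" and proj: "\<And>j. projective_lmod R (P j)"
    and N: "left_module R N" and Q: "projective_resolution R N Q d' e"
    and f: "f \<in> lmod_hom R (P n) N" and fd: "\<And>x. x \<in> carrier (P (n + 1)) \<Longrightarrow> f (d (n + 1) x) = \<zero>\<^bsub>N\<^esub>"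
  shows "\<exists>F\<in>chain_maps R P d Q d' n. \<forall>x\<in>carrier (P n). e (F n x) = f x"
proof -
  note Q' = projective_resolutionD(1)[OF Q]
  let ?S = "\<lambda>m g. g \<in> lmod_hom R (P (n + int m)) (Q (int m)) \<and>
    (\<forall>y\<in>carrier (P (n + int m + 1)). \<exists>z\<in>carrier (Q (int m + 1)). d' (int m + 1) z = g (d (n + int m + 1) y)) \<and>
    (m = 0 \<longrightarrow> (\<forall>x\<in>carrier (P n). e (g x) = f x))"
  let ?T = "\<lambda>m g g'. \<forall>y\<in>carrier (P (n + int m + 1)). d' (int m + 1) (g' y) = signed (Q (int m)) n (g (d (n + int m + 1) y))"
  \<comment> \<open>Each component depends on the choice of the previous one, so they are picked by
    dependent choice: \<open>?S\<close> is the invariant of a single component and \<open>?T\<close>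
    the signed commutation with the next one.\<close>
  have "\<exists>G. \<forall>m. ?S m (G m) \<and> ?T m (G m) (G (Suc m))"
  proof (rule dependent_nat_choice)
    obtain g where g: "g \<in> lmod_hom R (P n) (Q 0)" "\<And>x. x \<in> carrier (P n) \<Longrightarrow> e (g x) = f x"
      using projective_lmod_lift[OF proj lcomplexD(1)[OF Q'] N projective_resolutionD(4)[OF Q] f]
        projective_resolutionD(7)[OF Q] lmod_homD(1)[OF f] by blast
    have "\<exists>z\<in>carrier (Q 1). d' 1 z = g (d (n + 1) y)" if y: "y \<in> carrier (P (n + 1))" for y
      using projective_resolutionD(6)[OF Q lmod_homD(1)[OF g(1) lcomplex_Suc(2)[OF P y]]] g(2)[OF lcomplex_Suc(2)[OF P y]] fd[OF y]
      by simp
    then show "\<exists>g. ?S 0 g" using g by (intro exI[of _ g]) simp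
  next
    fix g m assume S: "?S m g"
    have eq: "int (Suc m) = int m + 1" "n + (int m + 1) = n + int m + 1" by simp_all
    obtain g' where "g' \<in> lmod_hom R (P (n + int m + 1)) (Q (int m + 1))"
      "\<forall>y\<in>carrier (P (n + int m + 1)). d' (int m + 1) (g' y) = signed (Q (int m)) n (g (d (n + int m + 1) y))"
      "\<forall>y\<in>carrier (P (n + int m + 1 + 1)). \<exists>z\<in>carrier (Q (int m + 1 + 1)). d' (int m + 1 + 1) z = g' (d (n + int m + 1 + 1) y)"
      using chain_map_lift_step[OF P proj Q, of "int m" g n] S by auto
    then show "\<exists>g'. ?S (Suc m) g' \<and> ?T m g g'"
      unfolding eq by (intro exI[of _ g']) simp
  qed
  then obtain G where G: "\<And>m. ?S m (G m)" "\<And>m. ?T m (G m) (G (Suc m))" by blast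
  define F where "F j = (if j \<ge> n then G (nat (j - n)) else (\<lambda>x\<in>carrier (P j). \<zero>\<^bsub>Q (j - n)\<^esub>))" for j
  have F_ge: "F (n + int m) = G m" for m by (simp add: F_def)
  have hom: "F j \<in> lmod_hom R (P j) (Q (j - n))" for j
  proof (cases "j \<ge> n")
    case True
    then obtain m where j: "j = n + int m" by (metis zle_iff_zadd)
    show ?thesis using G(1)[of m] F_ge[of m] by (simp add: j)
  next
    case False
    then show ?thesis
      using lmod_hom_zero_map[OF lcomplexD(1)[OF P] lcomplexD(1)[OF Q']] by (simp add: F_def)
  qed
  have "d' (j - n) (F j x) = signed (Q (j - 1 - n)) n (F (j - 1) (d j x))" if x: "x \<in> carrier (P j)" for j x
  proof (cases "j > n")
    case True
    then obtain m where j: "j = n + int m + 1" by (metis zless_iff_Suc_zadd int_Suc add.assoc)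
    have "F (n + int m + 1) = G (Suc m)"
      using F_ge[of "Suc m"] by (simp add: algebra_simps)
    then have "F j = G (Suc m)" "F (j - 1) = G m" "j - n = int m + 1" "j - 1 - n = int m"
      using F_ge[of m] by (simp_all add: j)
    then show ?thesis using G(2)[of m] x by (simp add: j)
  next
    case False
    \<comment> \<open>For j at most n the square ends in a module of negative index and commutes
      trivially. This includes j = n, although \<open>F n\<close> need not vanish.\<close>
    then have "carrier (Q (j - 1 - n)) = {\<zero>\<^bsub>Q (j - 1 - n)\<^esub>}" by (intro projective_resolutionD(3)[OF Q]) simp
    moreover have "d' (j - n) (F j x) \<in> carrier (Q (j - 1 - n))"
      using lcomplexD(4)[OF Q' lmod_homD(1)[OF hom x]] by (simp only: int_shift)
    moreover have "signed (Q (j - 1 - n)) n (F (j - 1) (d j x)) \<in> carrier (Q (j - 1 - n))"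
      by (rule abelian_group.signed_closed[OF lcomplexD(2)[OF Q'] lmod_homD(1)[OF hom lcomplexD(4)[OF P x]]])
    ultimately show ?thesis by simp
  qed
  then have "F \<in> chain_maps R P d Q d' n"
    using hom by (simp add: chain_maps_def hom_family_def)
  moreover have "\<forall>x\<in>carrier (P n). e (F n x) = f x"
    using G(1)[of 0] F_ge[of 0] by simp
  ultimately show ?thesis by blast
qed

text \<open>The invariant \<open>eq\<close> is d g d = F d, the homotopy identity composed with d,
  where the second term dies by d d = 0. This weak form is enough to continue, and it also holds at
  the start, where there is no previous component.\<close>

lemma null_homotopic_step:
  fixes n k :: int
  assumes P: "lcomplex R P d" and proj: "\<And>j. projective_lmod R (P j)"
    and Q: "projective_resolution R N Q d' e" and k: "k \<ge> 0"
    and F: "F \<in> chain_maps R P d Q d' n"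
    and g: "g \<in> lmod_hom R (P (n + k)) (Q (k + 1))"
    and eq: "\<And>y. y \<in> carrier (P (n + k + 1)) \<Longrightarrow> d' (k + 1) (g (d (n + k + 1) y)) = F (n + k) (d (n + k + 1) y)"
  shows "\<exists>g'\<in>lmod_hom R (P (n + k + 1)) (Q (k + 1 + 1)).
    (\<forall>y\<in>carrier (P (n + k + 1)). d' (k + 1 + 1) (g' y) \<oplus>\<^bsub>Q (k + 1)\<^esub> signed (Q (k + 1)) n (g (d (n + k + 1) y)) = F (n + k + 1) y) \<and>
    (\<forall>y\<in>carrier (P (n + k + 1 + 1)). d' (k + 1 + 1) (g' (d (n + k + 1 + 1) y)) = F (n + k + 1) (d (n + k + 1 + 1) y))"
proof -
  note Q' = projective_resolutionD(1)[OF Q]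
  let ?P = "P (n + k + 1)"
  interpret Qk: left_module R "Q (k + 1)" by (rule lcomplexD(1)[OF Q'])
  note d1 = lcomplex_Suc(1)[OF P, of "n + k"]
  note LP = lcomplexD(1)[OF P] and LQ = lcomplexD(1)[OF Q']
  have F1: "F (n + k + 1) \<in> lmod_hom R ?P (Q (k + 1))"
    using chain_mapsD(2)[OF F, of "n + k + 1"] by simp
  let ?gd = "\<lambda>y\<in>carrier ?P. g (d (n + k + 1) y)"
  have gd: "?gd \<in> lmod_hom R ?P (Q (k + 1))" by (rule lmod_hom_compose[OF LP d1 g])
  have gd_closed: "g (d (n + k + 1) y) \<in> carrier (Q (k + 1))" if "y \<in> carrier ?P" for y
    using lmod_homD(1)[OF gd that] that by simp
  \<comment> \<open>The map F - (-1)^n g d that is to be lifted, with the minus sign absorbed into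
    the parity n + 1. Its values are cycles because d F = (-1)^n F d and d g d = F d.\<close>
  let ?f = "\<lambda>y\<in>carrier ?P. F (n + k + 1) y \<oplus>\<^bsub>Q (k + 1)\<^esub> (\<lambda>y\<in>carrier ?P. signed (Q (k + 1)) (n + 1) (?gd y)) y"
  have f: "?f \<in> lmod_hom R ?P (Q (k + 1))"
    by (rule lmod_hom_add[OF LP LQ F1 lmod_hom_signed_map[OF LP LQ gd]])
  have f_eq: "?f y \<oplus>\<^bsub>Q (k + 1)\<^esub> signed (Q (k + 1)) n (g (d (n + k + 1) y)) = F (n + k + 1) y" if y: "y \<in> carrier ?P" for y
    using y lmod_homD(1)[OF F1 y] gd_closed[OF y]
    by (auto simp: signed_def Qk.M.a_assoc Qk.M.l_neg Qk.M.r_neg)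
  have "\<exists>z\<in>carrier (Q (k + 1 + 1)). d' (k + 1 + 1) z = ?f y" if y: "y \<in> carrier ?P" for y
  proof (rule projective_resolutionD(5)[OF Q])
    interpret Q0: abelian_group "Q k" by (rule lcomplexD(2)[OF Q'])
    have dy: "d (n + k + 1) y \<in> carrier (P (n + k))" using lcomplex_Suc(2)[OF P y] .
    have Fdy: "F (n + k) (d (n + k + 1) y) \<in> carrier (Q k)"
      using chain_mapsD(3)[OF F dy] by simp
    show "?f y \<in> carrier (Q (k + 1))" using lmod_homD(1)[OF f y] .
    have "d' (k + 1) (?f y) = d' (k + 1) (F (n + k + 1) y) \<oplus>\<^bsub>Q k\<^esub> signed (Q k) (n + 1) (d' (k + 1) (g (d (n + k + 1) y)))"
      using y lmod_homD(2)[OF lcomplex_Suc(1)[OF Q'] lmod_homD(1)[OF F1 y] Qk.M.signed_closed[OF gd_closed[OF y]]]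
        lmod_hom_signed[OF LQ LQ lcomplex_Suc(1)[OF Q'] gd_closed[OF y]] by simp
    also have "d' (k + 1) (F (n + k + 1) y) = signed (Q k) n (F (n + k) (d (n + k + 1) y))"
      using chain_mapsD(4)[OF F y] by simp
    also have "signed (Q k) n (F (n + k) (d (n + k + 1) y)) \<oplus>\<^bsub>Q k\<^esub> signed (Q k) (n + 1) (d' (k + 1) (g (d (n + k + 1) y))) = \<zero>\<^bsub>Q k\<^esub>"
      unfolding eq[OF y] using Fdy by (auto simp: signed_def Q0.l_neg Q0.r_neg)
    finally show "d' (k + 1) (?f y) = \<zero>\<^bsub>Q (k + 1 - 1)\<^esub>" by simp
  qed (use k in simp)
  then obtain g' where g': "g' \<in> lmod_hom R ?P (Q (k + 1 + 1))"
    "\<And>y. y \<in> carrier ?P \<Longrightarrow> d' (k + 1 + 1) (g' y) = ?f y"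
    using projective_lmod_lift[OF proj LQ LQ lcomplex_Suc(1)[OF Q'] f] by blast
  have g'_d: "d' (k + 1 + 1) (g' (d (n + k + 1 + 1) y)) = F (n + k + 1) (d (n + k + 1 + 1) y)"
    if y: "y \<in> carrier (P (n + k + 1 + 1))" for y
  proof -
    have dy: "d (n + k + 1 + 1) y \<in> carrier ?P" using lcomplex_Suc(2)[OF P y] .
    have "d (n + k + 1) (d (n + k + 1 + 1) y) = \<zero>\<^bsub>P (n + k)\<^esub>"
      using lcomplex_Suc(3)[OF P y] by simp
    then have "g (d (n + k + 1) (d (n + k + 1 + 1) y)) = \<zero>\<^bsub>Q (k + 1)\<^esub>"
      using lmod_hom_zero[OF LP LQ g] by simp
    then show ?thesis
      using g'(2)[OF dy] dy lmod_homD(1)[OF F1 dy] by simp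
  qed
  show ?thesis
  proof (intro bexI[OF _ g'(1)] conjI ballI)
    fix y assume y: "y \<in> carrier ?P"
    show "d' (k + 1 + 1) (g' y) \<oplus>\<^bsub>Q (k + 1)\<^esub> signed (Q (k + 1)) n (g (d (n + k + 1) y)) = F (n + k + 1) y"
      unfolding g'(2)[OF y] by (rule f_eq[OF y])
  qed (rule g'_d)
qed

text \<open>The uniqueness half of the comparison theorem: zero augmentation makes
  \<open>F n\<close> land in boundaries, and the homotopy is built upwards from there and is zero
  below degree n.\<close>

lemma null_homotopicI:
  fixes n :: int
  assumes P: "lcomplex R P d" and proj: "\<And>j. projective_lmod R (P j)"
    and Q: "projective_resolution R N Q d' e"
    and F: "F \<in> chain_maps R P d Q d' n" and eF: "\<And>x. x \<in> carrier (P n) \<Longrightarrow> e (F n x) = \<zero>\<^bsub>N\<^esub>"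
  shows "null_homotopic R P d Q d' n F"
proof -
  note Q' = projective_resolutionD(1)[OF Q]
  note LP = lcomplexD(1)[OF P] and LQ = lcomplexD(1)[OF Q']
  let ?S = "\<lambda>m g. g \<in> lmod_hom R (P (n + int m)) (Q (int m + 1)) \<and>
    (\<forall>y\<in>carrier (P (n + int m + 1)). d' (int m + 1) (g (d (n + int m + 1) y)) = F (n + int m) (d (n + int m + 1) y)) \<and>
    (m = 0 \<longrightarrow> (\<forall>x\<in>carrier (P n). d' 1 (g x) = F n x))"
  let ?T = "\<lambda>m g g'. \<forall>y\<in>carrier (P (n + int m + 1)).
     d' (int m + 1 + 1) (g' y) \<oplus>\<^bsub>Q (int m + 1)\<^esub> signed (Q (int m + 1)) n (g (d (n + int m + 1) y)) = F (n + int m + 1) y"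
  have "\<exists>G. \<forall>m. ?S m (G m) \<and> ?T m (G m) (G (Suc m))"
  proof (rule dependent_nat_choice)
    have Fn: "F n \<in> lmod_hom R (P n) (Q 0)" using chain_mapsD(2)[OF F, of n] by simp
    have d1: "d' 1 \<in> lmod_hom R (Q 1) (Q 0)" using lcomplex_Suc(1)[OF Q', of 0] by simp
    obtain g where g: "g \<in> lmod_hom R (P n) (Q 1)" "\<And>x. x \<in> carrier (P n) \<Longrightarrow> d' 1 (g x) = F n x"
      using projective_lmod_lift[OF proj LQ LQ d1 Fn]
        projective_resolutionD(6)[OF Q lmod_homD(1)[OF Fn] eF] by blast
    then show "\<exists>g. ?S 0 g" using lcomplex_Suc(2)[OF P, of _ n] by (intro exI[of _ g]) simp
  next
    fix g m assume S: "?S m g"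
    have eq: "int (Suc m) = int m + 1" "n + (int m + 1) = n + int m + 1" by simp_all
    obtain g' where "g' \<in> lmod_hom R (P (n + int m + 1)) (Q (int m + 1 + 1))" "?T m g g'"
      "\<forall>y\<in>carrier (P (n + int m + 1 + 1)). d' (int m + 1 + 1) (g' (d (n + int m + 1 + 1) y)) = F (n + int m + 1) (d (n + int m + 1 + 1) y)"
      using null_homotopic_step[OF P proj Q _ F, of "int m" g] S by auto
    then show "\<exists>g'. ?S (Suc m) g' \<and> ?T m g g'"
      unfolding eq by (intro exI[of _ g']) simp
  qed
  then obtain G where G: "\<And>m. ?S m (G m)" "\<And>m. ?T m (G m) (G (Suc m))" by blast
  define h where "h j = (if j \<ge> n then G (nat (j - n)) else (\<lambda>x\<in>carrier (P j). \<zero>\<^bsub>Q (j - (n - 1))\<^esub>))" for j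
  have h_ge: "h (n + int m) = G m" for m by (simp add: h_def)
  have hom: "h j \<in> lmod_hom R (P j) (Q (j - (n - 1)))" for j
  proof (cases "j \<ge> n")
    case True
    then obtain m where j: "j = n + int m" by (metis zle_iff_zadd)
    have "j - (n - 1) = int m + 1" by (simp add: j)
    then show ?thesis using G(1)[of m] h_ge[of m] by (simp only: j)
  next
    case False
    then show ?thesis
      using lmod_hom_zero_map[OF LP LQ] by (simp add: h_def)
  qed
  then have h: "h \<in> hom_family R P Q (n - 1)" by (simp add: hom_family_def)
  have "F j x = d' (j - (n - 1)) (h j x) \<oplus>\<^bsub>Q (j - n)\<^esub> signed (Q (j - n)) n (h (j - 1) (d j x))" if x: "x \<in> carrier (P j)" for j x
  proof -
    consider m where "j = n + int m + 1" | "j = n" | "j < n"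
      by (metis zless_iff_Suc_zadd int_Suc add.assoc linorder_cases)
    then show ?thesis
    proof cases
      case (1 m)
      have "h (n + int m + 1) = G (Suc m)"
        using h_ge[of "Suc m"] by (simp add: algebra_simps)
      then have "h j = G (Suc m)" "h (j - 1) = G m" "j - n = int m + 1" "j - (n - 1) = int m + 1 + 1"
        using h_ge[of m] by (simp_all add: 1)
      then show ?thesis using G(2)[of m] x by (simp only: 1)
    next
      case 2
      interpret Q0: abelian_group "Q 0" by (rule lcomplexD(2)[OF Q'])
      have "h (j - 1) (d j x) = \<zero>\<^bsub>Q 0\<^esub>"
        using lcomplexD(4)[OF P x] by (simp add: 2 h_def)
      then show ?thesis
        using G(1)[of 0] h_ge[of 0] x chain_mapsD(3)[OF F x] by (simp add: 2)
    next
      case 3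
      then have zero: "carrier (Q (j - n)) = {\<zero>\<^bsub>Q (j - n)\<^esub>}" by (intro projective_resolutionD(3)[OF Q]) simp
      interpret Qj: abelian_group "Q (j - n)" by (rule lcomplexD(2)[OF Q'])
      have "d' (j - (n - 1)) (h j x) \<oplus>\<^bsub>Q (j - n)\<^esub> signed (Q (j - n)) n (h (j - 1) (d j x)) \<in> carrier (Q (j - n))"
        using homotopyD[OF h P Q' x] by simp
      then show ?thesis using chain_mapsD(3)[OF F x] zero by simp
    qed
  qed
  then show ?thesis unfolding null_homotopic_def using h by blast
qed

lemma null_homotopic_subI:
  fixes n :: int
  assumes P: "lcomplex R P d" and proj: "\<And>j. projective_lmod R (P j)"
    and N: "left_module R N" and Q: "projective_resolution R N Q d' e"
    and f: "f \<in> chain_maps R P d Q d' n" and g: "g \<in> chain_maps R P d Q d' n"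
    and eq: "\<And>x. x \<in> carrier (P n) \<Longrightarrow> e (f n x) = e (g n x)"
  shows "null_homotopic R P d Q d' n (sub_maps P Q n f g)"
proof (rule null_homotopicI[OF P proj Q])
  note Q' = projective_resolutionD(1)[OF Q]
  show "sub_maps P Q n f g \<in> chain_maps R P d Q d' n" by (rule chain_maps_sub[OF P Q' f g])
  fix x assume x: "x \<in> carrier (P n)"
  interpret N: abelian_group N by (rule left_module_abelian_group[OF N])
  have c: "f n x \<in> carrier (Q 0)" "g n x \<in> carrier (Q 0)"
    using chain_mapsD(3)[OF f x] chain_mapsD(3)[OF g x] by simp_all
  show "e (sub_maps P Q n f g n x) = \<zero>\<^bsub>N\<^esub>"
    using lmod_hom_minus[OF lcomplexD(1)[OF Q'] N projective_resolutionD(4)[OF Q] c] eq[OF x]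
      lmod_homD(1)[OF projective_resolutionD(4)[OF Q] c(2)] N.r_neg
    by (simp add: sub_maps_apply[where P = P, OF x] a_minus_def)
qed

section \<open>The ring of cocycles and the ideal of coboundaries\<close>

lemma hom_deg_eq: "hom_deg R P n = hom_family R P P n"
  by (simp add: hom_deg_def hom_family_def)

lemma restrict_family_eq_iff:
  "(\<lambda>j. \<lambda>x\<in>A j. f j x) = (\<lambda>j. \<lambda>x\<in>A j. g j x) \<longleftrightarrow> (\<forall>j. \<forall>x\<in>A j. f j x = g j x)"
  by (auto simp: fun_eq_iff restrict_def)

lemma (in abelian_group) sum_zero_iff:
  assumes "x \<in> carrier G" "y \<in> carrier G"
  shows "x \<oplus> y = \<zero> \<longleftrightarrow> x = \<ominus> y"
  using assms minus_equality[of x y] l_neg[of y] by auto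

lemma (in abelian_group) finsum_zeroI: "(\<And>a. a \<in> A \<Longrightarrow> f a = \<zero>) \<Longrightarrow> finsum G f A = \<zero>"
  by (rule add.finprod_one_eqI)

lemma cocycles_eq_chain_maps:
  assumes P: "lcomplex R P d"
  shows "cocycles R P d n = chain_maps R P d P d n"
proof -
  have "hom_diff P d n f = zero_map P (n + 1) \<longleftrightarrow>
      (\<forall>j. \<forall>x\<in>carrier (P j). d (j - n) (f j x) = signed (P (j - 1 - n)) n (f (j - 1) (d j x)))"
    if f: "f \<in> hom_family R P P n" for f
  proof -
    have "(if even n then d (j - n) (f j x) \<ominus>\<^bsub>P (j - n - 1)\<^esub> f (j - 1) (d j x)
        else d (j - n) (f j x) \<oplus>\<^bsub>P (j - n - 1)\<^esub> f (j - 1) (d j x)) = \<zero>\<^bsub>P (j - (n + 1))\<^esub> \<longleftrightarrow>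
      d (j - n) (f j x) = signed (P (j - 1 - n)) n (f (j - 1) (d j x))" if x: "x \<in> carrier (P j)" for j x
    proof -
      interpret Pj: abelian_group "P (j - 1 - n)" by (rule lcomplexD(2)[OF P])
      have eq: "j - (n + 1) = j - 1 - n" by simp
      have c: "d (j - n) (f j x) \<in> carrier (P (j - 1 - n))" "f (j - 1) (d j x) \<in> carrier (P (j - 1 - n))"
        using lcomplexD(4)[OF P hom_familyD(2)[OF f x]] hom_familyD(2)[OF f lcomplexD(4)[OF P x]]
        by (simp_all only: int_shift)
      show ?thesis
        unfolding eq int_shift(1) signed_def a_minus_def
        using Pj.sum_zero_iff[OF c] Pj.sum_zero_iff[OF c(1) Pj.a_inv_closed[OF c(2)]] c by simp
    qed
    then show ?thesis
      unfolding hom_diff_def zero_map_def restrict_family_eq_iff by simp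
  qed
  then show ?thesis
    unfolding cocycles_def chain_maps_def hom_deg_eq by blast
qed

lemma coboundaries_iff_null_homotopic:
  assumes P: "lcomplex R P d" and f: "f \<in> hom_family R P P n"
  shows "f \<in> coboundaries R P d n \<longleftrightarrow> null_homotopic R P d P d n f"
proof -
  have f_eq: "f = (\<lambda>j. \<lambda>x\<in>carrier (P j). f j x)"
    using lmod_homD(4)[OF hom_familyD(1)[OF f]] by (auto simp: fun_eq_iff restrict_def)
  have "f = hom_diff P d (n - 1) h \<longleftrightarrow> (\<forall>j. \<forall>x\<in>carrier (P j).
      f j x = d (j - (n - 1)) (h j x) \<oplus>\<^bsub>P (j - n)\<^esub> signed (P (j - n)) n (h (j - 1) (d j x)))"
    if h: "h \<in> hom_family R P P (n - 1)" for h
  proof -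
    have "hom_diff P d (n - 1) h = (\<lambda>j. \<lambda>x\<in>carrier (P j).
      d (j - (n - 1)) (h j x) \<oplus>\<^bsub>P (j - n)\<^esub> signed (P (j - n)) n (h (j - 1) (d j x)))"
      unfolding hom_diff_def int_shift(2) restrict_family_eq_iff
      by (auto simp: signed_def a_minus_def)
    then show ?thesis
      by (subst f_eq) (simp only: restrict_family_eq_iff)
  qed
  then show ?thesis
    unfolding coboundaries_def null_homotopic_def hom_deg_eq by blast
qed

text \<open>Both sides sum over the triangle b + c \<le> n, and the induction peels off the diagonal
  b + c = n + 1. Membership in the carrier is asked on the triangle only, because in the application
  T b c is a triple composite with the third degree n - b - c.\<close>

lemma (in abelian_group) finsum_triangle:
  fixes n :: nat
  assumes "\<And>b c. b + c \<le> n \<Longrightarrow> T b c \<in> carrier G"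
  shows "(\<Oplus>a\<in>{..n}. \<Oplus>b\<in>{..a}. T b (a - b)) = (\<Oplus>b\<in>{..n}. \<Oplus>c\<in>{..n - b}. T b c)"
  using assms
proof (induction n)
  case 0
  then show ?case by simp
next
  case (Suc n)
  have T: "T b c \<in> carrier G" if "b + c \<le> Suc n" for b c using Suc.prems[OF that] .
  have "(\<Oplus>a\<in>{..Suc n}. \<Oplus>b\<in>{..a}. T b (a - b))
    = (\<Oplus>b\<in>{..Suc n}. T b (Suc n - b)) \<oplus> (\<Oplus>a\<in>{..n}. \<Oplus>b\<in>{..a}. T b (a - b))"
    by (rule finsum_Suc) (auto intro!: finsum_closed T)
  also have "(\<Oplus>a\<in>{..n}. \<Oplus>b\<in>{..a}. T b (a - b)) = (\<Oplus>b\<in>{..n}. \<Oplus>c\<in>{..n - b}. T b c)"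
    by (rule Suc.IH) (simp add: T)
  also have "(\<Oplus>b\<in>{..Suc n}. T b (Suc n - b)) = T (Suc n) 0 \<oplus> (\<Oplus>b\<in>{..n}. T b (Suc n - b))"
    by (subst finsum_Suc) (auto intro!: T)
  also have "T (Suc n) 0 \<oplus> (\<Oplus>b\<in>{..n}. T b (Suc n - b)) \<oplus> (\<Oplus>b\<in>{..n}. \<Oplus>c\<in>{..n - b}. T b c)
    = T (Suc n) 0 \<oplus> ((\<Oplus>b\<in>{..n}. T b (Suc n - b)) \<oplus> (\<Oplus>b\<in>{..n}. \<Oplus>c\<in>{..n - b}. T b c))"
    by (rule a_assoc) (auto intro!: finsum_closed T)
  also have "(\<Oplus>b\<in>{..n}. T b (Suc n - b)) \<oplus> (\<Oplus>b\<in>{..n}. \<Oplus>c\<in>{..n - b}. T b c)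
    = (\<Oplus>b\<in>{..n}. T b (Suc n - b) \<oplus> (\<Oplus>c\<in>{..n - b}. T b c))"
    by (rule finsum_addf[symmetric]) (auto intro!: finsum_closed T)
  also have "\<dots> = (\<Oplus>b\<in>{..n}. \<Oplus>c\<in>{..Suc n - b}. T b c)"
  proof (rule finsum_cong')
    fix b assume b: "b \<in> {..n}"
    then have eq: "Suc n - b = Suc (n - b)" by auto
    show "T b (Suc n - b) \<oplus> (\<Oplus>c\<in>{..n - b}. T b c) = (\<Oplus>c\<in>{..Suc n - b}. T b c)"
      unfolding eq by (rule finsum_Suc[symmetric]) (use b in \<open>auto intro!: T\<close>)
  qed (auto intro!: finsum_closed T)
  also have "T (Suc n) 0 \<oplus> (\<Oplus>b\<in>{..n}. \<Oplus>c\<in>{..Suc n - b}. T b c) = (\<Oplus>b\<in>{..Suc n}. \<Oplus>c\<in>{..Suc n - b}. T b c)"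
  proof -
    have "(\<Oplus>b\<in>{..Suc n}. \<Oplus>c\<in>{..Suc n - b}. T b c)
      = (\<Oplus>c\<in>{..Suc n - Suc n}. T (Suc n) c) \<oplus> (\<Oplus>b\<in>{..n}. \<Oplus>c\<in>{..Suc n - b}. T b c)"
      by (rule finsum_Suc) (auto intro!: finsum_closed T)
    then show ?thesis using T[of "Suc n" 0] by simp
  qed
  finally show ?case .
qed

definition sum_maps :: "(int \<Rightarrow> ('a, 'p) module) \<Rightarrow> int \<Rightarrow> ('i \<Rightarrow> int \<Rightarrow> 'p \<Rightarrow> 'p) \<Rightarrow> 'i set \<Rightarrow> int \<Rightarrow> 'p \<Rightarrow> 'p" where
  "sum_maps P n f A = (\<lambda>j. \<lambda>x\<in>carrier (P j). \<Oplus>\<^bsub>P (j - n)\<^esub>a\<in>A. f a j x)"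

context
  fixes R :: "('a, 'c) ring_scheme" and P :: "int \<Rightarrow> ('a, 'p) module" and d :: "int \<Rightarrow> 'p \<Rightarrow> 'p"
  assumes P: "lcomplex R P d"
begin

lemma chain_maps_eqI:
  assumes "f \<in> chain_maps R P d Q d' n" "g \<in> chain_maps R P d Q d' n"
    and "\<And>j x. x \<in> carrier (P j) \<Longrightarrow> f j x = g j x"
  shows "f = g"
  using lmod_hom_eqI[OF chain_mapsD(2)[OF assms(1)] chain_mapsD(2)[OF assms(2)] assms(3)] by (rule ext)

lemma zero_map_chain: "zero_map P n \<in> chain_maps R P d P d n"
proof -
  have "(\<lambda>x\<in>carrier (P j). \<zero>\<^bsub>P (j - n)\<^esub>) \<in> lmod_hom R (P j) (P (j - n))" for j
    by (rule lmod_hom_zero_map[OF lcomplexD(1)[OF P] lcomplexD(1)[OF P]])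
  moreover have "d (j - n) \<zero>\<^bsub>P (j - n)\<^esub> = signed (P (j - 1 - n)) n \<zero>\<^bsub>P (j - 1 - n)\<^esub>" for j
    using lmod_hom_zero[OF lcomplexD(1)[OF P] lcomplexD(1)[OF P] lcomplexD(3)[OF P], of "j - n"]
    unfolding abelian_group.signed_zero[OF lcomplexD(2)[OF P]] int_shift(1) .
  ultimately show ?thesis
    using lcomplexD(4)[OF P] by (simp add: chain_maps_def hom_family_def zero_map_def)
qed

lemma null_homotopic_zero: "null_homotopic R P d P d n (zero_map P n)"
proof -
  have "d (j - (n - 1)) \<zero>\<^bsub>P (j - (n - 1))\<^esub> = \<zero>\<^bsub>P (j - n)\<^esub>" for j
    using lmod_hom_zero[OF lcomplexD(1)[OF P] lcomplexD(1)[OF P] lcomplexD(3)[OF P], of "j - (n - 1)"]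
    unfolding int_shift(2) .
  then have "zero_map P n j x = d (j - (n - 1)) (zero_map P (n - 1) j x) \<oplus>\<^bsub>P (j - n)\<^esub>
      signed (P (j - n)) n (zero_map P (n - 1) (j - 1) (d j x))" if x: "x \<in> carrier (P j)" for j x
  proof -
    interpret Pj: abelian_group "P (j - n)" by (rule lcomplexD(2)[OF P])
    show ?thesis
      using x lcomplexD(4)[OF P x] \<open>\<And>j. d (j - (n - 1)) \<zero>\<^bsub>P (j - (n - 1))\<^esub> = \<zero>\<^bsub>P (j - n)\<^esub>\<close>
      by (simp only: zero_map_def restrict_apply' int_shift(3) Pj.signed_zero Pj.l_zero Pj.zero_closed)
  qed
  then show ?thesis
    unfolding null_homotopic_def
    by (intro bexI[OF _ chain_mapsD(1)[OF zero_map_chain]]) blast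
qed

lemma finsum_maps_empty:
  "sum_maps P n f {} = zero_map P n"
proof -
  have "(\<Oplus>\<^bsub>P (j - n)\<^esub>a\<in>{}. f a j x) = \<zero>\<^bsub>P (j - n)\<^esub>" for j x
    by (rule abelian_monoid.finsum_empty[OF abelian_group.axioms(1)[OF lcomplexD(2)[OF P]]])
  then show ?thesis unfolding sum_maps_def zero_map_def restrict_family_eq_iff by blast
qed

lemma finsum_maps_insert:
  assumes "finite A" "b \<notin> A" "\<And>a. a \<in> insert b A \<Longrightarrow> f a \<in> hom_family R P P n"
  shows "sum_maps P n f (insert b A) = add_maps P P n (f b) (sum_maps P n f A)"
proof -
  have "(\<Oplus>\<^bsub>P (j - n)\<^esub>a\<in>insert b A. f a j x) = f b j x \<oplus>\<^bsub>P (j - n)\<^esub> (\<Oplus>\<^bsub>P (j - n)\<^esub>a\<in>A. f a j x)"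
    if x: "x \<in> carrier (P j)" for j x
    using hom_familyD(2)[OF assms(3) x] assms(1,2)
    by (intro abelian_monoid.finsum_insert[OF abelian_group.axioms(1)[OF lcomplexD(2)[OF P]]]) auto
  then show ?thesis unfolding sum_maps_def add_maps_def restrict_family_eq_iff by simp
qed

lemma chain_maps_finsum:
  assumes "finite A" "\<And>a. a \<in> A \<Longrightarrow> f a \<in> chain_maps R P d P d n"
  shows "sum_maps P n f A \<in> chain_maps R P d P d n"
  using assms
proof (induction A)
  case empty
  show ?case unfolding finsum_maps_empty by (rule zero_map_chain)
next
  case (insert b A)
  have "sum_maps P n f (insert b A) = add_maps P P n (f b) (sum_maps P n f A)"
    by (rule finsum_maps_insert[OF insert.hyps chain_mapsD(1)[OF insert.prems]])
  moreover have "add_maps P P n (f b) (sum_maps P n f A) \<in> chain_maps R P d P d n"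
    using insert by (intro chain_maps_add[OF P P]) auto
  ultimately show ?case by simp
qed

section \<open>Ring axioms for families of cocycles\<close>

lemma cocycle_ring_simps:
  "monoid.mult (cocycle_ring R P d) = (\<lambda>F G n j. \<lambda>x \<in> carrier (P j).
       \<Oplus>\<^bsub>P (j - int n)\<^esub>a \<in> {..n}. F a (j - int (n - a)) (G (n - a) j x))"
  "monoid.one (cocycle_ring R P d) = (\<lambda>n j. \<lambda>x \<in> carrier (P j). if n = 0 then x else \<zero>\<^bsub>P (j - int n)\<^esub>)"
  "ring.zero (cocycle_ring R P d) = (\<lambda>n. zero_map P (int n))"
  "ring.add (cocycle_ring R P d) = (\<lambda>F G n. add_maps P P (int n) (F n) (G n))"
  by (simp_all add: cocycle_ring_def add_maps_def)

lemma cocycle_ring_carrier: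
  "F \<in> carrier (cocycle_ring R P d) \<longleftrightarrow> (\<forall>n. F n \<in> chain_maps R P d P d (int n)) \<and> finite {n. F n \<noteq> zero_map P (int n)}"
  by (simp add: cocycle_ring_def cocycles_eq_chain_maps[OF P])

lemma cocycle_ring_closed:
  assumes "F \<in> carrier (cocycle_ring R P d)"
  shows "F n \<in> chain_maps R P d P d (int n)" "F n j \<in> lmod_hom R (P j) (P (j - int n))"
    "x \<in> carrier (P j) \<Longrightarrow> F n j x \<in> carrier (P (j - int n))"
proof -
  show F: "F n \<in> chain_maps R P d P d (int n)" using assms by (simp add: cocycle_ring_carrier)
  show "F n j \<in> lmod_hom R (P j) (P (j - int n))" using chain_mapsD(2)[OF F] .
  show "F n j x \<in> carrier (P (j - int n))" if "x \<in> carrier (P j)" using chain_mapsD(3)[OF F that] .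
qed

lemma cocycle_ring_eqI:
  assumes "F \<in> carrier (cocycle_ring R P d)" "G \<in> carrier (cocycle_ring R P d)" "\<And>n j x. x \<in> carrier (P j) \<Longrightarrow> F n j x = G n j x"
  shows "F = G"
  using chain_maps_eqI[OF cocycle_ring_closed(1)[OF assms(1)] cocycle_ring_closed(1)[OF assms(2)] assms(3)]
  by (rule ext)

lemma cocycle_ring_add_apply:
  "x \<in> carrier (P j) \<Longrightarrow> (F \<oplus>\<^bsub>cocycle_ring R P d\<^esub> G) n j x = F n j x \<oplus>\<^bsub>P (j - int n)\<^esub> G n j x"
  by (simp add: cocycle_ring_simps add_maps_def)

lemma cocycle_ring_mult_apply:
  "x \<in> carrier (P j) \<Longrightarrow> (F \<otimes>\<^bsub>cocycle_ring R P d\<^esub> G) n j x = (\<Oplus>\<^bsub>P (j - int n)\<^esub>a \<in> {..n}. F a (j - int (n - a)) (G (n - a) j x))"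
  by (simp add: cocycle_ring_simps)

lemma cocycle_ring_one_apply:
  "x \<in> carrier (P j) \<Longrightarrow> \<one>\<^bsub>cocycle_ring R P d\<^esub> n j x = (if n = 0 then x else \<zero>\<^bsub>P (j - int n)\<^esub>)"
  by (simp add: cocycle_ring_simps)

lemma zero_map_apply: "x \<in> carrier (P j) \<Longrightarrow> zero_map P n j x = \<zero>\<^bsub>P (j - n)\<^esub>"
  by (simp add: zero_map_def)

lemma cocycle_ring_mult_eq:
  "(F \<otimes>\<^bsub>cocycle_ring R P d\<^esub> G) n = sum_maps P (int n) (\<lambda>a. comp_maps P (int (n - a)) (F a) (G (n - a))) {..n}"
  unfolding cocycle_ring_simps sum_maps_def restrict_family_eq_iff by (simp add: comp_maps_def)

lemma cocycle_ring_comp: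
  assumes "F \<in> carrier (cocycle_ring R P d)" "G \<in> carrier (cocycle_ring R P d)" "a \<le> n"
  shows "comp_maps P (int (n - a)) (F a) (G (n - a)) \<in> chain_maps R P d P d (int n)"
proof -
  have "int a + int (n - a) = int n" using assms(3) by simp
  then show ?thesis
    using chain_maps_comp[OF P P P cocycle_ring_closed(1)[OF assms(1), of a] cocycle_ring_closed(1)[OF assms(2), of "n - a"]]
    by simp
qed

lemma cocycle_ring_summand_closed:
  assumes "F \<in> carrier (cocycle_ring R P d)" "G \<in> carrier (cocycle_ring R P d)" "a \<le> n" "x \<in> carrier (P j)"
  shows "F a (j - int (n - a)) (G (n - a) j x) \<in> carrier (P (j - int n))"
  using chain_mapsD(3)[OF cocycle_ring_comp[OF assms(1-3)] assms(4)] assms(4) by (simp add: comp_maps_def)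

lemma cocycle_ring_mult_closed:
  assumes F: "F \<in> carrier (cocycle_ring R P d)" and G: "G \<in> carrier (cocycle_ring R P d)"
  shows "F \<otimes>\<^bsub>cocycle_ring R P d\<^esub> G \<in> carrier (cocycle_ring R P d)"
proof -
  have mult: "(F \<otimes>\<^bsub>cocycle_ring R P d\<^esub> G) n \<in> chain_maps R P d P d (int n)" for n
    unfolding cocycle_ring_mult_eq by (rule chain_maps_finsum, simp, rule cocycle_ring_comp[OF F G], simp)
  let ?S = "\<lambda>F. {n. F n \<noteq> zero_map P (int n)}"
  \<comment> \<open>A component of the product can be nonzero only in a degree that is a sum of
    degrees from the two supports, which keeps the support finite.\<close>
  have zero: "(F \<otimes>\<^bsub>cocycle_ring R P d\<^esub> G) n = zero_map P (int n)" if n: "n \<notin> (\<lambda>(a, b). a + b) ` (?S F \<times> ?S G)" for n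
  proof (rule chain_maps_eqI[OF mult zero_map_chain])
    fix j x assume x: "x \<in> carrier (P j)"
    have "F a (j - int (n - a)) (G (n - a) j x) = \<zero>\<^bsub>P (j - int n)\<^esub>" if a: "a \<in> {..n}" for a
    proof -
      have Gx: "G (n - a) j x \<in> carrier (P (j - int (n - a)))" by (rule cocycle_ring_closed(3)[OF G x])
      have eq: "j - int (n - a) - int a = j - int n" using a by simp
      have "n = a + (n - a)" using a by simp
      then have "F a = zero_map P (int a) \<or> G (n - a) = zero_map P (int (n - a))"
        using n by (force simp del: of_nat_diff)
      then show ?thesis
      proof
        assume "F a = zero_map P (int a)"
        then show ?thesis using zero_map_apply[OF Gx, of "int a"] eq by simp
      next
        assume "G (n - a) = zero_map P (int (n - a))"
        then have "G (n - a) j x = \<zero>\<^bsub>P (j - int (n - a))\<^esub>" using zero_map_apply[OF x] by simp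
        then show ?thesis
          using lmod_hom_zero[OF lcomplexD(1)[OF P] lcomplexD(1)[OF P] cocycle_ring_closed(2)[OF F, of a "j - int (n - a)"]] eq
          by simp
      qed
    qed
    then show "(F \<otimes>\<^bsub>cocycle_ring R P d\<^esub> G) n j x = zero_map P (int n) j x"
      unfolding cocycle_ring_mult_apply[OF x] zero_map_apply[OF x]
      by (rule abelian_group.finsum_zeroI[OF lcomplexD(2)[OF P]])
  qed
  have "finite ((\<lambda>(a, b). a + b) ` (?S F \<times> ?S G))"
    using F G by (simp add: cocycle_ring_carrier)
  then have "finite (?S (F \<otimes>\<^bsub>cocycle_ring R P d\<^esub> G))"
    by (rule finite_subset[rotated]) (use zero in blast)
  then show ?thesis using mult by (simp add: cocycle_ring_carrier)
qed

lemma cocycle_ring_mult_assoc: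
  assumes F: "F \<in> carrier (cocycle_ring R P d)" and G: "G \<in> carrier (cocycle_ring R P d)" and H: "H \<in> carrier (cocycle_ring R P d)"
  shows "F \<otimes>\<^bsub>cocycle_ring R P d\<^esub> G \<otimes>\<^bsub>cocycle_ring R P d\<^esub> H = F \<otimes>\<^bsub>cocycle_ring R P d\<^esub> (G \<otimes>\<^bsub>cocycle_ring R P d\<^esub> H)"
proof (rule cocycle_ring_eqI)
  show "F \<otimes>\<^bsub>cocycle_ring R P d\<^esub> G \<otimes>\<^bsub>cocycle_ring R P d\<^esub> H \<in> carrier (cocycle_ring R P d)" "F \<otimes>\<^bsub>cocycle_ring R P d\<^esub> (G \<otimes>\<^bsub>cocycle_ring R P d\<^esub> H) \<in> carrier (cocycle_ring R P d)"
    using F G H by (simp_all add: cocycle_ring_mult_closed)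
  fix n j x assume x: "x \<in> carrier (P j)"
  note closed = cocycle_ring_closed and mult_apply = cocycle_ring_mult_apply
  interpret Pn: abelian_group "P (j - int n)" by (rule lcomplexD(2)[OF P])
  \<comment> \<open>The summand of the triple product with F in degree b, G in degree c and H in the
    remaining degree. Both bracketings become sums of these over the triangle b + c \<le> n.\<close>
  define T where "T b c = F b (j - int (n - b)) (G c (j - int (n - b - c)) (H (n - b - c) j x))" for b c
  have GH: "G c (j - int (n - b - c)) (H (n - b - c) j x) \<in> carrier (P (j - int (n - b)))" if "b + c \<le> n" for b c
    using cocycle_ring_summand_closed[OF G H _ x, of c "n - b"] that by simp
  have T: "T b c \<in> carrier (P (j - int n))" if "b + c \<le> n" for b c
  proof -
    have "j - int (n - b) - int b = j - int n" using that by simp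
    then show ?thesis unfolding T_def using closed(3)[OF F GH[OF that], of b] by simp
  qed
  have "(F \<otimes>\<^bsub>cocycle_ring R P d\<^esub> G \<otimes>\<^bsub>cocycle_ring R P d\<^esub> H) n j x = (\<Oplus>\<^bsub>P (j - int n)\<^esub>a\<in>{..n}. \<Oplus>\<^bsub>P (j - int n)\<^esub>b\<in>{..a}. T b (a - b))"
    unfolding mult_apply[OF x]
  proof (rule Pn.finsum_cong')
    fix a assume a: "a \<in> {..n}"
    have Hx: "H (n - a) j x \<in> carrier (P (j - int (n - a)))" by (rule closed(3)[OF H x])
    have eq: "j - int (n - a) - int a = j - int n" using a by simp
    have "(F \<otimes>\<^bsub>cocycle_ring R P d\<^esub> G) a (j - int (n - a)) (H (n - a) j x)
      = (\<Oplus>\<^bsub>P (j - int n)\<^esub>b\<in>{..a}. F b (j - int (n - a) - int (a - b)) (G (a - b) (j - int (n - a)) (H (n - a) j x)))"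
      unfolding mult_apply[OF Hx] eq ..
    also have "\<dots> = (\<Oplus>\<^bsub>P (j - int n)\<^esub>b\<in>{..a}. T b (a - b))"
    proof (rule Pn.finsum_cong')
      fix b assume b: "b \<in> {..a}"
      have "j - int (n - a) - int (a - b) = j - int (n - b)" "n - b - (a - b) = n - a" using a b by auto
      then show "F b (j - int (n - a) - int (a - b)) (G (a - b) (j - int (n - a)) (H (n - a) j x)) = T b (a - b)"
        by (simp only: T_def)
    qed (use a T in auto)
    finally show "(F \<otimes>\<^bsub>cocycle_ring R P d\<^esub> G) a (j - int (n - a)) (H (n - a) j x) = (\<Oplus>\<^bsub>P (j - int n)\<^esub>b\<in>{..a}. T b (a - b))" .
  qed (auto intro!: Pn.finsum_closed T)
  also have "\<dots> = (\<Oplus>\<^bsub>P (j - int n)\<^esub>b\<in>{..n}. \<Oplus>\<^bsub>P (j - int n)\<^esub>c\<in>{..n - b}. T b c)"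
    by (rule Pn.finsum_triangle) (rule T)
  also have "\<dots> = (F \<otimes>\<^bsub>cocycle_ring R P d\<^esub> (G \<otimes>\<^bsub>cocycle_ring R P d\<^esub> H)) n j x"
    unfolding mult_apply[OF x]
  proof (rule Pn.finsum_cong')
    show "(\<lambda>a. F a (j - int (n - a)) (\<Oplus>\<^bsub>P (j - int (n - a))\<^esub>c\<in>{..n - a}. G c (j - int (n - a - c)) (H (n - a - c) j x)))
      \<in> {..n} \<rightarrow> carrier (P (j - int n))"
      using cocycle_ring_summand_closed[OF F cocycle_ring_mult_closed[OF G H] _ x, of _ n]
      unfolding mult_apply[OF x] by auto
    fix b assume b: "b \<in> {..n}"
    have eq: "j - int (n - b) - int b = j - int n" using b by simp
    have "F b (j - int (n - b)) (\<Oplus>\<^bsub>P (j - int (n - b))\<^esub>c\<in>{..n - b}. G c (j - int (n - b - c)) (H (n - b - c) j x))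
      = (\<Oplus>\<^bsub>P (j - int (n - b) - int b)\<^esub>c\<in>{..n - b}. T b c)"
      unfolding T_def
      by (rule lmod_hom_finsum[OF lcomplexD(1)[OF P] lcomplexD(1)[OF P] closed(2)[OF F]])
         (use GH b in auto)
    then show "(\<Oplus>\<^bsub>P (j - int n)\<^esub>c\<in>{..n - b}. T b c)
      = F b (j - int (n - b)) (\<Oplus>\<^bsub>P (j - int (n - b))\<^esub>c\<in>{..n - b}. G c (j - int (n - b - c)) (H (n - b - c) j x))"
      by (simp only: eq)
  qed (rule refl)
  finally show "(F \<otimes>\<^bsub>cocycle_ring R P d\<^esub> G \<otimes>\<^bsub>cocycle_ring R P d\<^esub> H) n j x = (F \<otimes>\<^bsub>cocycle_ring R P d\<^esub> (G \<otimes>\<^bsub>cocycle_ring R P d\<^esub> H)) n j x" .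
qed

lemma cocycle_ring_one_closed: "\<one>\<^bsub>cocycle_ring R P d\<^esub> \<in> carrier (cocycle_ring R P d)"
proof -
  have eq: "\<one>\<^bsub>cocycle_ring R P d\<^esub> n = (if n = 0 then (\<lambda>j. \<lambda>x\<in>carrier (P j). x) else zero_map P (int n))" for n
    by (auto simp: cocycle_ring_simps zero_map_def)
  have "{n. \<one>\<^bsub>cocycle_ring R P d\<^esub> n \<noteq> zero_map P (int n)} \<subseteq> {0}" by (auto simp: eq)
  then have "finite {n. \<one>\<^bsub>cocycle_ring R P d\<^esub> n \<noteq> zero_map P (int n)}" by (rule finite_subset) simp
  then show ?thesis
    using identity_chain_map[OF P] zero_map_chain by (simp add: cocycle_ring_carrier eq)
qed

lemma cocycle_ring_zero_closed: "\<zero>\<^bsub>cocycle_ring R P d\<^esub> \<in> carrier (cocycle_ring R P d)"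
  by (simp add: cocycle_ring_carrier cocycle_ring_simps zero_map_chain)

lemma cocycle_ring_add_closed:
  assumes "F \<in> carrier (cocycle_ring R P d)" "G \<in> carrier (cocycle_ring R P d)"
  shows "F \<oplus>\<^bsub>cocycle_ring R P d\<^esub> G \<in> carrier (cocycle_ring R P d)"
proof -
  have "add_maps P P (int n) (zero_map P (int n)) (zero_map P (int n)) = zero_map P (int n)" for n
  proof -
    have "\<zero>\<^bsub>P (j - int n)\<^esub> \<oplus>\<^bsub>P (j - int n)\<^esub> \<zero>\<^bsub>P (j - int n)\<^esub> = \<zero>\<^bsub>P (j - int n)\<^esub>" for j
    proof -
      interpret abelian_group "P (j - int n)" by (rule lcomplexD(2)[OF P])
      show ?thesis by simp
    qed
    then show ?thesis unfolding add_maps_def zero_map_def restrict_family_eq_iff by simp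
  qed
  then have sub: "{n. (F \<oplus>\<^bsub>cocycle_ring R P d\<^esub> G) n \<noteq> zero_map P (int n)} \<subseteq> {n. F n \<noteq> zero_map P (int n)} \<union> {n. G n \<noteq> zero_map P (int n)}"
    by (auto simp: cocycle_ring_simps)
  have "finite {n. (F \<oplus>\<^bsub>cocycle_ring R P d\<^esub> G) n \<noteq> zero_map P (int n)}"
    by (rule finite_subset[OF sub]) (use assms in \<open>simp add: cocycle_ring_carrier\<close>)
  moreover have "(F \<oplus>\<^bsub>cocycle_ring R P d\<^esub> G) n \<in> chain_maps R P d P d (int n)" for n
    using chain_maps_add[OF P P cocycle_ring_closed(1)[OF assms(1)] cocycle_ring_closed(1)[OF assms(2)]]
    by (simp add: cocycle_ring_simps)
  ultimately show ?thesis by (simp add: cocycle_ring_carrier)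
qed

lemma cocycle_ring_neg_closed:
  assumes "F \<in> carrier (cocycle_ring R P d)"
  shows "(\<lambda>n. signed_maps P P (int n) 1 (F n)) \<in> carrier (cocycle_ring R P d)"
proof -
  have "signed_maps P P (int n) 1 (zero_map P (int n)) = zero_map P (int n)" for n
    unfolding signed_maps_def zero_map_def restrict_family_eq_iff
    using abelian_group.signed_zero[OF lcomplexD(2)[OF P]] by simp
  then have sub: "{n. signed_maps P P (int n) 1 (F n) \<noteq> zero_map P (int n)} \<subseteq> {n. F n \<noteq> zero_map P (int n)}"
    by auto
  have "finite {n. signed_maps P P (int n) 1 (F n) \<noteq> zero_map P (int n)}"
    by (rule finite_subset[OF sub]) (use assms in \<open>simp add: cocycle_ring_carrier\<close>)
  then show ?thesis
    using chain_maps_signed[OF P P cocycle_ring_closed(1)[OF assms]] by (simp add: cocycle_ring_carrier)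
qed

lemma cocycle_ring_neg:
  assumes F: "F \<in> carrier (cocycle_ring R P d)"
  shows "(\<lambda>n. signed_maps P P (int n) 1 (F n)) \<oplus>\<^bsub>cocycle_ring R P d\<^esub> F = \<zero>\<^bsub>cocycle_ring R P d\<^esub>"
proof (rule cocycle_ring_eqI[OF cocycle_ring_add_closed[OF cocycle_ring_neg_closed[OF F] F] cocycle_ring_zero_closed])
  fix n j x assume x: "x \<in> carrier (P j)"
  interpret Pn: abelian_group "P (j - int n)" by (rule lcomplexD(2)[OF P])
  show "((\<lambda>n. signed_maps P P (int n) 1 (F n)) \<oplus>\<^bsub>cocycle_ring R P d\<^esub> F) n j x = \<zero>\<^bsub>cocycle_ring R P d\<^esub> n j x"
    using x cocycle_ring_closed(3)[OF F x]
    by (simp add: cocycle_ring_simps add_maps_def signed_maps_def zero_map_def signed_def Pn.l_neg)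
qed

lemma ring_cocycle_ring: "ring (cocycle_ring R P d)"
proof (rule ringI)
  note add = cocycle_ring_add_apply and mult = cocycle_ring_mult_apply
  show "abelian_group (cocycle_ring R P d)"
  proof (rule abelian_groupI)
    fix F G assume F: "F \<in> carrier (cocycle_ring R P d)" and G: "G \<in> carrier (cocycle_ring R P d)"
    show "F \<oplus>\<^bsub>cocycle_ring R P d\<^esub> G \<in> carrier (cocycle_ring R P d)" by (rule cocycle_ring_add_closed[OF F G])
    show "F \<oplus>\<^bsub>cocycle_ring R P d\<^esub> G = G \<oplus>\<^bsub>cocycle_ring R P d\<^esub> F"
    proof (rule cocycle_ring_eqI)
      fix n j x assume x: "x \<in> carrier (P j)"
      interpret Pn: abelian_group "P (j - int n)" by (rule lcomplexD(2)[OF P])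
      show "(F \<oplus>\<^bsub>cocycle_ring R P d\<^esub> G) n j x = (G \<oplus>\<^bsub>cocycle_ring R P d\<^esub> F) n j x"
        unfolding add[OF x] by (rule Pn.a_comm[OF cocycle_ring_closed(3)[OF F x] cocycle_ring_closed(3)[OF G x]])
    qed (simp_all add: cocycle_ring_add_closed F G)
    fix H assume H: "H \<in> carrier (cocycle_ring R P d)"
    show "F \<oplus>\<^bsub>cocycle_ring R P d\<^esub> G \<oplus>\<^bsub>cocycle_ring R P d\<^esub> H = F \<oplus>\<^bsub>cocycle_ring R P d\<^esub> (G \<oplus>\<^bsub>cocycle_ring R P d\<^esub> H)"
    proof (rule cocycle_ring_eqI)
      fix n j x assume x: "x \<in> carrier (P j)"
      interpret Pn: abelian_group "P (j - int n)" by (rule lcomplexD(2)[OF P])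
      show "(F \<oplus>\<^bsub>cocycle_ring R P d\<^esub> G \<oplus>\<^bsub>cocycle_ring R P d\<^esub> H) n j x = (F \<oplus>\<^bsub>cocycle_ring R P d\<^esub> (G \<oplus>\<^bsub>cocycle_ring R P d\<^esub> H)) n j x"
        unfolding add[OF x]
        by (rule Pn.a_assoc[OF cocycle_ring_closed(3)[OF F x] cocycle_ring_closed(3)[OF G x] cocycle_ring_closed(3)[OF H x]])
    qed (simp_all add: cocycle_ring_add_closed F G H)
  next
    fix F assume F: "F \<in> carrier (cocycle_ring R P d)"
    show "\<zero>\<^bsub>cocycle_ring R P d\<^esub> \<oplus>\<^bsub>cocycle_ring R P d\<^esub> F = F"
    proof (rule cocycle_ring_eqI)
      fix n j x assume x: "x \<in> carrier (P j)"
      interpret Pn: abelian_group "P (j - int n)" by (rule lcomplexD(2)[OF P])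
      show "(\<zero>\<^bsub>cocycle_ring R P d\<^esub> \<oplus>\<^bsub>cocycle_ring R P d\<^esub> F) n j x = F n j x"
        unfolding add[OF x] using cocycle_ring_closed(3)[OF F x] x
        by (simp add: cocycle_ring_simps zero_map_def)
    qed (simp_all add: cocycle_ring_add_closed cocycle_ring_zero_closed F)
    show "\<exists>G\<in>carrier (cocycle_ring R P d). G \<oplus>\<^bsub>cocycle_ring R P d\<^esub> F = \<zero>\<^bsub>cocycle_ring R P d\<^esub>"
      using cocycle_ring_neg_closed[OF F] cocycle_ring_neg[OF F] by blast
  qed (rule cocycle_ring_zero_closed)
  show "monoid (cocycle_ring R P d)"
  proof (rule monoidI)
    fix F assume F: "F \<in> carrier (cocycle_ring R P d)"
    show "\<one>\<^bsub>cocycle_ring R P d\<^esub> \<otimes>\<^bsub>cocycle_ring R P d\<^esub> F = F"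
    proof (rule cocycle_ring_eqI)
      fix n j x assume x: "x \<in> carrier (P j)"
      interpret Pn: abelian_group "P (j - int n)" by (rule lcomplexD(2)[OF P])
      have "(\<one>\<^bsub>cocycle_ring R P d\<^esub> \<otimes>\<^bsub>cocycle_ring R P d\<^esub> F) n j x = (\<Oplus>\<^bsub>P (j - int n)\<^esub>a\<in>{..n}. if 0 = a then F n j x else \<zero>\<^bsub>P (j - int n)\<^esub>)"
        unfolding mult[OF x]
      proof (rule Pn.finsum_cong')
        fix a assume a: "a \<in> {..n}"
        have eq: "j - int (n - a) - int a = j - int n" using a by simp
        show "\<one>\<^bsub>cocycle_ring R P d\<^esub> a (j - int (n - a)) (F (n - a) j x) = (if 0 = a then F n j x else \<zero>\<^bsub>P (j - int n)\<^esub>)"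
          unfolding cocycle_ring_one_apply[OF cocycle_ring_closed(3)[OF F x]] eq by simp
      qed (use cocycle_ring_closed(3)[OF F x] in auto)
      also have "\<dots> = F n j x"
        by (rule Pn.add.finprod_singleton) (use cocycle_ring_closed(3)[OF F x] in auto)
      finally show "(\<one>\<^bsub>cocycle_ring R P d\<^esub> \<otimes>\<^bsub>cocycle_ring R P d\<^esub> F) n j x = F n j x" .
    qed (simp_all add: cocycle_ring_mult_closed cocycle_ring_one_closed F)
    show "F \<otimes>\<^bsub>cocycle_ring R P d\<^esub> \<one>\<^bsub>cocycle_ring R P d\<^esub> = F"
    proof (rule cocycle_ring_eqI)
      fix n j x assume x: "x \<in> carrier (P j)"
      interpret Pn: abelian_group "P (j - int n)" by (rule lcomplexD(2)[OF P])
      have "(F \<otimes>\<^bsub>cocycle_ring R P d\<^esub> \<one>\<^bsub>cocycle_ring R P d\<^esub>) n j x = (\<Oplus>\<^bsub>P (j - int n)\<^esub>a\<in>{..n}. if n = a then F n j x else \<zero>\<^bsub>P (j - int n)\<^esub>)"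
        unfolding mult[OF x]
      proof (rule Pn.finsum_cong')
        fix a assume a: "a \<in> {..n}"
        have eq: "j - int (n - a) - int a = j - int n" using a by simp
        show "F a (j - int (n - a)) (\<one>\<^bsub>cocycle_ring R P d\<^esub> (n - a) j x) = (if n = a then F n j x else \<zero>\<^bsub>P (j - int n)\<^esub>)"
        proof (cases "n = a")
          case True
          then show ?thesis using x by (simp add: cocycle_ring_one_apply)
        next
          case False
          then have "\<one>\<^bsub>cocycle_ring R P d\<^esub> (n - a) j x = \<zero>\<^bsub>P (j - int (n - a))\<^esub>"
            using a cocycle_ring_one_apply[OF x] by simp
          then show ?thesis
            using False eq lmod_hom_zero[OF lcomplexD(1)[OF P] lcomplexD(1)[OF P] cocycle_ring_closed(2)[OF F, of a "j - int (n - a)"]]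
            by simp
        qed
      qed (use cocycle_ring_closed(3)[OF F x] in auto)
      also have "\<dots> = F n j x"
        by (rule Pn.add.finprod_singleton) (use cocycle_ring_closed(3)[OF F x] in auto)
      finally show "(F \<otimes>\<^bsub>cocycle_ring R P d\<^esub> \<one>\<^bsub>cocycle_ring R P d\<^esub>) n j x = F n j x" .
    qed (simp_all add: cocycle_ring_mult_closed cocycle_ring_one_closed F)
  qed (simp_all add: cocycle_ring_mult_closed cocycle_ring_one_closed cocycle_ring_mult_assoc)
  fix F G H assume F: "F \<in> carrier (cocycle_ring R P d)" and G: "G \<in> carrier (cocycle_ring R P d)" and H: "H \<in> carrier (cocycle_ring R P d)"
  note closed = cocycle_ring_mult_closed cocycle_ring_add_closed
  show "(F \<oplus>\<^bsub>cocycle_ring R P d\<^esub> G) \<otimes>\<^bsub>cocycle_ring R P d\<^esub> H = F \<otimes>\<^bsub>cocycle_ring R P d\<^esub> H \<oplus>\<^bsub>cocycle_ring R P d\<^esub> G \<otimes>\<^bsub>cocycle_ring R P d\<^esub> H"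
  proof (rule cocycle_ring_eqI)
    fix n j x assume x: "x \<in> carrier (P j)"
    interpret Pn: abelian_group "P (j - int n)" by (rule lcomplexD(2)[OF P])
    show "((F \<oplus>\<^bsub>cocycle_ring R P d\<^esub> G) \<otimes>\<^bsub>cocycle_ring R P d\<^esub> H) n j x = (F \<otimes>\<^bsub>cocycle_ring R P d\<^esub> H \<oplus>\<^bsub>cocycle_ring R P d\<^esub> G \<otimes>\<^bsub>cocycle_ring R P d\<^esub> H) n j x"
      unfolding add[OF x] mult[OF x]
    proof (subst Pn.finsum_addf[symmetric], goal_cases)
      case 3
      show ?case
      proof (rule Pn.finsum_cong')
        fix a assume a: "a \<in> {..n}"
        have eq: "j - int (n - a) - int a = j - int n" using a by simp
        show "(F \<oplus>\<^bsub>cocycle_ring R P d\<^esub> G) a (j - int (n - a)) (H (n - a) j x)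
          = F a (j - int (n - a)) (H (n - a) j x) \<oplus>\<^bsub>P (j - int n)\<^esub> G a (j - int (n - a)) (H (n - a) j x)"
          unfolding add[OF cocycle_ring_closed(3)[OF H x]] eq ..
      qed (auto intro!: cocycle_ring_summand_closed[OF F H _ x] cocycle_ring_summand_closed[OF G H _ x])
    qed (auto intro!: cocycle_ring_summand_closed[OF F H _ x] cocycle_ring_summand_closed[OF G H _ x])
  qed (simp_all add: closed F G H)
  show "H \<otimes>\<^bsub>cocycle_ring R P d\<^esub> (F \<oplus>\<^bsub>cocycle_ring R P d\<^esub> G) = H \<otimes>\<^bsub>cocycle_ring R P d\<^esub> F \<oplus>\<^bsub>cocycle_ring R P d\<^esub> H \<otimes>\<^bsub>cocycle_ring R P d\<^esub> G"
  proof (rule cocycle_ring_eqI)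
    fix n j x assume x: "x \<in> carrier (P j)"
    interpret Pn: abelian_group "P (j - int n)" by (rule lcomplexD(2)[OF P])
    show "(H \<otimes>\<^bsub>cocycle_ring R P d\<^esub> (F \<oplus>\<^bsub>cocycle_ring R P d\<^esub> G)) n j x = (H \<otimes>\<^bsub>cocycle_ring R P d\<^esub> F \<oplus>\<^bsub>cocycle_ring R P d\<^esub> H \<otimes>\<^bsub>cocycle_ring R P d\<^esub> G) n j x"
      unfolding add[OF x] mult[OF x]
    proof (subst Pn.finsum_addf[symmetric], goal_cases)
      case 3
      show ?case
      proof (rule Pn.finsum_cong')
        fix a assume a: "a \<in> {..n}"
        have eq: "j - int (n - a) - int a = j - int n" using a by simp
        show "H a (j - int (n - a)) (F (n - a) j x \<oplus>\<^bsub>P (j - int (n - a))\<^esub> G (n - a) j x)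
          = H a (j - int (n - a)) (F (n - a) j x) \<oplus>\<^bsub>P (j - int n)\<^esub> H a (j - int (n - a)) (G (n - a) j x)"
          unfolding lmod_homD(2)[OF cocycle_ring_closed(2)[OF H] cocycle_ring_closed(3)[OF F x] cocycle_ring_closed(3)[OF G x]] eq ..
      qed (auto intro!: cocycle_ring_summand_closed[OF H F _ x] cocycle_ring_summand_closed[OF H G _ x])
    qed (auto intro!: cocycle_ring_summand_closed[OF H F _ x] cocycle_ring_summand_closed[OF H G _ x])
  qed (simp_all add: closed F G H)
qed

lemma coboundary_ideal_iff:
  "F \<in> coboundary_ideal R P d \<longleftrightarrow> F \<in> carrier (cocycle_ring R P d) \<and> (\<forall>n. null_homotopic R P d P d (int n) (F n))"
  unfolding coboundary_ideal_def
  using coboundaries_iff_null_homotopic[OF P chain_mapsD(1)[OF cocycle_ring_closed(1)]] by auto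

end

section \<open>The quantum exterior algebra\<close>

text \<open>The last coordinate belongs to yx. The word xy could not serve, since it equals -q yx
  and vanishes for q = 0.\<close>

datatype 'k lam = Lam (c1: 'k) (cx: 'k) (cy: 'k) (cyx: 'k)

instantiation lam :: (ab_group_add) ab_group_add
begin
definition "0 = Lam 0 0 0 0"
definition "a + b = Lam (c1 a + c1 b) (cx a + cx b) (cy a + cy b) (cyx a + cyx b)"
definition "- a = Lam (- c1 a) (- cx a) (- cy a) (- cyx a)"
definition "a - b = Lam (c1 a - c1 b) (cx a - cx b) (cy a - cy b) (cyx a - cyx b)"
instance
  by standard (simp_all add: zero_lam_def plus_lam_def uminus_lam_def minus_lam_def add_ac)
end

lemma lam_coord_simps [simp]:
  "c1 0 = 0" "cx 0 = 0" "cy 0 = 0" "cyx 0 = 0"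
  "c1 (a + b) = c1 a + c1 b" "cx (a + b) = cx a + cx b" "cy (a + b) = cy a + cy b" "cyx (a + b) = cyx a + cyx b"
  "c1 (- a) = - c1 a" "cx (- a) = - cx a" "cy (- a) = - cy a" "cyx (- a) = - cyx a"
  "c1 (a - b) = c1 a - c1 b" "cx (a - b) = cx a - cx b" "cy (a - b) = cy a - cy b" "cyx (a - b) = cyx a - cyx b"
  by (simp_all add: zero_lam_def plus_lam_def uminus_lam_def minus_lam_def)

lemma lam_eq_iff: "a = b \<longleftrightarrow> c1 a = c1 b \<and> cx a = cx b \<and> cy a = cy b \<and> cyx a = cyx b"
  by (cases a; cases b) simp

text \<open>Coordinates with respect to the basis \<open>1, x, y, yx\<close> of the algebra; the product is forced by \<open>xy = - q yx\<close>.\<close>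

definition lam_mult :: "'k::field \<Rightarrow> 'k lam \<Rightarrow> 'k lam \<Rightarrow> 'k lam" where
  "lam_mult q a b = Lam (c1 a * c1 b) (c1 a * cx b + cx a * c1 b) (c1 a * cy b + cy a * c1 b)
     (c1 a * cyx b + cyx a * c1 b + cy a * cx b - q * (cx a * cy b))"

definition lam_scale :: "'k::field \<Rightarrow> 'k lam \<Rightarrow> 'k lam" where
  "lam_scale c a = Lam (c * c1 a) (c * cx a) (c * cy a) (c * cyx a)"

lemma lam_op_simps [simp]:
  "c1 (lam_mult q a b) = c1 a * c1 b" "cx (lam_mult q a b) = c1 a * cx b + cx a * c1 b"
  "cy (lam_mult q a b) = c1 a * cy b + cy a * c1 b"
  "cyx (lam_mult q a b) = c1 a * cyx b + cyx a * c1 b + cy a * cx b - q * (cx a * cy b)"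
  "c1 (lam_scale c a) = c * c1 a" "cx (lam_scale c a) = c * cx a" "cy (lam_scale c a) = c * cy a"
  "cyx (lam_scale c a) = c * cyx a"
  by (simp_all add: lam_mult_def lam_scale_def)

fun lam_gen :: "letter \<Rightarrow> 'k::field lam" where
  "lam_gen LX = Lam 0 1 0 0"
| "lam_gen LY = Lam 0 0 1 0"

fun lam_word :: "'k::field \<Rightarrow> letter list \<Rightarrow> 'k lam" where
  "lam_word q [] = Lam 1 0 0 0"
| "lam_word q (a # l) = lam_mult q (lam_gen a) (lam_word q l)"

definition lam_eval :: "'k::field \<Rightarrow> 'k free_alg \<Rightarrow> 'k lam" where
  "lam_eval q = linext (\<lambda>w c. lam_scale c (lam_word q (letters w)))"

definition lam_nf :: "'k::field lam \<Rightarrow> 'k free_alg" where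
  "lam_nf a = Poly_Mapping.single (Word []) (c1 a) + Poly_Mapping.single (Word [LX]) (cx a)
     + Poly_Mapping.single (Word [LY]) (cy a) + Poly_Mapping.single (Word [LY, LX]) (cyx a)"

text \<open>The grading is defined as the image of the word grading, so that it agrees with that of
  the presented algebra by construction.\<close>

definition lam_algebra :: "'k::field \<Rightarrow> ('k, 'k lam) graded_algebra" where
  "lam_algebra q = \<lparr>carrier = UNIV, monoid.mult = lam_mult q, monoid.one = Lam 1 0 0 0,
     ring.zero = 0, ring.add = (+), scalar = (\<lambda>c. Lam c 0 0 0),
     homog = (\<lambda>n. lam_eval q ` {p. \<forall>w \<in> Poly_Mapping.keys p. length (letters w) = n})\<rparr>"

lemma lam_algebra_simps:
  "carrier (lam_algebra q) = UNIV" "a \<otimes>\<^bsub>lam_algebra q\<^esub> b = lam_mult q a b"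
  "a \<oplus>\<^bsub>lam_algebra q\<^esub> b = a + b" "\<zero>\<^bsub>lam_algebra q\<^esub> = 0" "\<one>\<^bsub>lam_algebra q\<^esub> = Lam 1 0 0 0"
  "scalar (lam_algebra q) c = Lam c 0 0 0"
  by (simp_all add: lam_algebra_def)

lemma lam_mult_assoc: "lam_mult q (lam_mult q a b) c = lam_mult q a (lam_mult q b c)"
  by (simp add: lam_eq_iff algebra_simps)

lemma lam_mult_distrib:
  "lam_mult q (a + b) c = lam_mult q a c + lam_mult q b c"
  "lam_mult q a (b + c) = lam_mult q a b + lam_mult q a c"
  by (simp_all add: lam_eq_iff algebra_simps)

lemma lam_mult_one: "lam_mult q (Lam 1 0 0 0) a = a" "lam_mult q a (Lam 1 0 0 0) = a"
  by (simp_all add: lam_eq_iff)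

lemma lam_mult_zero [simp]: "lam_mult q 0 a = 0" "lam_mult q a 0 = 0"
  by (simp_all add: lam_eq_iff)

lemma lam_scale_zero [simp]: "lam_scale 0 a = 0" "lam_scale c 0 = 0"
  by (simp_all add: lam_eq_iff)

lemma ring_lam_algebra: "ring (lam_algebra q)"
proof (rule ringI)
  show "abelian_group (lam_algebra q)"
    by (rule abelian_groupI) (auto simp: lam_algebra_simps add_ac intro: exI[of _ "- _"] ab_left_minus)
  show "monoid (lam_algebra q)"
    by (rule monoidI) (simp_all add: lam_algebra_simps lam_mult_assoc lam_mult_one)
qed (simp_all add: lam_algebra_simps lam_mult_distrib)

lemma lam_eval_add: "lam_eval q (p + p') = lam_eval q p + lam_eval q p'"
  unfolding lam_eval_def by (rule linext_add) (simp_all add: lam_eq_iff algebra_simps)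

lemma lam_eval_zero [simp]: "lam_eval q 0 = 0"
  by (simp add: lam_eval_def)

lemma lam_eval_single: "lam_eval q (Poly_Mapping.single w c) = lam_scale c (lam_word q (letters w))"
  unfolding lam_eval_def by (rule linext_single) simp

lemma lam_word_append: "lam_word q (l @ l') = lam_mult q (lam_word q l) (lam_word q l')"
  by (induction l) (simp_all add: lam_mult_one lam_mult_assoc)

lemma lam_eval_mult: "lam_eval q (p * p') = lam_mult q (lam_eval q p) (lam_eval q p')"
proof (induction p rule: poly_mapping_add_induct)
  case (single w c)
  show ?case
  proof (induction p' rule: poly_mapping_add_induct)
    case (single w' c')
    show ?case
      by (simp add: mult_single lam_eval_single plus_word_def lam_word_append)
         (simp add: lam_eq_iff algebra_simps)
  qed (simp_all add: lam_eval_add distrib_left lam_mult_distrib)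
qed (simp_all add: lam_eval_add distrib_right lam_mult_distrib)

lemma lam_eval_const: "lam_eval q (free_const c) = Lam c 0 0 0"
  by (simp add: free_const_def lam_eval_single zero_word_def lam_scale_def)

lemma lam_eval_var: "lam_eval q (free_var a) = lam_gen a"
  by (cases a) (simp_all add: free_var_def lam_eval_single lam_eq_iff)

lemma lam_eval_nf: "lam_eval q (lam_nf a) = a"
  by (simp add: lam_nf_def lam_eval_add lam_eval_single lam_eq_iff)

lemma lam_eval_hom: "lam_eval q \<in> ring_hom free_ring (lam_algebra q)"
proof (rule ring_hom_memI)
  show "lam_eval q \<one>\<^bsub>free_ring\<^esub> = \<one>\<^bsub>lam_algebra q\<^esub>"
    using lam_eval_const[of q 1] by (simp add: free_const_def lam_algebra_simps)
qed (simp_all add: lam_algebra_simps lam_eval_mult lam_eval_add)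

lemma lam_nf_add: "lam_nf (a + b) = lam_nf a + lam_nf b"
  by (simp add: lam_nf_def single_add algebra_simps)

lemma Lambda_genideal: "genideal free_ring (Lambda_rels q) = {p. lam_eval q p = \<zero>\<^bsub>lam_algebra q\<^esub>}"
proof (rule genideal_eq_kernel)
  let ?I = "genideal free_ring (Lambda_rels q)"
  have I: "ideal ?I free_ring"
    by (rule ring.genideal_ideal[OF ring_free_ring]) simp
  note I' = ideal_free_ringD[OF I]
  have rel: "Lambda_rels q \<subseteq> ?I"
    by (rule ring.genideal_self[OF ring_free_ring]) simp
  let ?x = "free_var LX :: 'a free_alg" and ?y = "free_var LY :: 'a free_alg"
  let ?r = "?x * ?y + free_const q * (?y * ?x)"
  have xx: "?x * ?x \<in> ?I" and yy: "?y * ?y \<in> ?I" and r: "?r \<in> ?I"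
    using rel by (auto simp: Lambda_rels_def)
  have commute: "f * free_const c = free_const c * f" for f :: "'a free_alg" and c
  proof (induction f rule: poly_mapping_add_induct)
    case (single w b)
    then show ?case by (simp add: free_const_def mult_single mult.commute)
  qed (simp_all add: distrib_left distrib_right)
  have nf: "lam_nf a = free_const (c1 a) + free_const (cx a) * ?x + free_const (cy a) * ?y + free_const (cyx a) * (?y * ?x)"
    for a :: "'a lam"
    by (simp add: lam_nf_def free_const_def free_var_def mult_single plus_word_def zero_word_def)
  have const_mult: "free_const (c * c') = free_const c' * (free_const c :: 'a free_alg)" for c c'
    by (simp add: free_const_def mult_single mult.commute)
  have move: "?x * free_const c = free_const c * ?x" "?y * free_const c = free_const c * ?y"
    "?x * (free_const c * f) = free_const c * (?x * f)" "?y * (free_const c * f) = free_const c * (?y * f)" for c f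
    by (simp_all only: commute mult.assoc[symmetric])
  have const_zero: "free_const 0 = (0 :: 'a free_alg)" by (simp add: free_const_def)
  have const_minus: "free_const (- c) = - (free_const c :: 'a free_alg)" for c
    by (simp add: free_const_def single_uminus)
  have step: "free_var a * lam_nf m - lam_nf (lam_mult q (lam_gen a) m) \<in> ?I" for a m
  proof (cases a)
    case LX
    have "free_var a * lam_nf m - lam_nf (lam_mult q (lam_gen a) m)
      = ?x * (free_const (c1 m) + free_const (cx m) * ?x + free_const (cy m) * ?y + free_const (cyx m) * (?y * ?x))
        - (free_const (c1 m) * ?x - free_const (q * cy m) * (?y * ?x))"
      by (simp add: nf LX const_zero const_minus)
    \<comment> \<open>The word xyx is resolved by xyx = (xy + q yx) x - q y (xx) and so lies in the
      ideal; the remaining terms are multiples of the relations themselves.\<close>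
    also have "\<dots> = free_const (cx m) * (?x * ?x) + free_const (cy m) * ?r
      + free_const (cyx m) * (?r * ?x - free_const q * ?y * (?x * ?x))"
      by (simp add: const_mult move distrib_left distrib_right right_diff_distrib left_diff_distrib mult.assoc)
    finally have eq: "free_var a * lam_nf m - lam_nf (lam_mult q (lam_gen a) m) = free_const (cx m) * (?x * ?x) + free_const (cy m) * ?r
      + free_const (cyx m) * (?r * ?x + free_const (- q) * ?y * (?x * ?x))" by (simp add: const_minus)
    show ?thesis unfolding eq by (intro I'(2) I'(3)[OF xx] I'(3)[OF r] I'(3) I'(4)[OF r])
  next
    case LY
    have "free_var a * lam_nf m - lam_nf (lam_mult q (lam_gen a) m)
      = ?y * (free_const (c1 m) + free_const (cx m) * ?x + free_const (cy m) * ?y + free_const (cyx m) * (?y * ?x))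
        - (free_const (c1 m) * ?y + free_const (cx m) * (?y * ?x))"
      by (simp add: nf LY const_zero)
    also have "\<dots> = free_const (cy m) * (?y * ?y) + free_const (cyx m) * ((?y * ?y) * ?x)"
      by (simp add: move distrib_left mult.assoc)
    finally show ?thesis using I'(2) I'(3)[OF yy] I'(3)[OF I'(4)[OF yy]] by (simp only:)
  qed
  show "p - lam_nf (lam_eval q p) \<in> ?I" for p
  proof (rule presented_algebra_normal_form[OF I])
    show "lam_nf (lam_eval q (free_const c)) = free_const c" for c
      unfolding lam_eval_const by (simp add: lam_nf_def free_const_def zero_word_def)
    show "free_var a * lam_nf (lam_eval q p) - lam_nf (lam_eval q (free_var a * p)) \<in> ?I" for a p
      using step[of a "lam_eval q p"] by (simp add: lam_eval_mult lam_eval_var)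
  qed (simp_all add: lam_eval_add lam_nf_add)
  show "lam_eval q s = 0" if "s \<in> Lambda_rels q" for s
    using that by (auto simp: Lambda_rels_def lam_eval_add lam_eval_mult lam_eval_var lam_eval_const lam_eq_iff)
qed (simp_all add: ring_lam_algebra lam_eval_hom lam_algebra_simps lam_nf_def)

section \<open>Coordinates on the presented algebra and its simple module\<close>

definition lam_coords :: "'k::field \<Rightarrow> 'k free_alg set \<Rightarrow> 'k lam" where
  "lam_coords q K = the_elem (lam_eval q ` K)"

lemma lam_coords:
  shows lam_coords_iso: "lam_coords q \<in> graded_algebra_iso (Lambda q) (lam_algebra q)"
    and lam_coords_coset: "lam_coords q (genideal free_ring (Lambda_rels q) +>\<^bsub>free_ring\<^esub> p) = lam_eval q p"
    and ring_Lambda: "ring (Lambda q)"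
proof -
  have surj: "range (lam_eval q) = carrier (lam_algebra q)"
    using surjI[of "lam_eval q" lam_nf, OF lam_eval_nf] by (simp add: lam_algebra_simps)
  have sc: "scalar (lam_algebra q) c = lam_eval q (free_const c)" for c
    by (simp add: lam_eval_const lam_algebra_simps)
  have ho: "homog (lam_algebra q) n = lam_eval q ` {p. \<forall>w \<in> Poly_Mapping.keys p. length (letters w) = n}" for n
    by (simp add: lam_algebra_def)
  note P = presented_algebra_iso[OF ring_lam_algebra lam_eval_hom surj Lambda_genideal sc ho]
  show "lam_coords q \<in> graded_algebra_iso (Lambda q) (lam_algebra q)"
    using P(1) by (simp add: lam_coords_def[abs_def] Lambda_def)
  show "lam_coords q (genideal free_ring (Lambda_rels q) +>\<^bsub>free_ring\<^esub> p) = lam_eval q p"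
    using P(2) by (simp add: lam_coords_def)
  show "ring (Lambda q)"
    using P(3) by (simp add: Lambda_def)
qed

lemma Lambda_carrierE:
  assumes "r \<in> carrier (Lambda q)"
  obtains p where "r = genideal free_ring (Lambda_rels q) +>\<^bsub>free_ring\<^esub> p"
  using assms by (auto simp: Lambda_def presented_algebra_def Let_def FactRing_def A_RCOSETS_def')

lemma Lambda_scalar_closed: "scalar (Lambda q) c \<in> carrier (Lambda q)"
  by (auto simp: Lambda_def presented_algebra_def Let_def FactRing_def A_RCOSETS_def' ring.defs)

lemma lam_coords_hom:
  assumes "r \<in> carrier (Lambda q)" "s \<in> carrier (Lambda q)"
  shows "lam_coords q (r \<oplus>\<^bsub>Lambda q\<^esub> s) = lam_coords q r + lam_coords q s"
    and "lam_coords q (r \<otimes>\<^bsub>Lambda q\<^esub> s) = lam_mult q (lam_coords q r) (lam_coords q s)"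
  using ring_hom_add[OF graded_algebra_isoD(2)[OF lam_coords_iso] assms]
    ring_hom_mult[OF graded_algebra_isoD(2)[OF lam_coords_iso] assms]
  by (simp_all add: lam_algebra_simps)

lemma lam_coords_one: "lam_coords q \<one>\<^bsub>Lambda q\<^esub> = Lam 1 0 0 0"
  using ring_hom_one[OF graded_algebra_isoD(2)[OF lam_coords_iso]] by (simp add: lam_algebra_simps)

lemma lam_coords_scalar: "lam_coords q (scalar (Lambda q) c) = Lam c 0 0 0"
  using graded_algebra_isoD(4)[OF lam_coords_iso] by (simp add: lam_algebra_simps)

lemma lam_coords_bij: "bij_betw (lam_coords q) (carrier (Lambda q)) UNIV"
  using graded_algebra_isoD(3)[OF lam_coords_iso] by (simp add: lam_algebra_simps)

text \<open>The definition evaluates a chosen representative of the coset. Representatives differ by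
  elements whose coordinates all vanish, and the constant term is one of the coordinates, so the
  choice does not matter.\<close>

lemma simple_module_smult:
  fixes q :: "'k::field"
  assumes "r \<in> carrier (Lambda q)"
  shows "r \<odot>\<^bsub>simple_module\<^esub> (c :: 'k) = c1 (lam_coords q r) * c"
proof -
  let ?I = "genideal free_ring (Lambda_rels q)"
  obtain p0 where r: "r = ?I +>\<^bsub>free_ring\<^esub> p0" using assms by (rule Lambda_carrierE)
  have I: "ideal ?I free_ring"
    by (rule ring.genideal_ideal[OF ring_free_ring]) simp
  have mem: "p \<in> r \<longleftrightarrow> (\<exists>s\<in>?I. p = s + p0)" for p
    by (auto simp: r a_r_coset_def')
  have "p0 \<in> r" using ideal_free_ringD(1)[OF I] by (auto simp: mem)
  then have "(SOME p. p \<in> r) \<in> r" by (rule someI)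
  then obtain s where s: "s \<in> ?I" "(SOME p. p \<in> r) = s + p0" by (auto simp: mem)
  have "c1 (lam_word q l) = (if l = [] then 1 else 0)" for l
  proof (cases l)
    case (Cons a l')
    then show ?thesis by (cases a) simp_all
  qed simp
  then have c1: "c1 (lam_eval q p) = Poly_Mapping.lookup p 0" for p
  proof (induction p rule: poly_mapping_add_induct)
    case (single w c)
    then show ?case by (cases w) (simp add: lam_eval_single lookup_single zero_word_def when_def)
  qed (simp_all add: lam_eval_add lookup_add)
  have "lam_eval q s = 0"
    using s(1) unfolding Lambda_genideal by (simp add: lam_algebra_simps)
  then have "Poly_Mapping.lookup (SOME p. p \<in> r) 0 = c1 (lam_coords q r)"
    unfolding s(2) by (simp add: r lam_coords_coset c1[symmetric] lam_eval_add)
  then show ?thesis by (simp add: simple_module_def)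
qed

lemma simple_module_simps [simp]:
  "carrier (simple_module :: ('k::field free_alg set, 'k) module) = UNIV"
  "x \<oplus>\<^bsub>simple_module\<^esub> y = (x + y :: 'k::field)" "\<zero>\<^bsub>simple_module\<^esub> = (0 :: 'k::field)"
  by (simp_all add: simple_module_def)

lemma left_module_simple_module: "left_module (Lambda q) (simple_module :: ('k::field free_alg set, 'k) module)"
proof (rule left_module.intro)
  show "ring (Lambda q)" by (rule ring_Lambda)
  interpret ring "Lambda q" by (rule ring_Lambda)
  show "abelian_group (simple_module :: ('k free_alg set, 'k) module)"
    by (rule abelian_groupI) (auto simp: add_ac intro: exI[of _ "- _"] ab_left_minus)
  show "left_module_axioms (Lambda q) (simple_module :: ('k free_alg set, 'k) module)"
    by standard (simp_all add: simple_module_smult[of _ q] lam_coords_hom lam_coords_one algebra_simps)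
qed

section \<open>The Koszul resolution\<close>

text \<open>The free module on generators \<open>e\<^sub>i\<close> for \<open>0 \<le> i \<le> j\<close>, where \<open>e\<^sub>i\<close> is dual to the monomial
  \<open>x\<^sup>i y\<^sup>j\<^sup>-\<^sup>i\<close>. The overall sign in the differential makes the chain maps \<open>koszul_shift\<close> below free of signs.\<close>

definition koszul :: "'k::field \<Rightarrow> int \<Rightarrow> ('k free_alg set, nat \<Rightarrow> 'k lam) module" where
  "koszul q j = \<lparr>carrier = {a. \<forall>i. int i > j \<longrightarrow> a i = 0}, monoid.mult = undefined, monoid.one = undefined,
     ring.zero = (\<lambda>_. 0), ring.add = (\<lambda>a b i. a i + b i),
     module.smult = (\<lambda>r a i. lam_mult q (lam_coords q r) (a i))\<rparr>"

definition sgn_int :: "int \<Rightarrow> 'k::field" where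
  "sgn_int n = (if even n then 1 else - 1)"

text \<open>On generators e_i goes to (-1)^j (x e_(i-1) + q^i y e_i), where terms with an index out
  of range are dropped. Coefficients stand to the left of the generators, which is why x and y
  multiply them from the right.\<close>

definition koszul_diff :: "'k::field \<Rightarrow> int \<Rightarrow> (nat \<Rightarrow> 'k lam) \<Rightarrow> nat \<Rightarrow> 'k lam" where
  "koszul_diff q j = (\<lambda>a\<in>carrier (koszul q j). \<lambda>i. if int i < j
     then lam_scale (sgn_int j) (lam_mult q (a (Suc i)) (lam_gen LX) + lam_scale (q ^ i) (lam_mult q (a i) (lam_gen LY)))
     else 0)"

definition koszul_aug :: "'k::field \<Rightarrow> (nat \<Rightarrow> 'k lam) \<Rightarrow> 'k" where
  "koszul_aug q = (\<lambda>a\<in>carrier (koszul q 0). c1 (a 0))"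

lemma koszul_simps [simp]:
  "a \<in> carrier (koszul q j) \<longleftrightarrow> (\<forall>i. int i > j \<longrightarrow> a i = 0)"
  "\<zero>\<^bsub>koszul q j\<^esub> = (\<lambda>_. 0)" "a \<oplus>\<^bsub>koszul q j\<^esub> b = (\<lambda>i. a i + b i)"
  "r \<odot>\<^bsub>koszul q j\<^esub> a = (\<lambda>i. lam_mult q (lam_coords q r) (a i))"
  by (simp_all add: koszul_def)

lemma sgn_int_simps [simp]: "sgn_int n * sgn_int n = (1 :: 'k::field)" "sgn_int n * (sgn_int n * c) = (c :: 'k::field)"
  by (simp_all add: sgn_int_def)

lemma sgn_int_minus: "sgn_int (m - n) = sgn_int n * (sgn_int m :: 'k::field)"
  by (simp add: sgn_int_def)

lemma left_module_koszul: "left_module (Lambda q) (koszul q j)"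
proof (rule left_module.intro)
  show "ring (Lambda q)" by (rule ring_Lambda)
  interpret ring "Lambda q" by (rule ring_Lambda)
  show "abelian_group (koszul q j)"
  proof (rule abelian_groupI)
    fix a assume "a \<in> carrier (koszul q j)"
    then show "\<exists>b\<in>carrier (koszul q j). b \<oplus>\<^bsub>koszul q j\<^esub> a = \<zero>\<^bsub>koszul q j\<^esub>"
      by (intro bexI[of _ "\<lambda>i. - a i"]) simp_all
  qed (simp_all add: add_ac)
  show "left_module_axioms (Lambda q) (koszul q j)"
    by standard (simp_all add: lam_coords_hom lam_coords_one lam_mult_distrib lam_mult_one lam_mult_assoc)
qed

lemma koszul_a_inv: "a \<in> carrier (koszul q j) \<Longrightarrow> \<ominus>\<^bsub>koszul q j\<^esub> a = (\<lambda>i. - a i)"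
  by (rule abelian_group.minus_equality[OF left_module_abelian_group[OF left_module_koszul]]) simp_all

lemma signed_koszul: "a \<in> carrier (koszul q j) \<Longrightarrow> signed (koszul q j) n a = (\<lambda>i. lam_scale (sgn_int n) (a i))"
  by (auto simp: signed_def sgn_int_def koszul_a_inv lam_eq_iff)

text \<open>The module is visibly free on the e_i, but \<open>projective_lmod\<close> wants an index
  set inside the element type of the module. The basis vectors \<open>\<delta> i\<close> therefore
  index themselves, with \<open>\<iota>\<close> recovering i.\<close>

lemma projective_koszul: "projective_lmod (Lambda q) (koszul q j)"
proof -
  let ?R = "Lambda q"
  define \<delta> :: "nat \<Rightarrow> nat \<Rightarrow> 'a lam" where "\<delta> i = (\<lambda>l. if l = i then Lam 1 0 0 0 else 0)" for i
  have \<delta>_eq: "\<delta> i = \<delta> l \<longleftrightarrow> i = l" for i l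
  proof
    assume "\<delta> i = \<delta> l"
    then have "\<delta> i i = \<delta> l i" by simp
    then show "i = l" by (simp add: \<delta>_def lam_eq_iff split: if_splits)
  qed simp
  then have "inj \<delta>" by (auto simp: inj_def)
  define \<iota> where "\<iota> = inv_into UNIV \<delta>"
  have inv: "\<iota> (\<delta> i) = i" for i unfolding \<iota>_def by (rule inv_into_f_f[OF \<open>inj \<delta>\<close> UNIV_I])
  define I where "I = \<delta> ` {i. int i \<le> j}"
  have "finite I"
    unfolding I_def by (rule finite_imageI, rule finite_subset[of _ "{..nat j}"]) auto
  let ?\<kappa> = "inv_into (carrier ?R) (lam_coords q)"
  have bij: "bij_betw (lam_coords q) (carrier ?R) UNIV" by (rule lam_coords_bij)
  have \<kappa>: "?\<kappa> u \<in> carrier ?R" "lam_coords q (?\<kappa> u) = u" for u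
    using bij inv_into_into[of u "lam_coords q" "carrier ?R"] f_inv_into_f[of u "lam_coords q" "carrier ?R"]
    by (auto simp: bij_betw_def)
  have \<kappa>_eqI: "?\<kappa> u = r" if "r \<in> carrier ?R" "lam_coords q r = u" for u r
    using bij that by (auto simp: bij_betw_def)
  interpret R: ring ?R by (rule ring_Lambda)
  let ?s = "\<lambda>a\<in>carrier (koszul q j). (\<lambda>t\<in>I. ?\<kappa> (a (\<iota> t)))"
  let ?p = "\<lambda>c\<in>carrier (free_lmod ?R I). (\<lambda>i. if int i \<le> j then lam_coords q (c (\<delta> i)) else 0)"
  have s: "?s \<in> lmod_hom ?R (koszul q j) (free_lmod ?R I)"
  proof (rule lmod_homI[OF left_module_koszul])
    fix a b r assume a: "a \<in> carrier (koszul q j)" and b: "b \<in> carrier (koszul q j)"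
    show "(\<lambda>t\<in>I. ?\<kappa> (a (\<iota> t))) \<in> carrier (free_lmod ?R I)"
      using \<open>finite I\<close> by (simp add: \<kappa>)
    show "(\<lambda>t\<in>I. ?\<kappa> ((a \<oplus>\<^bsub>koszul q j\<^esub> b) (\<iota> t)))
      = (\<lambda>t\<in>I. ?\<kappa> (a (\<iota> t))) \<oplus>\<^bsub>free_lmod ?R I\<^esub> (\<lambda>t\<in>I. ?\<kappa> (b (\<iota> t)))"
      by (auto simp: \<kappa> lam_coords_hom intro!: restrict_ext \<kappa>_eqI)
    show "(\<lambda>t\<in>I. ?\<kappa> ((r \<odot>\<^bsub>koszul q j\<^esub> a) (\<iota> t))) = r \<odot>\<^bsub>free_lmod ?R I\<^esub> (\<lambda>t\<in>I. ?\<kappa> (a (\<iota> t)))"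
      if "r \<in> carrier ?R"
      using that by (auto simp: \<kappa> lam_coords_hom intro!: restrict_ext \<kappa>_eqI)
  qed
  have p: "?p \<in> lmod_hom ?R (free_lmod ?R I) (koszul q j)"
  proof (rule lmod_homI[OF left_module_free_lmod[OF ring_Lambda]])
    have mem: "\<delta> i \<in> I" if "int i \<le> j" for i using that by (auto simp: I_def)
    fix c c' r assume c: "c \<in> carrier (free_lmod ?R I)" and c': "c' \<in> carrier (free_lmod ?R I)"
    show "(\<lambda>i. if int i \<le> j then lam_coords q (c (\<delta> i)) else 0) \<in> carrier (koszul q j)" by simp
    show "(\<lambda>i. if int i \<le> j then lam_coords q ((c \<oplus>\<^bsub>free_lmod ?R I\<^esub> c') (\<delta> i)) else 0)
      = (\<lambda>i. if int i \<le> j then lam_coords q (c (\<delta> i)) else 0) \<oplus>\<^bsub>koszul q j\<^esub> (\<lambda>i. if int i \<le> j then lam_coords q (c' (\<delta> i)) else 0)"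
      using c c' mem by (auto simp: fun_eq_iff PiE_iff lam_coords_hom)
    show "(\<lambda>i. if int i \<le> j then lam_coords q ((r \<odot>\<^bsub>free_lmod ?R I\<^esub> c) (\<delta> i)) else 0)
      = r \<odot>\<^bsub>koszul q j\<^esub> (\<lambda>i. if int i \<le> j then lam_coords q (c (\<delta> i)) else 0)" if "r \<in> carrier ?R"
      using c that mem by (auto simp: fun_eq_iff PiE_iff lam_coords_hom)
  qed
  have "?p (?s a) = a" if a: "a \<in> carrier (koszul q j)" for a
  proof -
    have "?s a \<in> carrier (free_lmod ?R I)" using lmod_homD(1)[OF s a] .
    then have "?p (?s a) = (\<lambda>i. if int i \<le> j then lam_coords q (?s a (\<delta> i)) else 0)"
      by (simp only: restrict_apply' if_True)
    also have "\<dots> = a"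
      using a by (auto simp: fun_eq_iff I_def inv \<kappa>(2))
    finally show ?thesis .
  qed
  then show ?thesis
    unfolding projective_lmod_def using left_module_koszul s p by blast
qed

lemma koszul_diff_apply:
  "a \<in> carrier (koszul q j) \<Longrightarrow> koszul_diff q j a i = (if int i < j
     then lam_scale (sgn_int j) (lam_mult q (a (Suc i)) (lam_gen LX) + lam_scale (q ^ i) (lam_mult q (a i) (lam_gen LY)))
     else 0)"
  by (simp only: koszul_diff_def restrict_apply' if_True)

lemma koszul_diff_hom: "koszul_diff q j \<in> lmod_hom (Lambda q) (koszul q j) (koszul q (j - 1))"
  unfolding koszul_diff_def
  by (rule lmod_homI[OF left_module_koszul]) (simp_all add: fun_eq_iff lam_eq_iff algebra_simps)

lemma koszul_diff_closed:
  "a \<in> carrier (koszul q j) \<Longrightarrow> koszul_diff q j a \<in> carrier (koszul q (j - 1))"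
  by (rule lmod_homD(1)[OF koszul_diff_hom])

text \<open>Apart from terms with xx and yy, the double differential has up to sign the entries q^i
  a_(i+1) (xy + q yx) = 0; this relation is what dictates the weights q^i.\<close>

lemma koszul_diff_diff:
  assumes a: "a \<in> carrier (koszul q j)"
  shows "koszul_diff q (j - 1) (koszul_diff q j a) = (\<lambda>_. 0)"
  by (rule ext, subst koszul_diff_apply[OF koszul_diff_closed[OF a]])
     (simp add: koszul_diff_apply[OF a] lam_eq_iff algebra_simps)

text \<open>The hypotheses spell out the cycle condition in coordinates. For j = 0 the condition
  \<open>cyc\<close> is vacuous and \<open>c1\<close> describes the kernel of the augmentation, so
  one computation gives exactness in positive degrees and at the augmentation.\<close>

lemma koszul_exact:
  assumes z: "z \<in> carrier (koszul q j)" and j: "j \<ge> 0" and c1: "\<And>i. c1 (z i) = 0"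
    and cyc: "\<And>i. int i < j \<Longrightarrow> cy (z (Suc i)) = q ^ Suc i * cx (z i)"
  shows "\<exists>w\<in>carrier (koszul q (j + 1)). koszul_diff q (j + 1) w = z"
proof
  \<comment> \<open>The x- and yx-parts of z_i have to come from w_(i+1) x, which dictates the 1-
    and y-coordinates of w_(i+1). The y-part q^i c1(w_i) is then right by \<open>cyc\<close> for i >
    0, and at i = 0 it determines w_0. The overall factor cancels the sign of the
    differential.\<close>
  define w :: "nat \<Rightarrow> 'a lam" where
    "w i = lam_scale (sgn_int (j + 1)) (case i of 0 \<Rightarrow> Lam (cy (z 0)) 0 0 0 | Suc i \<Rightarrow> Lam (cx (z i)) 0 (cyx (z i)) 0)" for i
  show w: "w \<in> carrier (koszul q (j + 1))"
    using z j by (auto simp: w_def lam_eq_iff split: nat.split)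
  show "koszul_diff q (j + 1) w = z"
  proof
    fix i
    show "koszul_diff q (j + 1) w i = z i"
    proof (cases "int i < j + 1")
      case True
      have "cy (z i) = q ^ i * c1 (lam_scale (sgn_int (j + 1)) (w i))"
        using True cyc by (cases i) (simp_all add: w_def)
      then show ?thesis
        using True c1[of i] unfolding koszul_diff_apply[OF w]
        by (cases i) (simp_all add: lam_eq_iff w_def algebra_simps)
    next
      case False
      then show ?thesis using z by (simp add: koszul_diff_apply[OF w])
    qed
  qed
qed

lemma koszul_aug_apply: "a \<in> carrier (koszul q 0) \<Longrightarrow> koszul_aug q a = c1 (a 0)"
  by (simp only: koszul_aug_def restrict_apply' if_True)

lemma koszul_aug_hom: "koszul_aug q \<in> lmod_hom (Lambda q) (koszul q 0) simple_module"
  unfolding koszul_aug_def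
  by (rule lmod_homI[OF left_module_koszul]) (simp_all add: simple_module_smult)

lemma c1_koszul_diff: "a \<in> carrier (koszul q j) \<Longrightarrow> c1 (koszul_diff q j a i) = 0"
  by (simp add: koszul_diff_apply)

lemma koszul_resolution:
  "projective_resolution (Lambda q) simple_module (koszul q) (koszul_diff q) (koszul_aug q)"
  unfolding projective_resolution_def
proof (intro conjI allI impI)
  fix j :: int
  show "projective_lmod (Lambda q) (koszul q j)" by (rule projective_koszul)
  show "koszul_diff q j \<in> lmod_hom (Lambda q) (koszul q j) (koszul q (j - 1))" by (rule koszul_diff_hom)
  show "carrier (koszul q j) = {\<zero>\<^bsub>koszul q j\<^esub>}" if "j < 0"
    using that by (auto simp: fun_eq_iff)
  show "{x \<in> carrier (koszul q j). koszul_diff q j x = \<zero>\<^bsub>koszul q (j - 1)\<^esub>} = koszul_diff q (j + 1) ` carrier (koszul q (j + 1))"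
    if j: "0 < j"
  proof (intro subset_antisym subsetI)
    fix z assume "z \<in> {x \<in> carrier (koszul q j). koszul_diff q j x = \<zero>\<^bsub>koszul q (j - 1)\<^esub>}"
    then have z: "z \<in> carrier (koszul q j)" and dz: "koszul_diff q j z = (\<lambda>_. 0)" by auto
    have eq: "lam_mult q (z (Suc i)) (lam_gen LX) + lam_scale (q ^ i) (lam_mult q (z i) (lam_gen LY)) = 0" if "int i < j" for i
      using fun_cong[OF dz, of i] that by (auto simp: koszul_diff_apply[OF z] lam_eq_iff sgn_int_def split: if_splits)
    \<comment> \<open>For i > 0 this is the x-coordinate of the equation at i - 1. The y-coordinate
      at i reads q^i c1(z_i) = 0, which says nothing there if q = 0; it is used only at i = 0, where
      the weight is 1.\<close>
    have "c1 (z i) = 0" for i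
    proof (cases i)
      case 0
      then show ?thesis using eq[of 0] j by (simp add: lam_eq_iff)
    next
      case (Suc i')
      show ?thesis
      proof (cases "int i' < j")
        case True
        then show ?thesis using eq[of i'] Suc by (simp add: lam_eq_iff)
      next
        case False
        then show ?thesis using z Suc by simp
      qed
    qed
    moreover have "cy (z (Suc i)) = q ^ Suc i * cx (z i)" if "int i < j" for i
      using eq[OF that] by (simp add: lam_eq_iff algebra_simps)
    ultimately show "z \<in> koszul_diff q (j + 1) ` carrier (koszul q (j + 1))"
      using koszul_exact[OF z] j by (metis image_eqI less_imp_le)
  next
    fix z assume "z \<in> koszul_diff q (j + 1) ` carrier (koszul q (j + 1))"
    then obtain w where w: "w \<in> carrier (koszul q (j + 1))" "z = koszul_diff q (j + 1) w" by blast
    then show "z \<in> {x \<in> carrier (koszul q j). koszul_diff q j x = \<zero>\<^bsub>koszul q (j - 1)\<^esub>}"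
      using koszul_diff_closed[OF w(1)] koszul_diff_diff[OF w(1)] by simp
  qed
next
  show "koszul_aug q \<in> lmod_hom (Lambda q) (koszul q 0) simple_module" by (rule koszul_aug_hom)
  show "koszul_aug q ` carrier (koszul q 0) = carrier simple_module"
  proof -
    have "c \<in> koszul_aug q ` carrier (koszul q 0)" for c
    proof (rule image_eqI)
      show "(\<lambda>i. if i = 0 then Lam c 0 0 0 else 0) \<in> carrier (koszul q 0)" by simp
      then show "c = koszul_aug q (\<lambda>i. if i = 0 then Lam c 0 0 0 else 0)" by (simp only: koszul_aug_apply) simp
    qed
    then show ?thesis by auto
  qed
  show "{x \<in> carrier (koszul q 0). koszul_aug q x = \<zero>\<^bsub>simple_module\<^esub>} = koszul_diff q 1 ` carrier (koszul q 1)"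
  proof (intro subset_antisym subsetI)
    fix z assume "z \<in> {x \<in> carrier (koszul q 0). koszul_aug q x = \<zero>\<^bsub>simple_module\<^esub>}"
    then have z: "z \<in> carrier (koszul q 0)" and "koszul_aug q z = 0" by auto
    then have "c1 (z 0) = 0" by (simp only: koszul_aug_apply)
    then have "c1 (z i) = 0" for i using z by (cases i) simp_all
    then show "z \<in> koszul_diff q 1 ` carrier (koszul q 1)"
      using koszul_exact[OF z] by auto
  next
    fix z assume "z \<in> koszul_diff q 1 ` carrier (koszul q 1)"
    then obtain w where w: "w \<in> carrier (koszul q 1)" "z = koszul_diff q 1 w" by blast
    have z: "z \<in> carrier (koszul q 0)" using koszul_diff_closed[OF w(1)] w(2) by simp
    have "koszul_aug q z = 0" using koszul_aug_apply[OF z] c1_koszul_diff[OF w(1)] w(2) by simp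
    then show "z \<in> {x \<in> carrier (koszul q 0). koszul_aug q x = \<zero>\<^bsub>simple_module\<^esub>}"
      using z by simp
  qed
qed

text \<open>The chain endomorphism of degree \<open>m\<close> lifting the cocycle \<open>\<Sum>\<^sub>c \<gamma>\<^sub>c x\<^sup>c y\<^sup>m\<^sup>-\<^sup>c\<close>.\<close>

definition koszul_shift :: "'k::field \<Rightarrow> nat \<Rightarrow> (nat \<Rightarrow> 'k) \<Rightarrow> int \<Rightarrow> (nat \<Rightarrow> 'k lam) \<Rightarrow> nat \<Rightarrow> 'k lam" where
  "koszul_shift q m \<gamma> = (\<lambda>j. \<lambda>a\<in>carrier (koszul q j). \<lambda>i. if int i \<le> j - int m
     then \<Sum>c\<le>m. lam_scale (\<gamma> c * q ^ (c * nat (j - int m - int i))) (a (i + c)) else 0)"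

lemma koszul_shift_apply:
  "a \<in> carrier (koszul q j) \<Longrightarrow> koszul_shift q m \<gamma> j a i = (if int i \<le> j - int m
     then \<Sum>c\<le>m. lam_scale (\<gamma> c * q ^ (c * nat (j - int m - int i))) (a (i + c)) else 0)"
  by (simp only: koszul_shift_def restrict_apply' if_True)

lemma lam_sum_simps:
  "c1 (\<Sum>c\<in>A. f c) = (\<Sum>c\<in>A. c1 (f c))" "cx (\<Sum>c\<in>A. f c) = (\<Sum>c\<in>A. cx (f c))"
  "cy (\<Sum>c\<in>A. f c) = (\<Sum>c\<in>A. cy (f c))" "cyx (\<Sum>c\<in>A. f c) = (\<Sum>c\<in>A. cyx (f c))"
  by (induction A rule: infinite_finite_induct; simp)+

lemma lam_mult_scale: "lam_mult q (lam_scale c a) b = lam_scale c (lam_mult q a b)"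
  and lam_scale_add: "lam_scale c (a + b) = lam_scale c a + lam_scale c b"
  and lam_scale_scale: "lam_scale c (lam_scale c' a) = lam_scale (c * c') a"
  by (simp_all add: lam_eq_iff algebra_simps)

lemma lam_mult_sum:
  "lam_mult q a (\<Sum>c\<in>A. f c) = (\<Sum>c\<in>A. lam_mult q a (f c))"
  "lam_mult q (\<Sum>c\<in>A. f c) a = (\<Sum>c\<in>A. lam_mult q (f c) a)"
  "lam_scale b (\<Sum>c\<in>A. f c) = (\<Sum>c\<in>A. lam_scale b (f c))"
  by (induction A rule: infinite_finite_induct; simp add: lam_mult_distrib lam_scale_add)+

text \<open>The weight q^(c (j-m-i)) is that of the product of x^i y^(j-m-i) with x^c y^(m-c): the
  map is dual to right multiplication by the cocycle in the quantum plane. The sign built into the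
  differential yields (-1)^(j-m) = (-1)^m (-1)^j, as a chain map of degree m requires.\<close>

lemma koszul_shift_chain:
  "koszul_shift q m \<gamma> \<in> chain_maps (Lambda q) (koszul q) (koszul_diff q) (koszul q) (koszul_diff q) (int m)"
proof -
  have hom: "koszul_shift q m \<gamma> j \<in> lmod_hom (Lambda q) (koszul q j) (koszul q (j - int m))" for j
    unfolding koszul_shift_def
    by (rule lmod_homI[OF left_module_koszul])
       (auto simp: fun_eq_iff lam_eq_iff lam_sum_simps sum.distrib sum_subtractf sum_distrib_left algebra_simps)
  have "koszul_diff q (j - int m) (koszul_shift q m \<gamma> j a)
    = signed (koszul q (j - 1 - int m)) (int m) (koszul_shift q m \<gamma> (j - 1) (koszul_diff q j a))"
    if a: "a \<in> carrier (koszul q j)" for j a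
  proof
    fix i
    note da = koszul_diff_closed[OF a]
    have sa: "koszul_shift q m \<gamma> j a \<in> carrier (koszul q (j - int m))"
      and sda: "koszul_shift q m \<gamma> (j - 1) (koszul_diff q j a) \<in> carrier (koszul q (j - 1 - int m))"
      by (rule lmod_homD(1)[OF hom a], rule lmod_homD(1)[OF hom da])
    show "koszul_diff q (j - int m) (koszul_shift q m \<gamma> j a) i
      = signed (koszul q (j - 1 - int m)) (int m) (koszul_shift q m \<gamma> (j - 1) (koszul_diff q j a)) i"
    proof (cases "int i < j - int m")
      case False
      then show ?thesis
        by (simp add: koszul_diff_apply[OF sa] signed_koszul[OF sda] koszul_shift_apply[OF da])
    next
      case True
      define N where "N = nat (j - int m - 1 - int i)"
      have N: "nat (j - int m - (1 + int i)) = N" "nat (j - int m - int (Suc i)) = N" "nat (j - 1 - int m - int i) = N" "nat (j - int m - int i) = Suc N"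
        using True by (auto simp: N_def)
      have "koszul_diff q (j - int m) (koszul_shift q m \<gamma> j a) i
        = lam_scale (sgn_int (j - int m)) ((\<Sum>c\<le>m. lam_mult q (lam_scale (\<gamma> c * q ^ (c * N)) (a (Suc i + c))) (lam_gen LX))
          + (\<Sum>c\<le>m. lam_scale (q ^ i) (lam_mult q (lam_scale (\<gamma> c * q ^ (c * Suc N)) (a (i + c))) (lam_gen LY))))"
        using True by (simp add: koszul_diff_apply[OF sa] koszul_shift_apply[OF a] N lam_mult_sum del: lam_gen.simps)
      also have "\<dots> = lam_scale (sgn_int (int m)) (\<Sum>c\<le>m. lam_scale (\<gamma> c * q ^ (c * N)) (lam_scale (sgn_int j)
           (lam_mult q (a (Suc (i + c))) (lam_gen LX) + lam_scale (q ^ (i + c)) (lam_mult q (a (i + c)) (lam_gen LY)))))"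
        unfolding sum.distrib[symmetric] lam_mult_sum(3)
      proof (rule sum.cong[OF refl])
        fix c
        have s: "sgn_int (j - int m) = sgn_int (int m) * sgn_int j" by (rule sgn_int_minus)
        \<comment> \<open>The exponents agree by i + c (N + 1) = c N + (i + c), where N + 1 and N
          count the letters y before and after the y-part of the differential is applied.\<close>
        have "q ^ i * q ^ (c * Suc N) = q ^ (c * N) * q ^ (i + c)"
          by (simp add: power_add[symmetric] algebra_simps)
        then have "sgn_int (j - int m) * \<gamma> c * (q ^ i * q ^ (c * Suc N))
          = sgn_int (int m) * sgn_int j * \<gamma> c * (q ^ (c * N) * q ^ (i + c))"
          by (simp only: s)
        then have y: "sgn_int (j - int m) * (q ^ i * (\<gamma> c * q ^ (c * Suc N)))
          = sgn_int (int m) * (\<gamma> c * q ^ (c * N) * (sgn_int j * q ^ (i + c)))"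
          by (simp only: mult_ac)
        have x: "sgn_int (j - int m) * (\<gamma> c * q ^ (c * N)) = sgn_int (int m) * (\<gamma> c * q ^ (c * N) * sgn_int j)"
          by (simp only: s mult_ac)
        show "lam_scale (sgn_int (j - int m)) (lam_mult q (lam_scale (\<gamma> c * q ^ (c * N)) (a (Suc i + c))) (lam_gen LX)
            + lam_scale (q ^ i) (lam_mult q (lam_scale (\<gamma> c * q ^ (c * Suc N)) (a (i + c))) (lam_gen LY)))
          = lam_scale (sgn_int (int m)) (lam_scale (\<gamma> c * q ^ (c * N)) (lam_scale (sgn_int j)
           (lam_mult q (a (Suc (i + c))) (lam_gen LX) + lam_scale (q ^ (i + c)) (lam_mult q (a (i + c)) (lam_gen LY)))))"
          by (simp only: lam_mult_scale lam_scale_add lam_scale_scale x y add_Suc)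
      qed
      also have "\<dots> = lam_scale (sgn_int (int m)) (\<Sum>c\<le>m. lam_scale (\<gamma> c * q ^ (c * N)) (koszul_diff q j a (i + c)))"
      proof -
        have "koszul_diff q j a (i + c) = lam_scale (sgn_int j)
           (lam_mult q (a (Suc (i + c))) (lam_gen LX) + lam_scale (q ^ (i + c)) (lam_mult q (a (i + c)) (lam_gen LY)))"
          if "c \<le> m" for c
          using that True by (simp add: koszul_diff_apply[OF a])
        then show ?thesis by simp
      qed
      also have "\<dots> = signed (koszul q (j - 1 - int m)) (int m) (koszul_shift q m \<gamma> (j - 1) (koszul_diff q j a)) i"
        using True by (simp add: signed_koszul[OF sda] koszul_shift_apply[OF da] N)
      finally show ?thesis .
    qed
  qed
  then show ?thesis
    using hom by (simp add: chain_maps_def hom_family_def)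
qed

section \<open>Reading off cohomology classes on the Koszul resolution\<close>

definition koszul_basis :: "nat \<Rightarrow> nat \<Rightarrow> 'k::field lam" where
  "koszul_basis l = (\<lambda>i. if i = l then Lam 1 0 0 0 else 0)"

lemma koszul_basis_closed: "int l \<le> j \<Longrightarrow> koszul_basis l \<in> carrier (koszul q j)"
  by (simp add: koszul_basis_def)

text \<open>A scalar acts on the simple module through its constant coefficient, so such a map is
  determined by its values on the e_i and sees nothing else of \<open>a\<close>.\<close>

lemma koszul_hom_expansion:
  fixes q :: "'k::field"
  assumes f: "f \<in> lmod_hom (Lambda q) (koszul q j) simple_module" and a: "a \<in> carrier (koszul q j)"
  shows "f a = (\<Sum>i | int i \<le> j. c1 (a i) * f (koszul_basis i))"
proof -
  note LK = left_module_koszul[of q j]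
  have "f a = (\<Sum>i\<in>T. c1 (a i) * f (koszul_basis i))"
    if "finite T" "T \<subseteq> {i. int i \<le> j}" "a \<in> carrier (koszul q j)" "\<And>i. i \<notin> T \<Longrightarrow> a i = 0" for T a
    using that
  proof (induction T arbitrary: a)
    case empty
    then have "a = \<zero>\<^bsub>koszul q j\<^esub>" by (auto simp: fun_eq_iff)
    then show ?case using lmod_hom_zero[OF LK left_module_simple_module f] by simp
  next
    case (insert t T)
    let ?b = "\<lambda>i. if i = t then 0 else a i"
    have "a t \<in> lam_coords q ` carrier (Lambda q)"
      using lam_coords_bij[of q] by (simp add: bij_betw_def)
    then obtain r where r: "r \<in> carrier (Lambda q)" "lam_coords q r = a t"
      by auto
    have b: "?b \<in> carrier (koszul q j)" using insert.prems by simp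
    have t: "koszul_basis t \<in> carrier (koszul q j)" using insert.prems by (intro koszul_basis_closed) simp
    have rt: "r \<odot>\<^bsub>koszul q j\<^esub> koszul_basis t \<in> carrier (koszul q j)"
      by (rule left_module.smult_closed[OF LK r(1) t])
    have "a = ?b \<oplus>\<^bsub>koszul q j\<^esub> r \<odot>\<^bsub>koszul q j\<^esub> koszul_basis t"
      by (auto simp: fun_eq_iff koszul_basis_def r(2) lam_mult_one)
    then have "f a = f (?b \<oplus>\<^bsub>koszul q j\<^esub> r \<odot>\<^bsub>koszul q j\<^esub> koszul_basis t)" by (rule arg_cong)
    also have "\<dots> = f ?b + c1 (a t) * f (koszul_basis t)"
      unfolding lmod_homD(2)[OF f b rt] lmod_homD(3)[OF f r(1) t] simple_module_smult[OF r(1)] r(2) by simp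
    also have "f ?b = (\<Sum>i\<in>T. c1 (?b i) * f (koszul_basis i))"
      using insert.prems by (intro insert.IH b) auto
    also have "\<dots> = (\<Sum>i\<in>T. c1 (a i) * f (koszul_basis i))"
      by (rule sum.cong) (use insert.hyps in auto)
    finally show ?case using insert.hyps by simp
  qed
  note expansion = this
  have fin: "finite {i. int i \<le> j}"
    by (rule finite_subset[of _ "{..nat j}"]) auto
  show ?thesis
    by (rule expansion[OF fin subset_refl a]) (use a in auto)
qed

text \<open>The differential has its entries in the ideal (x, y), which acts as zero on the simple
  module.\<close>

lemma koszul_hom_diff:
  assumes f: "f \<in> lmod_hom (Lambda q) (koszul q (j - 1)) simple_module" and a: "a \<in> carrier (koszul q j)"
  shows "f (koszul_diff q j a) = 0"
  unfolding koszul_hom_expansion[OF f koszul_diff_closed[OF a]] by (simp add: c1_koszul_diff[OF a])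

lemma lcomplex_koszul: "lcomplex (Lambda q) (koszul q) (koszul_diff q)"
  by (rule projective_resolutionD(1)[OF koszul_resolution])

text \<open>Minimality of the Koszul resolution.\<close>

lemma koszul_null_homotopic_aug:
  fixes q :: "'k::field"
  assumes Q: "projective_resolution (Lambda q) simple_module Q d e"
    and F: "null_homotopic (Lambda q) (koszul q) (koszul_diff q) Q d n F" and a: "a \<in> carrier (koszul q n)"
  shows "e (F n a) = (0 :: 'k)"
proof -
  note Q' = projective_resolutionD(1)[OF Q] and e = projective_resolutionD(4)[OF Q]
  note N = left_module_simple_module[of q]
  obtain h where h: "h \<in> hom_family (Lambda q) (koszul q) Q (n - 1)" and Fh: "\<And>j x. x \<in> carrier (koszul q j) \<Longrightarrow>
      F j x = d (j - (n - 1)) (h j x) \<oplus>\<^bsub>Q (j - n)\<^esub> signed (Q (j - n)) n (h (j - 1) (koszul_diff q j x))"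
    using F unfolding null_homotopic_def by blast
  have eq: "n - (n - 1) = 1" "n - n = 0" "n - 1 - (n - 1) = 0" by simp_all
  note H = homotopyD[OF h lcomplex_koszul Q' a, unfolded eq]
  have hom: "(\<lambda>x\<in>carrier (koszul q (n - 1)). e (h (n - 1) x)) \<in> lmod_hom (Lambda q) (koszul q (n - 1)) simple_module"
    using lmod_hom_compose[OF left_module_koszul hom_familyD(1)[OF h, of "n - 1", unfolded eq] e] .
  \<comment> \<open>In the homotopy formula the term h d dies because e h is a map from K to k, and
    the term d h dies because e vanishes on boundaries.\<close>
  have "e (h (n - 1) (koszul_diff q n a)) = 0"
    using koszul_hom_diff[OF hom a] koszul_diff_closed[OF a] by (simp only: restrict_apply' if_True)
  moreover have "e (signed (Q 0) n (h (n - 1) (koszul_diff q n a))) = signed simple_module n (e (h (n - 1) (koszul_diff q n a)))"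
    by (rule lmod_hom_signed[OF lcomplexD(1)[OF Q'] N e H(3)])
  ultimately have "e (signed (Q 0) n (h (n - 1) (koszul_diff q n a))) = 0"
    using abelian_group.signed_zero[OF left_module_abelian_group[OF N]] by simp
  moreover have "e (d 1 (h n a)) = 0"
    using projective_resolutionD(8)[OF Q H(1)] by simp
  moreover have "F n a = d 1 (h n a) \<oplus>\<^bsub>Q 0\<^esub> signed (Q 0) n (h (n - 1) (koszul_diff q n a))"
    using Fh[OF a] by (simp only: eq)
  ultimately show ?thesis
    using lmod_homD(2)[OF e H(2) H(4)] by simp
qed

text \<open>The comparison maps are not canonical. They are fixed once, together with their
  compatibility with the augmentations, so that classes can be expressed through u;
  \<open>ext_comparison_exists\<close> supplies them.\<close>

locale ext_comparison =
  fixes q :: "'k::field" and P :: "int \<Rightarrow> ('k free_alg set, 'p) module" and d :: "int \<Rightarrow> 'p \<Rightarrow> 'p" and e :: "'p \<Rightarrow> 'k"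
    and u :: "int \<Rightarrow> (nat \<Rightarrow> 'k lam) \<Rightarrow> 'p" and v :: "int \<Rightarrow> 'p \<Rightarrow> nat \<Rightarrow> 'k lam"
  assumes res: "projective_resolution (Lambda q) simple_module P d e"
    and u: "u \<in> chain_maps (Lambda q) (koszul q) (koszul_diff q) P d 0"
    and eu: "\<And>a. a \<in> carrier (koszul q 0) \<Longrightarrow> e (u 0 a) = koszul_aug q a"
    and v: "v \<in> chain_maps (Lambda q) P d (koszul q) (koszul_diff q) 0"
    and ev: "\<And>x. x \<in> carrier (P 0) \<Longrightarrow> koszul_aug q (v 0 x) = e x"
begin

abbreviation "R \<equiv> Lambda q"
abbreviation "K \<equiv> koszul q"
abbreviation "dK \<equiv> koszul_diff q"

lemmas cP = projective_resolutionD(1)[OF res]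
lemmas cK = lcomplex_koszul[of q]
lemmas e_hom = projective_resolutionD(4)[OF res]
lemmas LN = left_module_simple_module[of q]

text \<open>For l up to n the value at e_l is the coefficient of x^l y^(n-l).\<close>

definition ext_class :: "nat \<Rightarrow> (int \<Rightarrow> 'p \<Rightarrow> 'p) \<Rightarrow> nat \<Rightarrow> 'k" where
  "ext_class n f l = e (f (int n) (u (int n) (koszul_basis l)))"

lemma u_closed: "a \<in> carrier (K j) \<Longrightarrow> u j a \<in> carrier (P j)"
  using chain_mapsD(3)[OF u, of a j] by simp

lemma v_closed: "x \<in> carrier (P j) \<Longrightarrow> v j x \<in> carrier (K j)"
  using chain_mapsD(3)[OF v, of x j] by simp

lemma comp_u:
  assumes "f \<in> chain_maps R P d P d n"
  shows "comp_maps K 0 f u \<in> chain_maps R K dK P d n"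
  using chain_maps_comp[OF cK cP cP assms u] by simp

lemma comp_u_apply: "a \<in> carrier (K j) \<Longrightarrow> comp_maps K 0 f u j a = f j (u j a)"
  by (simp only: comp_maps_def restrict_apply' if_True diff_zero)

lemma e_hom_of_chain_map:
  assumes F: "F \<in> chain_maps R K dK P d (int n)"
  shows "(\<lambda>a\<in>carrier (K (int n)). e (F (int n) a)) \<in> lmod_hom R (K (int n)) simple_module"
proof -
  have "F (int n) \<in> lmod_hom R (K (int n)) (P 0)"
    using chain_mapsD(2)[OF F, of "int n"] by simp
  then show ?thesis by (rule lmod_hom_compose[OF left_module_koszul _ e_hom])
qed

lemma e_expansion:
  assumes F: "F \<in> chain_maps R K dK P d (int n)" and a: "a \<in> carrier (K (int n))"
  shows "e (F (int n) a) = (\<Sum>i\<le>n. c1 (a i) * e (F (int n) (koszul_basis i)))"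
proof -
  let ?f = "\<lambda>a\<in>carrier (K (int n)). e (F (int n) a)"
  have "e (F (int n) a) = ?f a" by (simp only: restrict_apply' a if_True)
  also have "\<dots> = (\<Sum>i | int i \<le> int n. c1 (a i) * ?f (koszul_basis i))"
    by (rule koszul_hom_expansion[OF e_hom_of_chain_map[OF F] a])
  also have "\<dots> = (\<Sum>i\<le>n. c1 (a i) * e (F (int n) (koszul_basis i)))"
  proof (rule sum.cong)
    fix i assume "i \<in> {..n}"
    then have "koszul_basis i \<in> carrier (K (int n))" by (intro koszul_basis_closed) simp
    then show "c1 (a i) * ?f (koszul_basis i) = c1 (a i) * e (F (int n) (koszul_basis i))"
      by (simp only: restrict_apply' if_True)
  qed auto
  finally show ?thesis .
qed

text \<open>Both u v and the identity lift the identity of k, since u and v respect the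
  augmentations.\<close>

lemma uv_null: "null_homotopic R P d P d 0 (sub_maps P P 0 (comp_maps P 0 u v) (\<lambda>j. \<lambda>x\<in>carrier (P j). x))"
proof (rule null_homotopic_subI[OF cP projective_resolutionD(2)[OF res] LN res])
  show "comp_maps P 0 u v \<in> chain_maps R P d P d 0"
    using chain_maps_comp[OF cP cK cP u v] by simp
  show "(\<lambda>j. \<lambda>x\<in>carrier (P j). x) \<in> chain_maps R P d P d 0" by (rule identity_chain_map[OF cP])
  fix x assume x: "x \<in> carrier (P 0)"
  show "e (comp_maps P 0 u v 0 x) = e ((\<lambda>x\<in>carrier (P 0). x) x)"
    using x eu[OF v_closed[OF x]] ev[OF x] by (simp add: comp_maps_def)
qed

lemma vu_null: "null_homotopic R K dK K dK 0 (sub_maps K K 0 (comp_maps K 0 v u) (\<lambda>j. \<lambda>x\<in>carrier (K j). x))"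
proof (rule null_homotopic_subI[OF cK projective_koszul LN koszul_resolution])
  show "comp_maps K 0 v u \<in> chain_maps R K dK K dK 0"
    using chain_maps_comp[OF cK cP cK v u] by simp
  show "(\<lambda>j. \<lambda>x\<in>carrier (K j). x) \<in> chain_maps R K dK K dK 0" by (rule identity_chain_map[OF cK])
  fix a assume a: "a \<in> carrier (K 0)"
  have "comp_maps K 0 v u 0 a = v 0 (u 0 a)"
    by (simp only: comp_maps_def restrict_apply' a if_True diff_zero)
  moreover have "(\<lambda>x\<in>carrier (K 0). x) a = a" by (simp only: restrict_apply' a if_True)
  ultimately show "koszul_aug q (comp_maps K 0 v u 0 a) = koszul_aug q ((\<lambda>x\<in>carrier (K 0). x) a)"
    using ev[OF u_closed[OF a]] eu[OF a] by simp
qed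

text \<open>One direction is minimality of K. Conversely, vanishing values make f u null-homotopic
  by uniqueness of lifts, and f is recovered as f u v - f (u v - 1), where u v - 1 is
  null-homotopic.\<close>

lemma ext_class_zero_iff:
  assumes f: "f \<in> chain_maps R P d P d (int n)"
  shows "(\<forall>l\<le>n. ext_class n f l = 0) \<longleftrightarrow> null_homotopic R P d P d (int n) f"
proof
  let ?fu = "comp_maps K 0 f u"
  have fu: "?fu \<in> chain_maps R K dK P d (int n)" by (rule comp_u[OF f])
  have basis: "e (?fu (int n) (koszul_basis l)) = ext_class n f l" if "l \<le> n" for l
    using comp_u_apply[OF koszul_basis_closed[of l "int n" q], of f] that by (simp only: ext_class_def of_nat_le_iff)
  {
    assume "null_homotopic R P d P d (int n) f"
    then have "null_homotopic R K dK P d (int n) ?fu"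
      using null_homotopic_comp_right[OF cK cP cP _ u, of "int n" f] by simp
    then show "\<forall>l\<le>n. ext_class n f l = 0"
      using koszul_null_homotopic_aug[OF res] koszul_basis_closed[of _ "int n" q] basis by (metis of_nat_le_iff)
  next
    assume z: "\<forall>l\<le>n. ext_class n f l = 0"
    have "e (?fu (int n) a) = 0" if "a \<in> carrier (K (int n))" for a
      unfolding e_expansion[OF fu that] using z basis by (intro sum.neutral) simp
    then have "null_homotopic R K dK P d (int n) ?fu"
      by (intro null_homotopicI[OF cK projective_koszul res fu]) simp
    then have 1: "null_homotopic R P d P d (int n) (comp_maps P 0 ?fu v)"
      using null_homotopic_comp_right[OF cP cK cP _ v, of "int n" ?fu] by simp
    let ?D = "sub_maps P P 0 (comp_maps P 0 u v) (\<lambda>j. \<lambda>x\<in>carrier (P j). x)"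
    have 2: "null_homotopic R P d P d (int n) (comp_maps P 0 f ?D)"
      using null_homotopic_comp_left[OF cP cP cP f uv_null] by simp
    have "null_homotopic R P d P d (int n) (sub_maps P P (int n) (comp_maps P 0 ?fu v) (comp_maps P 0 f ?D))"
      unfolding sub_maps_def[of P P "int n"] by (intro null_homotopic_add[OF cP cP 1] null_homotopic_signed[OF cP cP 2])
    then show "null_homotopic R P d P d (int n) f"
    proof (rule null_homotopic_cong)
      fix j x assume x: "x \<in> carrier (P j)"
      interpret Pj: abelian_group "P (j - int n)" by (rule lcomplexD(2)[OF cP])
      have uvx: "u j (v j x) \<in> carrier (P j)" by (rule u_closed[OF v_closed[OF x]])
      have "comp_maps P 0 ?fu v j x = f j (u j (v j x))"
        using x comp_u_apply[OF v_closed[OF x]] by (simp add: comp_maps_def[of P])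
      moreover have "?D j x = u j (v j x) \<ominus>\<^bsub>P j\<^esub> x"
        using x by (subst sub_maps_apply) (simp_all add: comp_maps_def)
      then have "comp_maps P 0 f ?D j x = f j (u j (v j x)) \<ominus>\<^bsub>P (j - int n)\<^esub> f j x"
        using x lmod_hom_minus[OF lcomplexD(1)[OF cP] lcomplexD(1)[OF cP] chain_mapsD(2)[OF f] uvx x]
        by (simp only: comp_maps_def[of P 0 f] restrict_apply' if_True diff_zero)
      ultimately show "f j x = sub_maps P P (int n) (comp_maps P 0 ?fu v) (comp_maps P 0 f ?D) j x"
        using chain_mapsD(3)[OF f uvx] chain_mapsD(3)[OF f x]
        by (simp add: sub_maps_apply[where P = P, OF x] a_minus_def Pj.minus_add Pj.a_assoc[symmetric] Pj.r_neg)
    qed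
  }
qed

end

context ext_comparison
begin

lemma koszul_shift_basis:
  assumes "int i \<le> j"
  shows "c1 (koszul_shift q m \<gamma> j (koszul_basis i) l) = (if int l \<le> j - int m
     then \<Sum>c\<le>m. (if l + c = i then \<gamma> c * q ^ (c * nat (j - int m - int l)) else 0) else 0)"
  unfolding koszul_shift_apply[OF koszul_basis_closed[OF assms]]
  by (auto simp: lam_sum_simps koszul_basis_def intro!: sum.cong)

lemma koszul_shift_closed:
  assumes "a \<in> carrier (K j)"
  shows "koszul_shift q m \<gamma> j a \<in> carrier (K (j - int m))"
  by (rule chain_mapsD(3)[OF koszul_shift_chain assms])

lemma aug_koszul_shift:
  assumes "i \<le> m"
  shows "koszul_aug q (koszul_shift q m \<gamma> (int m) (koszul_basis i)) = \<gamma> i"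
proof -
  have "koszul_shift q m \<gamma> (int m) (koszul_basis i) \<in> carrier (K 0)"
    using koszul_shift_closed[OF koszul_basis_closed, of i "int m" m \<gamma>] assms by simp
  then have "koszul_aug q (koszul_shift q m \<gamma> (int m) (koszul_basis i)) = c1 (koszul_shift q m \<gamma> (int m) (koszul_basis i) 0)"
    by (rule koszul_aug_apply)
  also have "\<dots> = \<gamma> i"
    using assms by (subst koszul_shift_basis) simp_all
  finally show ?thesis .
qed

text \<open>The cocycle \<open>g\<close> and the chain map \<open>koszul_shift\<close> with the same class agree up to homotopy along \<open>u\<close>.\<close>

lemma ext_class_comp:
  assumes f: "f \<in> chain_maps R P d P d (int m)" and g: "g \<in> chain_maps R P d P d (int n)" and i: "i \<le> m + n"
  shows "ext_class (m + n) (comp_maps P (int n) f g) i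
    = (\<Sum>l\<le>m. \<Sum>c\<le>n. if l + c = i then q ^ (c * (m - l)) * ext_class m f l * ext_class n g c else 0)"
proof -
  let ?\<gamma> = "ext_class n g"
  let ?\<Xi> = "koszul_shift q n ?\<gamma>"
  let ?N = "int (m + n)"
  let ?gu = "comp_maps K 0 g u" and ?u\<Xi> = "comp_maps K (int n) u ?\<Xi>" and ?fu = "comp_maps K 0 f u"
  have N: "?N - int n = int m" "int m + int n = ?N" by simp_all
  have gu: "?gu \<in> chain_maps R K dK P d (int n)" by (rule comp_u[OF g])
  have u\<Xi>: "?u\<Xi> \<in> chain_maps R K dK P d (int n)"
    using chain_maps_comp[OF cK cK cP u koszul_shift_chain] by simp
  have fu: "?fu \<in> chain_maps R K dK P d (int m)" by (rule comp_u[OF f])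
  have "e (?gu (int n) a) = e (?u\<Xi> (int n) a)" if a: "a \<in> carrier (K (int n))" for a
  proof -
    have "e (?gu (int n) (koszul_basis l)) = e (?u\<Xi> (int n) (koszul_basis l))" if l: "l \<le> n" for l
    proof -
      have b: "koszul_basis l \<in> carrier (K (int n))" using l by (intro koszul_basis_closed) simp
      have "?\<Xi> (int n) (koszul_basis l) \<in> carrier (K 0)"
        using koszul_shift_closed[OF b, of n ?\<gamma>] by simp
      then have "e (?u\<Xi> (int n) (koszul_basis l)) = ?\<gamma> l"
        using eu aug_koszul_shift[OF l, of ?\<gamma>] by (simp only: comp_maps_def restrict_apply' b if_True diff_self)
      then show ?thesis
        by (simp only: comp_u_apply[OF b] ext_class_def)
    qed
    then show ?thesis
      unfolding e_expansion[OF gu a] e_expansion[OF u\<Xi> a] by (intro sum.cong) auto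
  qed
  then have "null_homotopic R K dK P d (int n) (sub_maps K P (int n) ?gu ?u\<Xi>)"
    by (rule null_homotopic_subI[OF cK projective_koszul LN res gu u\<Xi>])
  \<comment> \<open>Composed with f, the difference of g u and u \<Xi> is still null-homotopic, so
    minimality of K makes its augmentation vanish. This turns a homotopy into an equality of
    values.\<close>
  from null_homotopic_comp_left[OF cK cP cP f this]
  have null: "null_homotopic R K dK P d ?N (comp_maps K (int n) f (sub_maps K P (int n) ?gu ?u\<Xi>))"
    by (simp only: N)
  let ?b = "koszul_basis i :: nat \<Rightarrow> 'k lam"
  have b: "?b \<in> carrier (K ?N)" using i by (intro koszul_basis_closed) simp
  have \<Xi>b: "?\<Xi> ?N ?b \<in> carrier (K (int m))" using koszul_shift_closed[OF b, of n ?\<gamma>] by (simp only: N)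
  have ub: "u ?N ?b \<in> carrier (P ?N)" by (rule u_closed[OF b])
  have gub: "g ?N (u ?N ?b) \<in> carrier (P (int m))" using chain_mapsD(3)[OF g ub] by (simp only: N)
  have u\<Xi>b: "u (int m) (?\<Xi> ?N ?b) \<in> carrier (P (int m))" by (rule u_closed[OF \<Xi>b])
  have fP: "f (int m) x \<in> carrier (P 0)" if "x \<in> carrier (P (int m))" for x
    using chain_mapsD(3)[OF f that] by simp
  have "e (f (int m) (g ?N (u ?N ?b) \<ominus>\<^bsub>P (int m)\<^esub> u (int m) (?\<Xi> ?N ?b))) = 0"
  proof -
    have "sub_maps K P (int n) ?gu ?u\<Xi> ?N ?b = ?gu ?N ?b \<ominus>\<^bsub>P (?N - int n)\<^esub> ?u\<Xi> ?N ?b"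
      by (rule sub_maps_apply[where P = K, OF b])
    also have "?gu ?N ?b = g ?N (u ?N ?b)" by (rule comp_u_apply[OF b])
    also have "?u\<Xi> ?N ?b = u (int m) (?\<Xi> ?N ?b)"
      by (simp only: comp_maps_def restrict_apply' b if_True N)
    finally have "sub_maps K P (int n) ?gu ?u\<Xi> ?N ?b = g ?N (u ?N ?b) \<ominus>\<^bsub>P (int m)\<^esub> u (int m) (?\<Xi> ?N ?b)"
      by (simp only: N)
    moreover have "comp_maps K (int n) f (sub_maps K P (int n) ?gu ?u\<Xi>) ?N ?b = f (int m) (sub_maps K P (int n) ?gu ?u\<Xi> ?N ?b)"
      by (simp only: comp_maps_def[of K "int n" f] restrict_apply' b if_True N)
    ultimately show ?thesis
      using koszul_null_homotopic_aug[OF res null b] by simp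
  qed
  moreover have "f (int m) (g ?N (u ?N ?b) \<ominus>\<^bsub>P (int m)\<^esub> u (int m) (?\<Xi> ?N ?b))
    = f (int m) (g ?N (u ?N ?b)) \<ominus>\<^bsub>P 0\<^esub> f (int m) (u (int m) (?\<Xi> ?N ?b))"
    using lmod_hom_minus[OF lcomplexD(1)[OF cP] lcomplexD(1)[OF cP] chain_mapsD(2)[OF f] gub u\<Xi>b] by simp
  moreover have "e (f (int m) (g ?N (u ?N ?b)) \<ominus>\<^bsub>P 0\<^esub> f (int m) (u (int m) (?\<Xi> ?N ?b)))
    = e (f (int m) (g ?N (u ?N ?b))) \<ominus>\<^bsub>simple_module\<^esub> e (f (int m) (u (int m) (?\<Xi> ?N ?b)))"
    by (rule lmod_hom_minus[OF lcomplexD(1)[OF cP] LN e_hom fP[OF gub] fP[OF u\<Xi>b]])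
  moreover have "x \<ominus>\<^bsub>simple_module\<^esub> y = 0 \<longleftrightarrow> x = y" for x y :: 'k
  proof -
    interpret N: abelian_group "simple_module :: ('k free_alg set, 'k) module"
      by (rule left_module_abelian_group[OF LN])
    show ?thesis
      using N.sum_zero_iff[of x "\<ominus>\<^bsub>simple_module\<^esub> y"] by (simp add: a_minus_def)
  qed
  ultimately have "e (f (int m) (g ?N (u ?N ?b))) = e (f (int m) (u (int m) (?\<Xi> ?N ?b)))" by simp
  moreover have "ext_class (m + n) (comp_maps P (int n) f g) i = e (f (int m) (g ?N (u ?N ?b)))"
    by (simp only: ext_class_def comp_maps_def restrict_apply' ub if_True N)
  moreover have "e (f (int m) (u (int m) (?\<Xi> ?N ?b))) = e (?fu (int m) (?\<Xi> ?N ?b))"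
    by (simp only: comp_u_apply[OF \<Xi>b])
  ultimately have "ext_class (m + n) (comp_maps P (int n) f g) i = e (?fu (int m) (?\<Xi> ?N ?b))" by simp
  also have "\<dots> = (\<Sum>l\<le>m. c1 (?\<Xi> ?N ?b l) * e (?fu (int m) (koszul_basis l)))"
    by (rule e_expansion[OF fu \<Xi>b])
  also have "\<dots> = (\<Sum>l\<le>m. \<Sum>c\<le>n. if l + c = i then q ^ (c * (m - l)) * ext_class m f l * ?\<gamma> c else 0)"
  proof (rule sum.cong[OF refl])
    fix l assume "l \<in> {..m}"
    then have l: "l \<le> m" by simp
    have bl: "koszul_basis l \<in> carrier (K (int m))" using l by (intro koszul_basis_closed) simp
    have fl: "e (?fu (int m) (koszul_basis l)) = ext_class m f l"
      by (simp only: comp_u_apply[OF bl] ext_class_def)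
    have nat: "nat (?N - int n - int l) = m - l" using l by simp
    \<comment> \<open>The component of the shifted generator at e_l picks the index c with l + c =
      i. Its weight q^(c (m-l)) is the cost of moving the m - l letters y belonging to f past the c
      letters x belonging to g.\<close>
    have "c1 (?\<Xi> ?N ?b l) = (\<Sum>c\<le>n. if l + c = i then ?\<gamma> c * q ^ (c * (m - l)) else 0)"
      using l i by (subst koszul_shift_basis) (simp_all only: nat, simp_all)
    then show "c1 (?\<Xi> ?N ?b l) * e (?fu (int m) (koszul_basis l))
      = (\<Sum>c\<le>n. if l + c = i then q ^ (c * (m - l)) * ext_class m f l * ?\<gamma> c else 0)"
      by (simp add: fl sum_distrib_right) (auto intro!: sum.cong simp: mult_ac)
  qed
  finally show ?thesis .
qed

text \<open>The cocycle is u \<Xi> v, the explicit chain map of K carried over to P. Its values are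
  those of \<Xi>, because v u is homotopic to the identity and homotopic maps on K have equal
  augmentations.\<close>

lemma ext_class_surj:
  fixes \<gamma> :: "nat \<Rightarrow> 'k"
  shows "\<exists>f\<in>chain_maps R P d P d (int n). \<forall>l\<le>n. ext_class n f l = \<gamma> l"
proof
  let ?\<Xi> = "koszul_shift q n \<gamma>"
  let ?\<Xi>v = "comp_maps P 0 ?\<Xi> v"
  let ?f = "comp_maps P (int n) u ?\<Xi>v"
  have \<Xi>v: "?\<Xi>v \<in> chain_maps R P d K dK (int n)"
    using chain_maps_comp[OF cP cK cK koszul_shift_chain v] by simp
  show "?f \<in> chain_maps R P d P d (int n)"
    using chain_maps_comp[OF cP cK cP u \<Xi>v] by simp
  show "\<forall>l\<le>n. ext_class n ?f l = \<gamma> l"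
  proof (intro allI impI)
    fix l assume l: "l \<le> n"
    let ?b = "koszul_basis l :: nat \<Rightarrow> 'k lam"
    have b: "?b \<in> carrier (K (int n))" using l by (intro koszul_basis_closed) simp
    have ub: "u (int n) ?b \<in> carrier (P (int n))" by (rule u_closed[OF b])
    have vub: "v (int n) (u (int n) ?b) \<in> carrier (K (int n))" by (rule v_closed[OF ub])
    have \<Xi>K: "?\<Xi> (int n) a \<in> carrier (K 0)" if "a \<in> carrier (K (int n))" for a
      using koszul_shift_closed[OF that, of n \<gamma>] by simp
    let ?D = "sub_maps K K 0 (comp_maps K 0 v u) (\<lambda>j. \<lambda>x\<in>carrier (K j). x)"
    have "null_homotopic R K dK K dK (int n) (comp_maps K 0 ?\<Xi> ?D)"
      using null_homotopic_comp_left[OF cK cK cK koszul_shift_chain vu_null] by simp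
    then have "koszul_aug q (comp_maps K 0 ?\<Xi> ?D (int n) ?b) = 0"
      by (rule koszul_null_homotopic_aug[OF koszul_resolution _ b])
    moreover have "comp_maps K 0 ?\<Xi> ?D (int n) ?b = ?\<Xi> (int n) (v (int n) (u (int n) ?b)) \<ominus>\<^bsub>K 0\<^esub> ?\<Xi> (int n) ?b"
    proof -
      have "?D (int n) ?b = v (int n) (u (int n) ?b) \<ominus>\<^bsub>K (int n)\<^esub> ?b"
        unfolding sub_maps_apply[where P = K, OF b] by (simp only: comp_maps_def restrict_apply' b if_True diff_zero)
      then have "comp_maps K 0 ?\<Xi> ?D (int n) ?b = ?\<Xi> (int n) (v (int n) (u (int n) ?b) \<ominus>\<^bsub>K (int n)\<^esub> ?b)"
        by (simp only: comp_maps_def[of K 0 "?\<Xi>"] restrict_apply' b if_True diff_zero)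
      then show ?thesis
        using lmod_hom_minus[OF left_module_koszul left_module_koszul chain_mapsD(2)[OF koszul_shift_chain] vub b, of n \<gamma>]
        by (simp only: diff_self)
    qed
    moreover have "koszul_aug q (?\<Xi> (int n) (v (int n) (u (int n) ?b)) \<ominus>\<^bsub>K 0\<^esub> ?\<Xi> (int n) ?b)
      = koszul_aug q (?\<Xi> (int n) (v (int n) (u (int n) ?b))) \<ominus>\<^bsub>simple_module\<^esub> koszul_aug q (?\<Xi> (int n) ?b)"
      by (rule lmod_hom_minus[OF left_module_koszul LN koszul_aug_hom \<Xi>K[OF vub] \<Xi>K[OF b]])
    moreover have "x \<ominus>\<^bsub>simple_module\<^esub> y = 0 \<longleftrightarrow> x = y" for x y :: 'k
    proof -
      interpret N: abelian_group "simple_module :: ('k free_alg set, 'k) module"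
        by (rule left_module_abelian_group[OF LN])
      show ?thesis
        using N.sum_zero_iff[of x "\<ominus>\<^bsub>simple_module\<^esub> y"] by (simp add: a_minus_def)
    qed
    ultimately have "koszul_aug q (?\<Xi> (int n) (v (int n) (u (int n) ?b))) = \<gamma> l"
      using aug_koszul_shift[OF l, of \<gamma>] by simp
    moreover have "ext_class n ?f l = e (u 0 (?\<Xi> (int n) (v (int n) (u (int n) ?b))))"
      by (simp only: ext_class_def comp_maps_def restrict_apply' ub if_True diff_zero diff_self)
    ultimately show "ext_class n ?f l = \<gamma> l"
      using eu[OF \<Xi>K[OF vub]] by simp
  qed
qed

lemma ext_class_zero_map: "l \<le> n \<Longrightarrow> ext_class n (zero_map P (int n)) l = 0"
  using ext_class_zero_iff[OF zero_map_chain[OF cP]] null_homotopic_zero[OF cP] by blast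

lemma ext_class_add:
  assumes "f \<in> chain_maps R P d P d (int n)" "g \<in> chain_maps R P d P d (int n)" "l \<le> n"
  shows "ext_class n (add_maps P P (int n) f g) l = ext_class n f l + ext_class n g l"
proof -
  have ub: "u (int n) (koszul_basis l) \<in> carrier (P (int n))"
    using assms(3) by (intro u_closed koszul_basis_closed) simp
  have "f (int n) (u (int n) (koszul_basis l)) \<in> carrier (P 0)" "g (int n) (u (int n) (koszul_basis l)) \<in> carrier (P 0)"
    using chain_mapsD(3)[OF assms(1) ub] chain_mapsD(3)[OF assms(2) ub] by simp_all
  note lmod_homD(2)[OF e_hom this]
  then show ?thesis
    by (simp only: ext_class_def add_maps_def restrict_apply' ub if_True diff_self simple_module_simps)
qed

section \<open>The isomorphism of the Ext algebra with the model\<close>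

abbreviation "C \<equiv> cocycle_ring R P d"
abbreviation "B \<equiv> coboundary_ideal R P d"

definition ext_to_model :: "(nat \<Rightarrow> int \<Rightarrow> 'p \<Rightarrow> 'p) \<Rightarrow> 'k bipoly" where
  "ext_to_model F = Abs_poly_mapping (\<lambda>(i, j). ext_class (i + j) (F (i + j)) i)"

lemma lookup_ext_to_model:
  assumes "F \<in> carrier C"
  shows "Poly_Mapping.lookup (ext_to_model F) (i, j) = ext_class (i + j) (F (i + j)) i"
proof -
  \<comment> \<open>A nonzero component in degree n contributes only exponents (i, j) with i + j =
    n, which lie in a finite square. This gives the finite support without which
    \<open>Abs_poly_mapping\<close> has no known values.\<close>
  let ?S = "{n. F n \<noteq> zero_map P (int n)}"
  have "finite (\<Union>n\<in>?S. {..n} \<times> {..n})"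
    using assms by (simp add: cocycle_ring_carrier[OF cP])
  moreover have "{s. (\<lambda>(i, j). ext_class (i + j) (F (i + j)) i) s \<noteq> 0} \<subseteq> (\<Union>n\<in>?S. {..n} \<times> {..n})"
  proof
    fix s assume s: "s \<in> {s. (\<lambda>(i, j). ext_class (i + j) (F (i + j)) i) s \<noteq> 0}"
    obtain i j where ij: "s = (i, j)" by (cases s)
    have "F (i + j) \<noteq> zero_map P (int (i + j))"
      using s ext_class_zero_map[of i "i + j"] by (auto simp: ij)
    then show "s \<in> (\<Union>n\<in>?S. {..n} \<times> {..n})" by (auto simp: ij intro!: exI[of _ "i + j"])
  qed
  ultimately have "finite {s. (\<lambda>(i, j). ext_class (i + j) (F (i + j)) i) s \<noteq> 0}" by (rule finite_subset[rotated])
  then show ?thesis by (simp add: ext_to_model_def)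
qed

lemma e_finsum:
  assumes "finite A" "a \<in> A \<rightarrow> carrier (P 0)"
  shows "e (\<Oplus>\<^bsub>P 0\<^esub>i\<in>A. a i) = (\<Sum>i\<in>A. e (a i))"
  using assms
proof (induction A)
  case empty
  interpret P0: abelian_group "P 0" by (rule lcomplexD(2)[OF cP])
  show ?case using lmod_hom_zero[OF lcomplexD(1)[OF cP] LN e_hom] by simp
next
  case (insert i A)
  interpret P0: abelian_group "P 0" by (rule lcomplexD(2)[OF cP])
  have a: "a \<in> A \<rightarrow> carrier (P 0)" "a i \<in> carrier (P 0)" using insert.prems by auto
  show ?case
    using insert a lmod_homD(2)[OF e_hom a(2) P0.finsum_closed[OF a(1)]] by simp
qed

lemma ext_to_model_mult:
  assumes F: "F \<in> carrier C" and G: "G \<in> carrier C"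
  shows "ext_to_model (F \<otimes>\<^bsub>C\<^esub> G) = qmult q (ext_to_model F) (ext_to_model G)"
proof (rule poly_mapping_eqI)
  fix s :: "nat \<times> nat"
  obtain i j where s: "s = (i, j)" by (cases s)
  let ?n = "i + j"
  let ?b = "u (int ?n) (koszul_basis i)"
  have b: "?b \<in> carrier (P (int ?n))" by (intro u_closed koszul_basis_closed) simp
  let ?h = "\<lambda>a. comp_maps P (int (?n - a)) (F a) (G (?n - a))"
  have h: "?h a (int ?n) ?b \<in> carrier (P 0)" if "a \<le> ?n" for a
    using chain_mapsD(3)[OF cocycle_ring_comp[OF cP F G that] b] by simp
  let ?t = "\<lambda>a l c. q ^ (c * (a - l)) * ext_class a (F a) l * ext_class (?n - a) (G (?n - a)) c"
  have "Poly_Mapping.lookup (ext_to_model (F \<otimes>\<^bsub>C\<^esub> G)) (i, j) = e ((F \<otimes>\<^bsub>C\<^esub> G) ?n (int ?n) ?b)"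
    by (simp only: lookup_ext_to_model[OF cocycle_ring_mult_closed[OF cP F G]] ext_class_def)
  also have "(F \<otimes>\<^bsub>C\<^esub> G) ?n (int ?n) ?b = (\<Oplus>\<^bsub>P 0\<^esub>a\<in>{..?n}. ?h a (int ?n) ?b)"
    unfolding cocycle_ring_mult_eq[OF cP] sum_maps_def by (simp only: restrict_apply' b if_True diff_self)
  also have "e \<dots> = (\<Sum>a\<le>?n. e (?h a (int ?n) ?b))"
    by (rule e_finsum) (use h in auto)
  also have "\<dots> = (\<Sum>a\<le>?n. \<Sum>l\<le>a. \<Sum>c\<le>?n - a. if l + c = i then ?t a l c else 0)"
  proof (rule sum.cong[OF refl])
    fix a assume "a \<in> {..?n}"
    then have a: "a + (?n - a) = ?n" by simp
    have "e (?h a (int ?n) ?b) = ext_class (a + (?n - a)) (?h a) i" by (simp only: ext_class_def a)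
    also have "\<dots> = (\<Sum>l\<le>a. \<Sum>c\<le>?n - a. if l + c = i then ?t a l c else 0)"
      by (rule ext_class_comp[OF cocycle_ring_closed(1)[OF cP F] cocycle_ring_closed(1)[OF cP G]]) (simp only: a)
    finally show "e (?h a (int ?n) ?b) = (\<Sum>l\<le>a. \<Sum>c\<le>?n - a. if l + c = i then ?t a l c else 0)" .
  qed
  also have "\<dots> = (\<Sum>(a, l, c)\<in>(SIGMA a:{..?n}. {..a} \<times> {..?n - a}). if l + c = i then ?t a l c else 0)"
    by (simp add: sum.Sigma sum.cartesian_product split_def)
  also have "\<dots> = (\<Sum>(a, l, c)\<in>{(a, l, c). a \<le> ?n \<and> l \<le> a \<and> c \<le> ?n - a \<and> l + c = i}. ?t a l c)"
    by (rule sum.mono_neutral_cong_right) (auto split: if_splits)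
  \<comment> \<open>A triple (a, l, c) with l + c = i is determined by the exponents (c, i + j - a -
    c) of the right factor, the left factor having exponents (l, a - l). This is the indexing of
    \<open>lookup_qmult\<close>.\<close>
  also have "\<dots> = (\<Sum>(c, l)\<in>{..i} \<times> {..j}. q ^ (c * (j - l)) * Poly_Mapping.lookup (ext_to_model F) (i - c, j - l) * Poly_Mapping.lookup (ext_to_model G) (c, l))"
    by (rule sum.reindex_bij_witness[where i = "\<lambda>(c, l). (i - c + (j - l), i - c, c)" and j = "\<lambda>(a, l, c). (c, ?n - a - c)"])
       (auto simp: lookup_ext_to_model[OF F] lookup_ext_to_model[OF G] add_ac)
  also have "\<dots> = Poly_Mapping.lookup (qmult q (ext_to_model F) (ext_to_model G)) (i, j)"
    by (simp add: lookup_qmult sum.cartesian_product)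
  finally show "Poly_Mapping.lookup (ext_to_model (F \<otimes>\<^bsub>C\<^esub> G)) s = Poly_Mapping.lookup (qmult q (ext_to_model F) (ext_to_model G)) s"
    by (simp only: s)
qed

lemma ext_to_model_add:
  assumes F: "F \<in> carrier C" and G: "G \<in> carrier C"
  shows "ext_to_model (F \<oplus>\<^bsub>C\<^esub> G) = ext_to_model F + ext_to_model G"
proof (rule poly_mapping_eqI)
  fix s :: "nat \<times> nat"
  obtain i j where s: "s = (i, j)" by (cases s)
  have "ext_class (i + j) ((F \<oplus>\<^bsub>C\<^esub> G) (i + j)) i = ext_class (i + j) (F (i + j)) i + ext_class (i + j) (G (i + j)) i"
    unfolding cocycle_ring_simps[OF cP]
    by (rule ext_class_add[OF cocycle_ring_closed(1)[OF cP F] cocycle_ring_closed(1)[OF cP G]]) simp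
  then show "Poly_Mapping.lookup (ext_to_model (F \<oplus>\<^bsub>C\<^esub> G)) s = Poly_Mapping.lookup (ext_to_model F + ext_to_model G) s"
    by (simp only: s lookup_add lookup_ext_to_model[OF F] lookup_ext_to_model[OF G] lookup_ext_to_model[OF cocycle_ring_add_closed[OF cP F G]])
qed

definition ext_scalar :: "'k \<Rightarrow> nat \<Rightarrow> int \<Rightarrow> 'p \<Rightarrow> 'p" where
  "ext_scalar c = (\<lambda>n j. \<lambda>x \<in> carrier (P j). if n = 0 then scalar R c \<odot>\<^bsub>P j\<^esub> x else \<zero>\<^bsub>P (j - int n)\<^esub>)"

lemma ext_scalar_eq:
  "ext_scalar c n = (if n = 0 then (\<lambda>j. \<lambda>x\<in>carrier (P j). scalar R c \<odot>\<^bsub>P j\<^esub> x) else zero_map P (int n))"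
  by (simp add: ext_scalar_def zero_map_def)

text \<open>Multiplication by a scalar has to commute with the action of the algebra in order to be
  an endomorphism of the resolution.\<close>

lemma scalar_central:
  assumes r: "r \<in> carrier R"
  shows "scalar R c \<otimes>\<^bsub>R\<^esub> r = r \<otimes>\<^bsub>R\<^esub> scalar R c"
proof -
  interpret ring R by (rule ring_Lambda)
  note s = Lambda_scalar_closed[of q c]
  have "lam_coords q (scalar R c \<otimes>\<^bsub>R\<^esub> r) = lam_coords q (r \<otimes>\<^bsub>R\<^esub> scalar R c)"
    unfolding lam_coords_hom(2)[OF s r] lam_coords_hom(2)[OF r s] lam_coords_scalar
    by (simp add: lam_eq_iff mult.commute)
  moreover have "inj_on (lam_coords q) (carrier R)" using lam_coords_bij by (rule bij_betw_imp_inj_on)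
  ultimately show ?thesis using r s by (auto dest: inj_onD)
qed

lemma ext_scalar_closed: "ext_scalar c \<in> carrier C"
proof -
  note s = Lambda_scalar_closed[of q c]
  have hom: "(\<lambda>x\<in>carrier (P j). scalar R c \<odot>\<^bsub>P j\<^esub> x) \<in> lmod_hom R (P j) (P j)" for j
  proof -
    interpret Pj: left_module R "P j" by (rule lcomplexD(1)[OF cP])
    show ?thesis
    proof (rule lmod_homI[OF lcomplexD(1)[OF cP]])
      fix r x assume r: "r \<in> carrier R" and x: "x \<in> carrier (P j)"
      show "scalar R c \<odot>\<^bsub>P j\<^esub> (r \<odot>\<^bsub>P j\<^esub> x) = r \<odot>\<^bsub>P j\<^esub> (scalar R c \<odot>\<^bsub>P j\<^esub> x)"
        unfolding Pj.smult_assoc1[OF s r x, symmetric] Pj.smult_assoc1[OF r s x, symmetric] scalar_central[OF r] ..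
    qed (simp_all add: s Pj.smult_closed Pj.smult_r_distr)
  qed
  have "(\<lambda>j. \<lambda>x\<in>carrier (P j). scalar R c \<odot>\<^bsub>P j\<^esub> x) \<in> chain_maps R P d P d 0"
  proof -
    have "scalar R c \<odot>\<^bsub>P j\<^esub> x \<in> carrier (P j)" if "x \<in> carrier (P j)" for j x
      by (rule left_module.smult_closed[OF lcomplexD(1)[OF cP] s that])
    then show ?thesis
      using hom lmod_homD(3)[OF lcomplexD(3)[OF cP] s] lcomplexD(4)[OF cP]
      by (simp add: chain_maps_def hom_family_def signed_def)
  qed
  then have "ext_scalar c n \<in> chain_maps R P d P d (int n)" for n
    by (simp add: ext_scalar_eq zero_map_chain[OF cP])
  moreover have "finite {n. ext_scalar c n \<noteq> zero_map P (int n)}"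
    by (rule finite_subset[of _ "{0}"]) (auto simp: ext_scalar_eq)
  ultimately show ?thesis by (simp add: cocycle_ring_carrier[OF cP])
qed

lemma ext_to_model_scalar: "ext_to_model (ext_scalar c) = Poly_Mapping.single (0, 0) c"
proof (rule poly_mapping_eqI)
  fix s :: "nat \<times> nat"
  obtain i j where s: "s = (i, j)" by (cases s)
  have b: "koszul_basis 0 \<in> carrier (K 0)" by (intro koszul_basis_closed) simp
  have ub: "u 0 (koszul_basis 0) \<in> carrier (P 0)" by (rule u_closed[OF b])
  have "ext_class 0 (ext_scalar c 0) 0 = e (scalar R c \<odot>\<^bsub>P 0\<^esub> u 0 (koszul_basis 0))"
    using ub by (simp add: ext_class_def ext_scalar_eq)
  also have "\<dots> = c * e (u 0 (koszul_basis 0))"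
    unfolding lmod_homD(3)[OF e_hom Lambda_scalar_closed ub] simple_module_smult[OF Lambda_scalar_closed] lam_coords_scalar by simp
  also have "e (u 0 (koszul_basis 0)) = 1"
    unfolding eu[OF b] koszul_aug_apply[OF b] by (simp add: koszul_basis_def)
  finally have zero: "ext_class 0 (ext_scalar c 0) 0 = c" by simp
  show "Poly_Mapping.lookup (ext_to_model (ext_scalar c)) s = Poly_Mapping.lookup (Poly_Mapping.single (0, 0) c) s"
  proof (cases "i + j = 0")
    case True
    then show ?thesis by (simp add: s lookup_ext_to_model[OF ext_scalar_closed] zero)
  next
    case False
    then have "ext_scalar c (i + j) = zero_map P (int (i + j))" by (simp only: ext_scalar_eq if_False)
    then have "ext_class (i + j) (ext_scalar c (i + j)) i = 0"
      using ext_class_zero_map[of i "i + j"] by (simp only: le_add1)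
    then show ?thesis
      using False by (auto simp: s lookup_ext_to_model[OF ext_scalar_closed] lookup_single when_def)
  qed
qed

lemma ext_to_model_one: "ext_to_model \<one>\<^bsub>C\<^esub> = Poly_Mapping.single (0, 0) 1"
proof -
  have "scalar R 1 = \<one>\<^bsub>R\<^esub>"
  proof -
    have "lam_coords q (scalar R 1) = lam_coords q \<one>\<^bsub>R\<^esub>" by (simp only: lam_coords_scalar lam_coords_one)
    moreover have "inj_on (lam_coords q) (carrier R)" using lam_coords_bij by (rule bij_betw_imp_inj_on)
    ultimately show ?thesis
      using Lambda_scalar_closed ring.ring_simprules(6)[OF ring_Lambda] by (auto dest: inj_onD)
  qed
  then have "\<one>\<^bsub>C\<^esub> = ext_scalar 1"
    unfolding cocycle_ring_simps[OF cP] ext_scalar_def restrict_family_eq_iff fun_eq_iff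
    using left_module.smult_one[OF lcomplexD(1)[OF cP]] by (auto simp: restrict_def)
  then show ?thesis by (simp only: ext_to_model_scalar)
qed

text \<open>Beyond surjectivity, the preimage is exactly zero in every degree where g has no term.
  Homogeneous parts of the Ext algebra are defined by representatives that vanish on the nose
  outside one degree, so being a coboundary there would not do.\<close>

lemma ext_to_model_lift:
  shows "\<exists>F\<in>carrier C. ext_to_model F = g \<and>
    (\<forall>n. (\<forall>i\<le>n. Poly_Mapping.lookup g (i, n - i) = 0) \<longrightarrow> F n = zero_map P (int n))"
proof -
  let ?\<gamma> = "\<lambda>n i. Poly_Mapping.lookup g (i, n - i)"
  have "\<forall>n. \<exists>f. f \<in> chain_maps R P d P d (int n) \<and> (\<forall>l\<le>n. ext_class n f l = ?\<gamma> n l)"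
    using ext_class_surj unfolding Bex_def by (rule allI)
  from choice[OF this] obtain f where "\<forall>n. f n \<in> chain_maps R P d P d (int n) \<and> (\<forall>l\<le>n. ext_class n (f n) l = ?\<gamma> n l)"
    by (rule exE)
  then have f: "\<And>n. f n \<in> chain_maps R P d P d (int n)" "\<And>n l. l \<le> n \<Longrightarrow> ext_class n (f n) l = ?\<gamma> n l"
    by simp_all
  \<comment> \<open>Resetting to the zero map where all coefficients vanish leaves the class
    unchanged and makes the support finite.\<close>
  define F where "F n = (if \<forall>i\<le>n. ?\<gamma> n i = 0 then zero_map P (int n) else f n)" for n
  have coeff: "ext_class n (F n) l = ?\<gamma> n l" if "l \<le> n" for n l
    using that by (simp add: F_def ext_class_zero_map f(2))
  have "{n. F n \<noteq> zero_map P (int n)} \<subseteq> (\<lambda>(i, j). i + j) ` Poly_Mapping.keys g"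
  proof
    fix n assume "n \<in> {n. F n \<noteq> zero_map P (int n)}"
    then obtain i where "i \<le> n" "?\<gamma> n i \<noteq> 0" by (auto simp: F_def split: if_splits)
    then show "n \<in> (\<lambda>(i, j). i + j) ` Poly_Mapping.keys g"
      by (intro image_eqI[of _ _ "(i, n - i)"]) (auto simp: in_keys_iff)
  qed
  then have "finite {n. F n \<noteq> zero_map P (int n)}" by (rule finite_subset) simp
  then have F: "F \<in> carrier C"
    using f(1) zero_map_chain[OF cP] by (simp add: cocycle_ring_carrier[OF cP] F_def)
  have "ext_to_model F = g"
  proof (rule poly_mapping_eqI)
    fix s :: "nat \<times> nat"
    obtain i j where s: "s = (i, j)" by (cases s)
    show "Poly_Mapping.lookup (ext_to_model F) s = Poly_Mapping.lookup g s"
      using coeff[of i "i + j"] by (simp add: s lookup_ext_to_model[OF F])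
  qed
  then show ?thesis using F by (intro bexI[of _ F]) (auto simp: F_def)
qed

lemma ext_to_model_hom: "ext_to_model \<in> ring_hom C (qmodel q)"
  by (rule ring_hom_memI) (simp_all add: qmodel_simps ext_to_model_mult ext_to_model_add ext_to_model_one)

lemma ext_to_model_kernel: "B = {F \<in> carrier C. ext_to_model F = \<zero>\<^bsub>qmodel q\<^esub>}"
proof -
  have "ext_to_model F = 0 \<longleftrightarrow> (\<forall>n. null_homotopic R P d P d (int n) (F n))" if F: "F \<in> carrier C" for F
  proof -
    have "ext_to_model F = 0 \<longleftrightarrow> (\<forall>i j. ext_class (i + j) (F (i + j)) i = 0)"
      by (auto simp: poly_mapping_eq_iff fun_eq_iff lookup_ext_to_model[OF F])
    also have "\<dots> \<longleftrightarrow> (\<forall>n. \<forall>l\<le>n. ext_class n (F n) l = 0)"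
      by (metis le_add1 le_add_diff_inverse)
    finally show ?thesis by (simp only: ext_class_zero_iff[OF cocycle_ring_closed(1)[OF cP F]])
  qed
  then show ?thesis
    by (auto simp: coboundary_ideal_iff[OF cP] qmodel_simps)
qed

lemma Ext_algebra_to_model:
  shows "(\<lambda>X'. the_elem (ext_to_model ` X')) \<in> graded_algebra_iso (Ext_algebra (Lambda q) P d) (qmodel q)"
    and "ring (Ext_algebra (Lambda q) P d)"
    and "scalar (Ext_algebra (Lambda q) P d) c \<in> carrier (Ext_algebra (Lambda q) P d)"
    and "homog (Ext_algebra (Lambda q) P d) n \<subseteq> carrier (Ext_algebra (Lambda q) P d)"
proof -
  let ?E = "Ext_algebra R P d" and ?\<phi> = "\<lambda>X'. the_elem (ext_to_model ` X')"
  have surj: "ext_to_model ` carrier C = carrier (qmodel q)"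
  proof -
    have "g \<in> ext_to_model ` carrier C" for g
      using ext_to_model_lift[of g] by blast
    then show ?thesis by (auto simp: qmodel_simps)
  qed
  note Q = quotient_ring_iso[OF ring_cocycle_ring[OF cP] ring_qmodel ext_to_model_hom surj ext_to_model_kernel]
  have ops: "carrier ?E = carrier (C Quot B)" "monoid.mult ?E = monoid.mult (C Quot B)"
    "monoid.one ?E = monoid.one (C Quot B)" "ring.zero ?E = ring.zero (C Quot B)" "ring.add ?E = ring.add (C Quot B)"
    by (simp_all add: Ext_algebra_def Let_def)
  show ring: "ring ?E" by (rule ring_cong_operations[OF Q(3) ops])
  have sc: "scalar ?E c = B +>\<^bsub>C\<^esub> ext_scalar c" for c
    by (simp add: Ext_algebra_def Let_def ext_scalar_def)
  let ?H = "\<lambda>n. {F \<in> carrier C. \<forall>m. m \<noteq> n \<longrightarrow> F m = zero_map P (int m)}"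
  have ho: "homog ?E n = (\<lambda>F. B +>\<^bsub>C\<^esub> F) ` ?H n" for n
    by (auto simp: Ext_algebra_def Let_def)
  have coset: "B +>\<^bsub>C\<^esub> F \<in> carrier ?E" if "F \<in> carrier C" for F
    using that by (auto simp: ops FactRing_def A_RCOSETS_def')
  show "scalar ?E c \<in> carrier ?E" unfolding sc by (rule coset[OF ext_scalar_closed])
  show "homog ?E n \<subseteq> carrier ?E" unfolding ho using coset by blast
  have "?\<phi> \<in> ring_iso ?E (qmodel q)"
    using Q(1) by (simp add: ring_iso_def ring_hom_def ops)
  moreover have "?\<phi> (scalar ?E c) = scalar (qmodel q) c" for c
    unfolding sc Q(2)[OF ext_scalar_closed] ext_to_model_scalar by (simp add: qmodel_simps)
  moreover have "?\<phi> ` homog ?E n = homog (qmodel q) n" for n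
  proof -
    have "?\<phi> ` homog ?E n = ext_to_model ` ?H n"
      unfolding ho image_image by (rule image_cong[OF refl]) (use Q(2) in simp)
    also have "\<dots> = homog (qmodel q) n"
    proof (intro subset_antisym subsetI)
      fix g assume "g \<in> ext_to_model ` ?H n"
      then obtain F where F: "F \<in> carrier C" "\<And>m. m \<noteq> n \<Longrightarrow> F m = zero_map P (int m)" "g = ext_to_model F" by blast
      have "i + j = n" if "(i, j) \<in> Poly_Mapping.keys g" for i j
      proof (rule ccontr)
        assume "i + j \<noteq> n"
        then have "F (i + j) = zero_map P (int (i + j))" by (rule F(2))
        then have "Poly_Mapping.lookup g (i, j) = 0"
          using ext_class_zero_map[OF le_add1, of i j] by (simp only: F(3) lookup_ext_to_model[OF F(1)])
        then show False using that by (simp add: in_keys_iff)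
      qed
      then show "g \<in> homog (qmodel q) n" by (auto simp: qmodel_simps)
    next
      fix g assume g: "g \<in> homog (qmodel q) n"
      obtain F where F: "F \<in> carrier C" "ext_to_model F = g"
        "\<And>m. (\<forall>i\<le>m. Poly_Mapping.lookup g (i, m - i) = 0) \<Longrightarrow> F m = zero_map P (int m)"
        using ext_to_model_lift[of g] by auto
      have "F m = zero_map P (int m)" if "m \<noteq> n" for m
      proof (rule F(3), intro allI impI)
        fix i assume "i \<le> m"
        show "Poly_Mapping.lookup g (i, m - i) = 0"
        proof (rule ccontr)
          assume "Poly_Mapping.lookup g (i, m - i) \<noteq> 0"
          then have "(i, m - i) \<in> Poly_Mapping.keys g" by (simp add: in_keys_iff)
          then have "i + (m - i) = n" using g by (auto simp: qmodel_simps)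
          then show False using \<open>i \<le> m\<close> that by simp
        qed
      qed
      then show "g \<in> ext_to_model ` ?H n" using F(1,2) by blast
    qed
    finally show ?thesis .
  qed
  ultimately show "?\<phi> \<in> graded_algebra_iso ?E (qmodel q)"
    by (simp add: graded_algebra_iso_def)
qed

end

text \<open>Both complexes are projective resolutions of the same module, so the comparison theorem
  in degree 0 applies to the two augmentations in either direction.\<close>

lemma ext_comparison_exists:
  assumes res: "projective_resolution (Lambda q) simple_module P d e"
  shows "\<exists>u v. ext_comparison q P d e u v"
proof -
  note cP = projective_resolutionD(1)[OF res]
  note LN = left_module_simple_module
  have "koszul_aug q (koszul_diff q (0 + 1) a) = \<zero>\<^bsub>simple_module\<^esub>" if "a \<in> carrier (koszul q (0 + 1))" for a
    using projective_resolutionD(8)[OF koszul_resolution, of a q] that by simp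
  from chain_map_lift[where n = 0 and P = "koszul q" and d = "koszul_diff q" and f = "koszul_aug q", OF lcomplex_koszul projective_koszul LN res koszul_aug_hom this]
  obtain u where u: "u \<in> chain_maps (Lambda q) (koszul q) (koszul_diff q) P d 0"
    "\<And>a. a \<in> carrier (koszul q 0) \<Longrightarrow> e (u 0 a) = koszul_aug q a" by blast
  have "e (d (0 + 1) x) = \<zero>\<^bsub>simple_module\<^esub>" if "x \<in> carrier (P (0 + 1))" for x
    using projective_resolutionD(8)[OF res, of x] that by simp
  from chain_map_lift[where n = 0 and P = P and d = d and f = e, OF cP projective_resolutionD(2)[OF res] LN koszul_resolution projective_resolutionD(4)[OF res] this]
  obtain v where v: "v \<in> chain_maps (Lambda q) P d (koszul q) (koszul_diff q) 0"
    "\<And>x. x \<in> carrier (P 0) \<Longrightarrow> koszul_aug q (v 0 x) = e x" by blast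
  have "ext_comparison q P d e u v" by (rule ext_comparison.intro[OF res u v])
  then show ?thesis by blast
qed

theorem proposition2p1:
  fixes q :: "'k::field"
    and P :: "int \<Rightarrow> ('k free_alg set, 'p) module"
    and d :: "int \<Rightarrow> 'p \<Rightarrow> 'p"
    and e :: "'p \<Rightarrow> 'k"
  assumes "projective_resolution (Lambda q) simple_module P d e"
  shows "(\<exists>\<phi>. \<phi> \<in> graded_algebra_iso (qplane q) (Ext_algebra (Lambda q) P d)) \<and>
    (\<forall>\<phi> \<in> graded_algebra_iso (qplane q) (Ext_algebra (Lambda q) P d).
      (\<not> is_root_of_unity q \<longrightarrow>
        graded_centre (Ext_algebra (Lambda q) P d) = \<phi> ` range (scalar (qplane q))) \<and>
      (\<forall>r. is_primitive_root_of_unity r q \<and> (even r \<or> CHAR('k) = 2) \<longrightarrow>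
        graded_centre (Ext_algebra (Lambda q) P d) =
          \<phi> ` subalgebra_generated (qplane q)
            {qplane_var q LX [^]\<^bsub>qplane q\<^esub> r, qplane_var q LY [^]\<^bsub>qplane q\<^esub> r}) \<and>
      (\<forall>r. is_primitive_root_of_unity r q \<and> odd r \<and> CHAR('k) \<noteq> 2 \<longrightarrow>
        graded_centre (Ext_algebra (Lambda q) P d) =
          \<phi> ` subalgebra_generated (qplane q)
            {qplane_var q LX [^]\<^bsub>qplane q\<^esub> (2 * r),
             qplane_var q LX [^]\<^bsub>qplane q\<^esub> r \<otimes>\<^bsub>qplane q\<^esub> qplane_var q LY [^]\<^bsub>qplane q\<^esub> r,
             qplane_var q LY [^]\<^bsub>qplane q\<^esub> (2 * r)}))"
proof -
  let ?E = "Ext_algebra (Lambda q) P d"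
  obtain u v where "ext_comparison q P d e u v" using ext_comparison_exists[OF assms] by blast
  then interpret ext_comparison q P d e u v .
  \<comment> \<open>The quantum plane maps to the model, and from there one returns along the
    inverse of the isomorphism on the Ext algebra.\<close>
  have "inv_into (carrier ?E) (\<lambda>X'. the_elem (ext_to_model ` X')) \<in> graded_algebra_iso (qmodel q) ?E"
    by (rule graded_algebra_iso_inv[OF Ext_algebra_to_model(2,1,3,4)])
  from graded_algebra_iso_comp[OF qplane_to_model_iso this]
  have exists: "\<exists>\<phi>. \<phi> \<in> graded_algebra_iso (qplane q) ?E" by blast
  \<comment> \<open>The claim ranges over every identification; each one carries graded centre onto
    graded centre, so the formulas do not depend on the choice.\<close>
  have centre: "graded_centre ?E = \<phi> ` graded_centre (qplane q)" if "\<phi> \<in> graded_algebra_iso (qplane q) ?E" for \<phi>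
    by (rule graded_centre_image[OF ring_qplane Ext_algebra_to_model(2) that qplane_closed(2)])
  show ?thesis
  proof (intro conjI exists ballI allI impI, goal_cases)
    case (1 \<phi>)
    show ?case unfolding centre[OF 1(1)] graded_centre_qplane(1)[OF 1(2)] ..
  next
    case (2 \<phi> r)
    show ?case unfolding centre[OF 2(1)] graded_centre_qplane(2)[OF 2(2)] ..
  next
    case (3 \<phi> r)
    show ?case unfolding centre[OF 3(1)] graded_centre_qplane(3)[OF 3(2)] ..
  qed
qed

end
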